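(* Let $m,N\geq 1$ be integers, let $\mathbb{M}$ be the space of real $m\times N$ matrices and let $L:\mathbb{M}\to[0,\infty[$ be continuous (and finite everywhere). Assume that: (D$_1$) there exists $\lambda:\,]1,\infty[\,\to\,]0,1[$ such that $\lambda(R)\to1$ as $R\to\infty$ and $$\lim_{R\to\infty}\sup_{|\xi|\geq R}\frac{L(\lambda(R)\xi)}{L(\xi)}=0;$$ (D$_2$) there exists $\alpha_1>0$ such that $L(t\xi)\leq\alpha_1(1+L(\xi))$ for all $\xi\in\mathbb{M}$ and all $t\in[0,1]$; (D$_3$) for every $\xi\in\mathbb{M}$ there exist $\varepsilon>0$, $\alpha_{2,\xi}>0$ and $c_\xi>0$ such that $L(\xi+t(\zeta-\xi)+a)\leq\alpha_{2,\xi}(1+L(\zeta))$ for all $t\in[0,1]$, all $\zeta\in\mathbb{M}$ with $|\zeta-\xi|\geq c_\xi$ and all $a\in\mathbb{M}$ with $|a|\leq\varepsilon$. Then for every $p\in\,]N,\infty[$ the following condition (C$_{p,p}$) holds: for every $\xi\in\mathbb{M}$ and every sequence $\{v_n\}_n\subset W^{1,p}(Y;\mathbb{R}^m)$ such that $v_n\rightharpoonup l_\xi$ in $W^{1,p}(Y;\mathbb{R}^m)$ and $\sup_n\int_Y L(\nabla v_n(y))\,dy<\infty$, there exist a subsequence $\{v_n\}_n$ (not relabeled) and $\{w_n\}_n\subset l_\xi+W^{1,p}_0(Y;\mathbb{R}^m)$ such that $|\nabla v_n-\nabla w_n|\to0$ in measure on $Y$ and $\{L(\nabla w_n)\}_n$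 is equi-integrable on $Y$.
   Context: $Y:=\,]-\tfrac12,\tfrac12[^N$ is the open unit cube of $\mathbb{R}^N$, and for $\xi\in\mathbb{M}$, $l_\xi(y):=\xi y$. The symbol $\rightharpoonup$ denotes weak convergence. *)

theory Defs
  imports "HOL-Analysis.Analysis"
begin

text \<open>Sobolev functions are represented by actual functions \<open>u\<close> rather than by their almost
  everywhere classes; all notions below depend only on the restriction of \<open>u\<close> to \<open>\<Omega>\<close>, up to
  null sets. A real \<open>m \<times> N\<close> matrix is an element of \<^typ>\<open>real^'n^'m\<close>, whose norm is the Euclidean
  (Frobenius) norm. The set \<open>\<Omega>\<close> is always meant to be open.\<close>

definition unit_cube :: "(real^'n) set" where
  "unit_cube = {y. \<forall>i. - (1/2) < y $ i \<and> y $ i < 1/2}"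

primrec C_k :: "nat \<Rightarrow> (real^'n \<Rightarrow> real) \<Rightarrow> bool" where
  "C_k 0 f \<longleftrightarrow> continuous_on UNIV f"
| "C_k (Suc k) f \<longleftrightarrow>
     (\<forall>x. f differentiable (at x)) \<and> (\<forall>h. C_k k (\<lambda>x. frechet_derivative f (at x) h))"

definition test_function :: "(real^'n) set \<Rightarrow> (real^'n \<Rightarrow> real) \<Rightarrow> bool" where
  "test_function \<Omega> \<phi> \<longleftrightarrow>
     (\<forall>k. C_k k \<phi>) \<and> compact (closure {x. \<phi> x \<noteq> 0}) \<and> closure {x. \<phi> x \<noteq> 0} \<subseteq> \<Omega>"

definition Lp :: "(real^'n) set \<Rightarrow> real \<Rightarrow> (real^'n \<Rightarrow> 'b::euclidean_space) \<Rightarrow> bool" where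
  "Lp \<Omega> p f \<longleftrightarrow> f \<in> borel_measurable (lebesgue_on \<Omega>) \<and>
     integrable (lebesgue_on \<Omega>) (\<lambda>x. norm (f x) powr p)"

definition locally_integrable :: "(real^'n) set \<Rightarrow> (real^'n \<Rightarrow> 'b::euclidean_space) \<Rightarrow> bool" where
  "locally_integrable \<Omega> f \<longleftrightarrow> (\<forall>K. compact K \<and> K \<subseteq> \<Omega> \<longrightarrow> f absolutely_integrable_on K)"

text \<open>The entry in row \<open>i\<close> and column \<open>j\<close> of the gradient is the distributional derivative of the
  \<open>i\<close>-th component in the \<open>j\<close>-th coordinate direction.\<close>

definition has_weak_gradient ::
    "(real^'n) set \<Rightarrow> (real^'n \<Rightarrow> real^'m) \<Rightarrow> (real^'n \<Rightarrow> real^'n^'m) \<Rightarrow> bool" where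
  "has_weak_gradient \<Omega> u G \<longleftrightarrow> locally_integrable \<Omega> u \<and> locally_integrable \<Omega> G \<and>
     (\<forall>\<phi> i j. test_function \<Omega> \<phi> \<longrightarrow>
        (LINT x|lebesgue_on \<Omega>. u x $ i * frechet_derivative \<phi> (at x) (axis j 1)) =
        - (LINT x|lebesgue_on \<Omega>. G x $ i $ j * \<phi> x))"

text \<open>Weak gradients are unique up to null sets, so the choice of the representative is immaterial.\<close>

definition wgrad :: "(real^'n) set \<Rightarrow> (real^'n \<Rightarrow> real^'m) \<Rightarrow> real^'n \<Rightarrow> real^'n^'m" where
  "wgrad \<Omega> u = (SOME G. has_weak_gradient \<Omega> u G)"

definition W1p :: "(real^'n) set \<Rightarrow> real \<Rightarrow> (real^'n \<Rightarrow> real^'m) set" where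
  "W1p \<Omega> p = {u. Lp \<Omega> p u \<and> (\<exists>G. has_weak_gradient \<Omega> u G \<and> Lp \<Omega> p G)}"

definition W1p_norm :: "(real^'n) set \<Rightarrow> real \<Rightarrow> (real^'n \<Rightarrow> real^'m) \<Rightarrow> real" where
  "W1p_norm \<Omega> p u =
     ((LINT x|lebesgue_on \<Omega>. norm (u x) powr p) +
      (LINT x|lebesgue_on \<Omega>. norm (wgrad \<Omega> u x) powr p)) powr (1 / p)"

definition W1p0 :: "(real^'n) set \<Rightarrow> real \<Rightarrow> (real^'n \<Rightarrow> real^'m) set" where
  "W1p0 \<Omega> p = {u \<in> W1p \<Omega> p. \<forall>\<epsilon>>0. \<exists>\<phi>. (\<forall>i. test_function \<Omega> (\<lambda>x. \<phi> x $ i)) \<and>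
     W1p_norm \<Omega> p (\<lambda>x. u x - \<phi> x) < \<epsilon>}"

text \<open>Elements of the topological dual. Boundedness forces \<open>F\<close> to respect equality almost
  everywhere.\<close>

definition W1p_dual :: "(real^'n) set \<Rightarrow> real \<Rightarrow> ((real^'n \<Rightarrow> real^'m) \<Rightarrow> real) set" where
  "W1p_dual \<Omega> p = {F.
     (\<forall>u\<in>W1p \<Omega> p. \<forall>v\<in>W1p \<Omega> p. F (\<lambda>x. u x + v x) = F u + F v) \<and>
     (\<forall>c. \<forall>u\<in>W1p \<Omega> p. F (\<lambda>x. c *\<^sub>R u x) = c * F u) \<and>
     (\<exists>C. \<forall>u\<in>W1p \<Omega> p. \<bar>F u\<bar> \<le> C * W1p_norm \<Omega> p u)}"

definition W1p_weakly_tendsto ::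
    "(real^'n) set \<Rightarrow> real \<Rightarrow> (nat \<Rightarrow> real^'n \<Rightarrow> real^'m) \<Rightarrow> (real^'n \<Rightarrow> real^'m) \<Rightarrow> bool" where
  "W1p_weakly_tendsto \<Omega> p v u \<longleftrightarrow> (\<forall>n. v n \<in> W1p \<Omega> p) \<and> u \<in> W1p \<Omega> p \<and>
     (\<forall>F\<in>W1p_dual \<Omega> p. (\<lambda>n. F (v n)) \<longlonglongrightarrow> F u)"

definition tendsto_zero_in_measure :: "'a measure \<Rightarrow> (nat \<Rightarrow> 'a \<Rightarrow> real) \<Rightarrow> bool" where
  "tendsto_zero_in_measure M f \<longleftrightarrow> (\<forall>n. f n \<in> borel_measurable M) \<and>
     (\<forall>\<epsilon>>0. (\<lambda>n. emeasure M {x \<in> space M. \<epsilon> \<le> \<bar>f n x\<bar>}) \<longlonglongrightarrow> 0)"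

text \<open>Equi-integrability in the sense of the Dunford--Pettis theorem; this is unrelated to
  \<^const>\<open>equiintegrable_on\<close>, which concerns gauge integrals.\<close>

definition equi_integrable :: "'a measure \<Rightarrow> (nat \<Rightarrow> 'a \<Rightarrow> real) \<Rightarrow> bool" where
  "equi_integrable M f \<longleftrightarrow> (\<forall>n. integrable M (f n)) \<and>
     (\<exists>C. \<forall>n. (LINT x|M. \<bar>f n x\<bar>) \<le> C) \<and>
     (\<forall>\<epsilon>>0. \<exists>\<delta>>0. \<forall>n. \<forall>E\<in>sets M. emeasure M E < ennreal \<delta> \<longrightarrow>
        (LINT x:E|M. \<bar>f n x\<bar>) < \<epsilon>)"

text \<open>The quotient in the first growth condition is taken in \<^typ>\<open>ennreal\<close>, so that
  \<open>a / 0 = \<infinity>\<close> for \<open>a > 0\<close> (and \<open>0 / 0 = 0\<close>), and the supremum may be infinite.\<close>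

definition cond_D1 :: "(real^'n^'m \<Rightarrow> real) \<Rightarrow> bool" where
  "cond_D1 L \<longleftrightarrow> (\<exists>\<Lambda>::real \<Rightarrow> real. (\<forall>R>1. 0 < \<Lambda> R \<and> \<Lambda> R < 1) \<and> (\<Lambda> \<longlongrightarrow> 1) at_top \<and>
     ((\<lambda>R. SUP \<xi>\<in>{\<xi>. R \<le> norm \<xi>}. ennreal (L (\<Lambda> R *\<^sub>R \<xi>)) / ennreal (L \<xi>)) \<longlongrightarrow> 0) at_top)"

definition cond_D2 :: "(real^'n^'m \<Rightarrow> real) \<Rightarrow> bool" where
  "cond_D2 L \<longleftrightarrow> (\<exists>\<alpha>>0. \<forall>\<xi>. \<forall>t\<in>{0..1}. L (t *\<^sub>R \<xi>) \<le> \<alpha> * (1 + L \<xi>))"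

definition cond_D3 :: "(real^'n^'m \<Rightarrow> real) \<Rightarrow> bool" where
  "cond_D3 L \<longleftrightarrow> (\<forall>\<xi>. \<exists>\<epsilon>>0. \<exists>\<alpha>>0. \<exists>c>0. \<forall>t\<in>{0..1}. \<forall>\<zeta> a.
     c \<le> norm (\<zeta> - \<xi>) \<and> norm a \<le> \<epsilon> \<longrightarrow> L (\<xi> + t *\<^sub>R (\<zeta> - \<xi>) + a) \<le> \<alpha> * (1 + L \<zeta>))"

end

theory Submission
  imports Defs "HOL-Library.Diagonal_Subsequence"
begin

text \<open>Pick \<open>R\<^sub>n \<rightarrow> \<infinity>\<close> so slowly that, along a subsequence, \<open>L(\<nabla>v\<^sub>n)\<close> restricted to
  \<open>{\<bar>\<nabla>v\<^sub>n\<bar> \<le> R\<^sub>n}\<close> is equi-integrable, and set \<open>\<lambda>\<^sub>n = \<lambda>(R\<^sub>n)\<close>,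
  \<open>w\<^sub>n = l\<^sub>\<xi> + \<phi>\<^sub>n (\<lambda>\<^sub>n v\<^sub>n - l\<^sub>\<xi>)\<close> with cut-offs \<open>\<phi>\<^sub>n\<close> that exhaust the cube. Since
  \<open>p > N\<close>, Morrey's estimate turns weak into uniform convergence on compact subsets of the cube, so
  \<open>\<nabla>w\<^sub>n = \<xi> + \<phi>\<^sub>n (\<lambda>\<^sub>n \<nabla>v\<^sub>n - \<xi>) + a\<^sub>n\<close> with \<open>a\<^sub>n = (\<lambda>\<^sub>n v\<^sub>n - l\<^sub>\<xi>) \<otimes> \<nabla>\<phi>\<^sub>n\<close> uniformly
  small if \<open>\<phi>\<^sub>n\<close> varies slowly enough. Then the third growth condition bounds \<open>L(\<nabla>w\<^sub>n)\<close> by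
  \<open>1 + L(\<lambda>\<^sub>n \<nabla>v\<^sub>n)\<close>, which is controlled by the second condition where \<open>\<bar>\<nabla>v\<^sub>n\<bar> \<le> R\<^sub>n\<close> and
  tends to \<open>0\<close> in \<open>L\<^sup>1\<close> elsewhere by the first one.\<close>

section \<open>Smooth functions and test functions\<close>

text \<open>The obstacle is that \<open>L\<close> has no growth bound from above. The error made by
  a cut-off therefore cannot be absorbed in an integral estimate: the third condition tolerates only
  matrices \<open>a\<close> of norm at most a fixed number, so the error must be small uniformly,
  and this is where p > N enters. The order of choices matters: the k-th cut-off and its derivative
  bound \<open>m k\<close> are fixed first, and only then is a member of the sequence taken so far
  out that the function multiplied by the derivative is of size 1 / \<open>m k\<close> on the
  support. The truncation level attached to a member is its index in an intermediate subsequence, so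
  passing to a further subsequence moves index and level together and keeps the equi-integrability.
  Where the scaled gradient is close to \<open>\<xi>\<close> the third condition says nothing; there
  the new gradient stays in a fixed ball and continuity bounds \<open>L\<close>. Convergence in
  measure holds because on the k-th compact set the two gradients differ by the factor 1 -
  \<open>lam k\<close>, while the gradients are bounded in L^p and these sets exhaust the
  cube.\<close>

lemma C_k_SucI:
  assumes "\<And>x. (f has_derivative f' x) (at x)" "\<And>h. C_k k (\<lambda>x. f' x h)"
  shows "C_k (Suc k) f"
proof -
  have "frechet_derivative f (at x) = f' x" for x
    using frechet_derivative_at[OF assms(1)] by simp
  then show ?thesis
    using assms by (auto simp: differentiable_def)
qed

lemma C_k_SucD:
  assumes "C_k (Suc k) f"
  shows "(f has_derivative frechet_derivative f (at x)) (at x)"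
    "C_k k (\<lambda>x. frechet_derivative f (at x) h)"
  using assms by (auto simp: frechet_derivative_works)

lemma C_k_Suc: "C_k (Suc k) f \<Longrightarrow> C_k k f"
proof (induction k arbitrary: f)
  case 0
  then show ?case
    using C_k_SucD(1)[OF 0] by (auto intro!: continuous_at_imp_continuous_on has_derivative_continuous)
next
  case (Suc k)
  show ?case
    by (rule C_k_SucI[OF C_k_SucD(1)[OF Suc.prems]]) (intro Suc.IH C_k_SucD(2)[OF Suc.prems])
qed

lemma C_k_const: "C_k k (\<lambda>x. c)"
proof (induction k arbitrary: c)
  case (Suc k)
  show ?case by (rule C_k_SucI[where f'="\<lambda>x h. 0"]) (auto intro: Suc)
qed auto

lemma C_k_add: "C_k k f \<Longrightarrow> C_k k g \<Longrightarrow> C_k k (\<lambda>x. f x + g x)"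
proof (induction k arbitrary: f g)
  case (Suc k)
  show ?case
    by (rule C_k_SucI[OF has_derivative_add[OF C_k_SucD(1)[OF Suc.prems(1)] C_k_SucD(1)[OF Suc.prems(2)]]])
       (intro Suc.IH C_k_SucD(2)[OF Suc.prems(1)] C_k_SucD(2)[OF Suc.prems(2)])
qed (auto intro: continuous_intros)

lemma C_k_mult: "C_k k f \<Longrightarrow> C_k k g \<Longrightarrow> C_k k (\<lambda>x. f x * g x)"
proof (induction k arbitrary: f g)
  case (Suc k)
  show ?case
    by (rule C_k_SucI[OF has_derivative_mult[OF C_k_SucD(1)[OF Suc.prems(1)] C_k_SucD(1)[OF Suc.prems(2)]]])
       (intro C_k_add Suc.IH C_k_SucD(2)[OF Suc.prems(1)] C_k_SucD(2)[OF Suc.prems(2)]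
        C_k_Suc[OF Suc.prems(1)] C_k_Suc[OF Suc.prems(2)])
qed (auto intro: continuous_intros)

lemma C_k_bounded_linear: "bounded_linear f \<Longrightarrow> C_k k f"
proof (induction k arbitrary: f)
  case 0
  then show ?case by (simp add: linear_continuous_on)
next
  case (Suc k)
  show ?case
    by (rule C_k_SucI[where f'="\<lambda>x h. f h"]) 
      (auto intro: bounded_linear_imp_has_derivative Suc.prems C_k_const)
qed

lemma C_k_reflect: "C_k k f \<Longrightarrow> C_k k (\<lambda>y. f (x - y))"
proof (induction k arbitrary: f)
  case 0
  then show ?case by (auto intro!: continuous_intros continuous_on_compose2[of UNIV f])
next
  case (Suc k)
  note d = C_k_SucD(1)[OF Suc.prems]
  have "((\<lambda>y. f (x - y)) has_derivative (\<lambda>h. - frechet_derivative f (at (x - y)) h)) (at y)" for y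
  proof -
    have "((\<lambda>y. f (x - y)) has_derivative (\<lambda>h. frechet_derivative f (at (x - y)) (0 - h))) (at y)"
      by (rule has_derivative_compose[OF _ d, where f="\<lambda>y. x - y"]) (intro derivative_intros)
    then show ?thesis
      using linear_neg[OF has_derivative_linear[OF d]] by (simp add: o_def)
  qed
  then show ?case
  proof (rule C_k_SucI)
    fix h
    show "C_k k (\<lambda>y. - frechet_derivative f (at (x - y)) h)"
      using C_k_mult[OF C_k_const[of k "-1"] Suc.IH[OF C_k_SucD(2)[OF Suc.prems, of h]]] by simp
  qed
qed

section \<open>A smooth bump function\<close>

definition inv_pow_exp :: "nat \<Rightarrow> real \<Rightarrow> real" where
  "inv_pow_exp k t = (if 0 < t then (1 / t) ^ k * exp (- 1 / t) else 0)"

lemma inv_pow_exp_nonneg: "0 \<le> inv_pow_exp k t"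
  by (simp add: inv_pow_exp_def)

lemma inv_pow_exp_tendsto_0: "(inv_pow_exp k \<longlongrightarrow> 0) (at 0)"
proof -
  have "((\<lambda>t::real. (1 / t) ^ k / exp (1 / t)) \<longlongrightarrow> 0) (at_right 0)"
    using filterlim_compose[OF tendsto_power_div_exp_0[of k] filterlim_inverse_at_top_right]
    by (simp add: inverse_eq_divide)
  moreover have "eventually (\<lambda>t. (1 / t) ^ k / exp (1 / t) = inv_pow_exp k t) (at_right 0)"
    by (auto simp: eventually_at_right_field inv_pow_exp_def exp_minus divide_simps intro!: exI[of _ 1])
  ultimately have r: "(inv_pow_exp k \<longlongrightarrow> 0) (at_right 0)"
    by (rule Lim_transform_eventually)
  have "eventually (\<lambda>t. 0 = inv_pow_exp k t) (at_left 0)"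
    by (auto simp: eventually_at_left_field inv_pow_exp_def intro!: exI[of _ "-1"])
  then have "(inv_pow_exp k \<longlongrightarrow> 0) (at_left 0)"
    by (rule Lim_transform_eventually[OF tendsto_const])
  with r show ?thesis by (simp add: filterlim_at_split)
qed

lemma inv_pow_exp_deriv:
  "(inv_pow_exp k has_real_derivative inv_pow_exp (k + 2) t - real k * inv_pow_exp (k + 1) t) (at t)"
proof -
  consider "t > 0" | "t < 0" | "t = 0" by linarith
  then show ?thesis
  proof cases
    case 1
    have "((\<lambda>t. (1 / t) ^ k) has_real_derivative - real k * (1 / t) ^ (k + 1)) (at t)"
      by (rule DERIV_cong[OF DERIV_power[where D="- (1 / t)\<^sup>2"]])
        (use 1 in \<open>auto intro!: derivative_eq_intros simp: power2_eq_square, cases k, auto\<close>)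
    moreover have "((\<lambda>t. exp (- 1 / t)) has_real_derivative (1 / t)\<^sup>2 * exp (- 1 / t)) (at t)"
      using 1 by (auto intro!: derivative_eq_intros simp: power2_eq_square)
    ultimately have "((\<lambda>t. (1 / t) ^ k * exp (- 1 / t)) has_real_derivative
       inv_pow_exp (k + 2) t - real k * inv_pow_exp (k + 1) t) (at t)"
      by (rule DERIV_cong[OF DERIV_mult]) (use 1 in \<open>simp add: inv_pow_exp_def algebra_simps power2_eq_square\<close>)
    then show ?thesis
      by (rule has_field_derivative_transform_within_open[where S="{0<..}"])
        (use 1 in \<open>auto simp: inv_pow_exp_def\<close>)
  next
    case 2
    have "((\<lambda>t. 0) has_real_derivative inv_pow_exp (k + 2) t - real k * inv_pow_exp (k + 1) t) (at t)"
      using 2 by (auto simp: inv_pow_exp_def)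
    then show ?thesis
      by (rule has_field_derivative_transform_within_open[where S="{..<0}"])
        (use 2 in \<open>auto simp: inv_pow_exp_def\<close>)
  next
    case 3
    \<comment> \<open>At 0 the difference quotient of one member of the family is the next member,
      also at h = 0, where division by zero gives 0. The derivative is thus a limit already
      computed.\<close>
    have "(\<lambda>h. (inv_pow_exp k (0 + h) - inv_pow_exp k 0) / h) = inv_pow_exp (Suc k)"
      by (auto simp: inv_pow_exp_def fun_eq_iff)
    then have "(inv_pow_exp k has_real_derivative 0) (at 0)"
      using inv_pow_exp_tendsto_0[of "Suc k"] by (simp add: DERIV_def)
    then show ?thesis using 3 by (simp add: inv_pow_exp_def)
  qed
qed

text \<open>The functions t^(-k) exp(-1/t), extended by 0, are closed under differentiation up to
  linear combinations. The induction over the order runs for all \<open>k\<close> at once because a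
  derivative involves the indices k + 1 and k + 2.\<close>

lemma C_k_inv_pow_exp:
  fixes q :: "real^'n \<Rightarrow> real"
  assumes q: "\<And>k. C_k k q"
  shows "C_k j (\<lambda>x. inv_pow_exp k (q x))"
proof (induction j arbitrary: k)
  case 0
  have "continuous_on UNIV (inv_pow_exp k)"
    by (rule DERIV_continuous_on) (auto intro: has_field_derivative_at_within inv_pow_exp_deriv)
  moreover have "continuous_on UNIV q" using q[of 0] by simp
  ultimately show ?case by (auto intro: continuous_on_compose2[of UNIV])
next
  case (Suc j)
  have "((\<lambda>x. inv_pow_exp k (q x)) has_derivative
     (\<lambda>h. (inv_pow_exp (k + 2) (q x) + (- real k) * inv_pow_exp (k + 1) (q x)) *
        frechet_derivative q (at x) h)) (at x)" for x
    by (rule has_derivative_eq_rhs[OF has_derivative_compose[OF C_k_SucD(1)[OF q[of "Suc 0"]]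
          inv_pow_exp_deriv[unfolded has_field_derivative_def]]]) auto
  then show ?case
    by (rule C_k_SucI) (intro C_k_mult C_k_add C_k_const Suc C_k_SucD(2) q)
qed

text \<open>The classical bump exp(-1 / (c - |x|^2)), vanishing where |x|^2 is at least
  \<open>c\<close>; normalised, it becomes a mollifier.\<close>

lemma C_k_bump:
  "C_k k (\<lambda>x::real^'n. inv_pow_exp 0 (c - x \<bullet> x))"
proof (rule C_k_inv_pow_exp)
  fix k
  have 1: "C_k k (\<lambda>x::real^'n. (-2) * (x \<bullet> h))" for h k
    by (intro C_k_mult C_k_const C_k_bounded_linear bounded_linear_inner_left)
  have "C_k (Suc k) (\<lambda>x::real^'n. c - x \<bullet> x)"
    by (rule C_k_SucI[OF _ 1]) (auto intro!: derivative_eq_intros simp: inner_commute)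
  then show "C_k k (\<lambda>x::real^'n. c - x \<bullet> x)" by (rule C_k_Suc)
qed

section \<open>Test functions: supports, closure properties, boundedness\<close>

lemma test_function_C_k: "test_function \<Omega> \<phi> \<Longrightarrow> C_k k \<phi>"
  by (simp add: test_function_def)

lemma test_function_continuous: "test_function \<Omega> \<phi> \<Longrightarrow> continuous_on UNIV \<phi>"
  using test_function_C_k[of \<Omega> \<phi> 0] by simp

lemma test_function_deriv:
  "test_function \<Omega> \<phi> \<Longrightarrow> (\<phi> has_derivative frechet_derivative \<phi> (at x)) (at x)"
  using C_k_SucD(1)[OF test_function_C_k] .

lemma test_functionI:
  assumes "\<And>k. C_k k \<phi>" "compact K" "K \<subseteq> \<Omega>" "\<And>x. x \<notin> K \<Longrightarrow> \<phi> x = 0"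
  shows "test_function \<Omega> \<phi>"
proof -
  have "closure {x. \<phi> x \<noteq> 0} \<subseteq> K"
    using assms by (intro closure_minimal) (auto intro: compact_imp_closed)
  then show ?thesis
    using assms(1-3) compact_Int_closed[OF assms(2) closed_closure, of "{x. \<phi> x \<noteq> 0}"]
    by (auto simp: test_function_def Int_absorb1)
qed

text \<open>The closed support also serves the derivative: a point outside it has a neighbourhood on
  which \<open>\<phi>\<close> vanishes.\<close>

lemma test_function_supportE:
  assumes "test_function \<Omega> \<phi>"
  obtains K where "compact K" "K \<subseteq> \<Omega>" "\<And>x. x \<notin> K \<Longrightarrow> \<phi> x = 0"
    "\<And>x. x \<notin> K \<Longrightarrow> frechet_derivative \<phi> (at x) = (\<lambda>h. 0)"
proof -
  let ?K = "closure {x. \<phi> x \<noteq> 0}"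
  have 0: "\<phi> x = 0" if "x \<notin> ?K" for x
    using contra_subsetD[OF closure_subset that] by simp
  have "frechet_derivative \<phi> (at x) = (\<lambda>h. 0)" if "x \<notin> ?K" for x
  proof -
    have "(\<phi> has_derivative (\<lambda>h. 0)) (at x)"
      by (rule has_derivative_transform_within_open[of "\<lambda>x. 0" _ _ _ "- ?K"])
        (use that in \<open>auto intro!: 0 has_derivative_const\<close>)
    from frechet_derivative_at[OF this] show ?thesis by simp
  qed
  then show ?thesis
    using assms by (intro that[OF _ _ 0]) (unfold test_function_def, blast+)
qed

lemma test_function_mult:
  assumes "test_function \<Omega> \<phi>" "\<And>k. C_k k \<psi>"
  shows "test_function \<Omega> (\<lambda>x. \<phi> x * \<psi> x)"
proof -
  obtain K where "compact K" "K \<subseteq> \<Omega>" "\<And>x. x \<notin> K \<Longrightarrow> \<phi> x = 0"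
    using test_function_supportE[OF assms(1)] by metis
  then show ?thesis
    using assms by (intro test_functionI[of _ K] C_k_mult test_function_C_k[OF assms(1)]) auto
qed

lemma test_function_partial:
  assumes "test_function \<Omega> \<phi>"
  shows "test_function \<Omega> (\<lambda>x. frechet_derivative \<phi> (at x) h)"
proof -
  obtain K where K: "compact K" "K \<subseteq> \<Omega>" "\<And>x. x \<notin> K \<Longrightarrow> frechet_derivative \<phi> (at x) = (\<lambda>h. 0)"
    using test_function_supportE[OF assms(1)] by metis
  show ?thesis
    by (intro test_functionI[OF _ K(1,2)] C_k_SucD(2)[OF test_function_C_k[OF assms]]) (simp add: K(3))
qed

text \<open>This makes the kernel of a convolution, as a function of the integration variable,
  admissible in the definition of weak derivatives.\<close>

lemma test_function_reflect:
  assumes "test_function UNIV \<phi>"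
  shows "test_function UNIV (\<lambda>y. \<phi> (x - y))"
proof -
  obtain K where K: "compact K" "\<And>x. x \<notin> K \<Longrightarrow> \<phi> x = 0"
    using test_function_supportE[OF assms(1)] by metis
  have "compact ((\<lambda>k. x - k) ` K)"
    using K(1) by (intro compact_continuous_image continuous_intros)
  moreover have "\<phi> (x - y) = 0" if "y \<notin> (\<lambda>k. x - k) ` K" for y
  proof (rule K(2), rule notI)
    assume "x - y \<in> K"
    then have "x - (x - y) \<in> (\<lambda>k. x - k) ` K" by (rule imageI)
    with that show False by simp
  qed
  ultimately show ?thesis
    by (intro test_functionI[of _ "(\<lambda>k. x - k) ` K"] C_k_reflect test_function_C_k[OF assms]) auto
qed

lemma test_function_mono: "test_function \<Omega> \<phi> \<Longrightarrow> \<Omega> \<subseteq> \<Omega>' \<Longrightarrow> test_function \<Omega>' \<phi>"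
  by (auto simp: test_function_def)

lemma test_function_bounded:
  assumes "test_function \<Omega> \<phi>"
  obtains M where "M > 0" "\<And>x. \<bar>\<phi> x\<bar> \<le> M"
proof -
  obtain K where K: "compact K" "\<And>x. x \<notin> K \<Longrightarrow> \<phi> x = 0"
    using test_function_supportE[OF assms(1)] by metis
  have "bounded (\<phi> ` K)"
    using K(1) test_function_continuous[OF assms]
    by (intro compact_imp_bounded compact_continuous_image) (auto intro: continuous_on_subset)
  then obtain M where M: "M > 0" "\<And>x. x \<in> K \<Longrightarrow> \<bar>\<phi> x\<bar> \<le> M"
    by (auto simp: bounded_pos)
  have "\<bar>\<phi> x\<bar> \<le> M" for x
    using M K(2)[of x] by (cases "x \<in> K") auto
  with M(1) show ?thesis by (rule that)
qed

lemma frechet_derivative_mult: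
  assumes "f differentiable at x" "g differentiable at x"
  shows "frechet_derivative (\<lambda>x. f x * g x :: real) (at x) h =
    f x * frechet_derivative g (at x) h + frechet_derivative f (at x) h * g x"
  using fun_cong[OF frechet_derivative_at[OF has_derivative_mult[OF assms[unfolded frechet_derivative_works]]], of h]
  by simp

section \<open>Convolution and mollifiers\<close>

lemma linear_eq_sum_Basis:
  fixes D :: "'a::euclidean_space \<Rightarrow> real"
  assumes "linear D"
  shows "D h = (\<Sum>b\<in>Basis. (h \<bullet> b) * D b)"
proof -
  interpret linear D by (fact assms)
  have "D h = D (\<Sum>b\<in>Basis. (h \<bullet> b) *\<^sub>R b)" by (simp add: euclidean_representation)
  then show ?thesis by (simp only: sum scaleR real_scaleR_def)
qed

text \<open>Expanding \<open>h\<close> in the standard basis leaves finitely many partial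
  derivatives, each of them again a test function and hence bounded.\<close>

lemma test_function_deriv_bound:
  fixes \<phi> :: "real^'n \<Rightarrow> real"
  assumes "test_function \<Omega> \<phi>"
  obtains M where "M > 0" "\<And>x h. \<bar>frechet_derivative \<phi> (at x) h\<bar> \<le> M * norm h"
proof -
  have "\<exists>M>0. \<forall>x. \<bar>frechet_derivative \<phi> (at x) b\<bar> \<le> M" for b
    using test_function_bounded[OF test_function_partial[OF assms]] by metis
  then obtain B where B: "\<And>b. B b > 0" "\<And>b x. \<bar>frechet_derivative \<phi> (at x) b\<bar> \<le> B b"
    by metis
  have "\<bar>frechet_derivative \<phi> (at x) h\<bar> \<le> (\<Sum>b\<in>Basis. B b) * norm h" for x h
  proof -
    have "frechet_derivative \<phi> (at x) h = (\<Sum>b\<in>Basis. (h \<bullet> b) * frechet_derivative \<phi> (at x) b)"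
      by (rule linear_eq_sum_Basis[OF has_derivative_linear[OF test_function_deriv[OF assms]]])
    also have "\<bar>\<dots>\<bar> \<le> (\<Sum>b\<in>Basis. norm h * B b)"
      by (intro order_trans[OF sum_abs] sum_mono)
        (auto simp: abs_mult intro!: mult_mono B Basis_le_norm)
    finally show ?thesis by (simp add: sum_distrib_left mult.commute)
  qed
  moreover have "(\<Sum>b\<in>(Basis::(real^'n) set). B b) > 0"
    using B(1) by (intro sum_pos) auto
  ultimately show ?thesis by (intro that)
qed

lemma test_function_lipschitz:
  fixes \<phi> :: "real^'n \<Rightarrow> real"
  assumes "test_function \<Omega> \<phi>"
  obtains M where "M > 0" "\<And>x y. \<bar>\<phi> x - \<phi> y\<bar> \<le> M * norm (x - y)"
proof -
  obtain M where M: "M > 0" "\<And>x h. \<bar>frechet_derivative \<phi> (at x) h\<bar> \<le> M * norm h"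
    using test_function_deriv_bound[OF assms] by blast
  have "norm (\<phi> x - \<phi> y) \<le> M * norm (x - y)" for x y
    by (rule differentiable_bound[OF convex_UNIV test_function_deriv[OF assms]])
      (auto intro!: onorm_le M(2))
  with M(1) show ?thesis by (intro that) auto
qed

text \<open>The first derivatives are Lipschitz. That \<open>M\<close> does not depend on
  \<open>x\<close> is what allows differentiation under a convolution integral when the other factor
  is merely integrable.\<close>

lemma test_function_taylor:
  fixes \<phi> :: "real^'n \<Rightarrow> real"
  assumes "test_function \<Omega> \<phi>"
  obtains M where "M > 0"
    "\<And>x h. \<bar>\<phi> (x + h) - \<phi> x - frechet_derivative \<phi> (at x) h\<bar> \<le> M * (norm h)\<^sup>2"
proof -
  have "\<exists>M>0. \<forall>x y. \<bar>frechet_derivative \<phi> (at x) b - frechet_derivative \<phi> (at y) b\<bar> \<le> M * norm (x - y)" for b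
    using test_function_lipschitz[OF test_function_partial[OF assms]] by metis
  then obtain B where B: "\<And>b. B b > 0"
    "\<And>b x y. \<bar>frechet_derivative \<phi> (at x) b - frechet_derivative \<phi> (at y) b\<bar> \<le> B b * norm (x - y)"
    by metis
  define M where "M = (\<Sum>b\<in>(Basis::(real^'n) set). B b)"
  have Mpos: "M > 0" unfolding M_def using B(1) by (intro sum_pos) auto
  have D: "\<bar>frechet_derivative \<phi> (at x) h - frechet_derivative \<phi> (at y) h\<bar> \<le> M * norm (x - y) * norm h" for x y h
  proof -
    note rep = linear_eq_sum_Basis[OF has_derivative_linear[OF test_function_deriv[OF assms]], of _ h]
    have "frechet_derivative \<phi> (at x) h - frechet_derivative \<phi> (at y) h =
      (\<Sum>b\<in>Basis. (h \<bullet> b) * (frechet_derivative \<phi> (at x) b - frechet_derivative \<phi> (at y) b))"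
      unfolding rep[of x] rep[of y] by (simp add: sum_subtractf right_diff_distrib)
    also have "\<bar>\<dots>\<bar> \<le> (\<Sum>b\<in>Basis. norm h * (B b * norm (x - y)))"
      by (intro order_trans[OF sum_abs] sum_mono)
        (auto simp: abs_mult intro!: mult_mono B Basis_le_norm)
    finally show ?thesis by (simp add: M_def sum_distrib_right sum_distrib_left mult_ac)
  qed
  have "\<bar>\<phi> (x + h) - \<phi> x - frechet_derivative \<phi> (at x) h\<bar> \<le> M * (norm h)\<^sup>2" for x h
  proof -
    \<comment> \<open>After subtraction of the derivative at \<open>x\<close>, the derivative of the
      difference is at most \<open>M * norm h\<close> on the ball of radius \<open>norm h\<close>;
      the mean value inequality supplies the second factor \<open>norm h\<close>.\<close>
    let ?g = "\<lambda>y. \<phi> y - frechet_derivative \<phi> (at x) y"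
    let ?S = "cball x (norm h)"
    have bl: "bounded_linear (frechet_derivative \<phi> (at x))"
      by (rule has_derivative_bounded_linear[OF test_function_deriv[OF assms]])
    note lin = bounded_linear_imp_has_derivative[OF bl]
    have "norm (?g (x + h) - ?g x) \<le> (M * norm h) * norm (x + h - x)"
    proof (rule differentiable_bound[where S="?S" and
          f'="\<lambda>y z. frechet_derivative \<phi> (at y) z - frechet_derivative \<phi> (at x) z"])
      show "(?g has_derivative (\<lambda>z. frechet_derivative \<phi> (at y) z - frechet_derivative \<phi> (at x) z)) (at y within ?S)" for y
        by (rule has_derivative_diff[OF has_derivative_at_withinI[OF test_function_deriv[OF assms]] lin])
      show "onorm (\<lambda>z. frechet_derivative \<phi> (at y) z - frechet_derivative \<phi> (at x) z) \<le> M * norm h" if "y \<in> ?S" for y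
      proof (rule onorm_le)
        fix z :: "real^'n"
        have "M * norm (y - x) * norm z \<le> M * norm h * norm z"
          using that Mpos by (intro mult_right_mono mult_left_mono) (auto simp: dist_norm norm_minus_commute)
        with D[of y z x] show "norm (frechet_derivative \<phi> (at y) z - frechet_derivative \<phi> (at x) z) \<le> M * norm h * norm z"
          by simp
      qed
    qed (auto simp: dist_norm)
    moreover have "frechet_derivative \<phi> (at x) (x + h) = frechet_derivative \<phi> (at x) x + frechet_derivative \<phi> (at x) h"
      using linear_add[OF has_derivative_linear[OF test_function_deriv[OF assms]]] .
    ultimately show ?thesis by (simp add: power2_eq_square algebra_simps)
  qed
  with Mpos show ?thesis by (rule that)
qed

section \<open>Convolution with a test function\<close>

lemma continuous_imp_measurable_lebesgue:
  fixes g :: "'a::euclidean_space \<Rightarrow> 'b::{real_normed_vector, second_countable_topology}"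
  shows "continuous_on UNIV g \<Longrightarrow> g \<in> borel_measurable lebesgue"
  by (simp add: borel_measurable_continuous_onI measurable_completion)

definition convolve :: "('a::euclidean_space \<Rightarrow> real) \<Rightarrow> ('a \<Rightarrow> real) \<Rightarrow> 'a \<Rightarrow> real" where
  "convolve \<eta> f x = (LINT y|lebesgue. \<eta> (x - y) * f y)"

lemma integrable_bounded_mult:
  fixes g f :: "'a \<Rightarrow> real"
  assumes "g \<in> borel_measurable M" "\<And>x. \<bar>g x\<bar> \<le> C" "integrable M f"
  shows "integrable M (\<lambda>x. g x * f x)"
proof (rule Bochner_Integration.integrable_bound)
  show "integrable M (\<lambda>x. C * \<bar>f x\<bar>)" using assms(3) by simp
  show "(\<lambda>x. g x * f x) \<in> borel_measurable M" using assms by (intro borel_measurable_times) auto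
  have "C \<ge> 0" using assms(2)[of undefined] by linarith
  then show "AE x in M. norm (g x * f x) \<le> norm (C * \<bar>f x\<bar>)"
    using assms(2) by (intro AE_I2) (auto simp: abs_mult intro!: mult_right_mono)
qed

lemma measurable_reflect_lebesgue:
  fixes \<eta> :: "'a::euclidean_space \<Rightarrow> real"
  assumes "continuous_on UNIV \<eta>"
  shows "(\<lambda>y. \<eta> (x - y)) \<in> borel_measurable lebesgue"
  by (intro continuous_imp_measurable_lebesgue continuous_on_compose2[OF assms] continuous_intros) auto

lemma integrable_convolve_integrand:
  fixes \<eta> :: "'a::euclidean_space \<Rightarrow> real"
  assumes "continuous_on UNIV \<eta>" "\<And>x. \<bar>\<eta> x\<bar> \<le> C" "integrable lebesgue f"
  shows "integrable lebesgue (\<lambda>y. \<eta> (x - y) * f y)"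
  using assms by (intro integrable_bounded_mult[of _ _ C] measurable_reflect_lebesgue) auto

lemma integrable_test_convolve:
  assumes "test_function \<Omega> \<eta>" "integrable lebesgue f"
  shows "integrable lebesgue (\<lambda>y. \<eta> (x - y) * f y)"
proof -
  obtain M where "\<And>x. \<bar>\<eta> x\<bar> \<le> M" using test_function_bounded[OF assms(1)] by blast
  then show ?thesis using test_function_continuous[OF assms(1)] assms(2) by (intro integrable_convolve_integrand)
qed

text \<open>The uniform quadratic remainder of \<open>\<eta>\<close> bounds the error of the linear
  approximation by B |h|^2 times the L^1 norm of \<open>f\<close>.\<close>

lemma convolve_has_derivative:
  fixes \<eta> :: "real^'n \<Rightarrow> real"
  assumes \<eta>: "test_function \<Omega> \<eta>" and f: "integrable lebesgue f"
  shows "(convolve \<eta> f has_derivative (\<lambda>h. convolve (\<lambda>z. frechet_derivative \<eta> (at z) h) f x)) (at x)"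
  unfolding has_derivative_at
proof
  let ?D = "\<lambda>h z. frechet_derivative \<eta> (at z) h"
  let ?I = "LINT y|lebesgue. \<bar>f y\<bar>"
  note int = integrable_test_convolve[OF \<eta> f] integrable_test_convolve[OF test_function_partial[OF \<eta>] f]
  obtain M where M: "M > 0" "\<And>x h. \<bar>frechet_derivative \<eta> (at x) h\<bar> \<le> M * norm h"
    using test_function_deriv_bound[OF \<eta>] by blast
  obtain B where B: "B > 0" "\<And>x h. \<bar>\<eta> (x + h) - \<eta> x - ?D h x\<bar> \<le> B * (norm h)\<^sup>2"
    using test_function_taylor[OF \<eta>] by blast
  note lin = has_derivative_linear[OF test_function_deriv[OF \<eta>]]
  show "bounded_linear (\<lambda>h. convolve (?D h) f x)"
  proof (rule bounded_linear_intro[where K="M * ?I"])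
    show "convolve (?D (h + k)) f x = convolve (?D h) f x + convolve (?D k) f x" for h k
      unfolding convolve_def using int by (simp add: linear_add[OF lin] distrib_right)
    show "convolve (?D (c *\<^sub>R h)) f x = c *\<^sub>R convolve (?D h) f x" for h c
      unfolding convolve_def by (simp add: linear_scale[OF lin] mult.assoc)
    show "norm (convolve (?D h) f x) \<le> norm h * (M * ?I)" for h
    proof -
      have "norm (convolve (?D h) f x) \<le> (LINT y|lebesgue. (M * norm h) * \<bar>f y\<bar>)"
        unfolding convolve_def using f M(2)
        by (intro Bochner_Integration.integral_norm_bound_integral int) (auto simp: abs_mult intro!: mult_right_mono)
      then show ?thesis by (simp add: mult_ac)
    qed
  qed
  have bnd: "norm (convolve \<eta> f (x + h) - convolve \<eta> f x - convolve (?D h) f x) / norm h \<le> (B * ?I) * norm h" for h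
  proof -
    have "convolve \<eta> f (x + h) - convolve \<eta> f x - convolve (?D h) f x =
       (LINT y|lebesgue. \<eta> (x + h - y) * f y - \<eta> (x - y) * f y - ?D h (x - y) * f y)"
      unfolding convolve_def using int by simp
    also have "norm \<dots> \<le> (LINT y|lebesgue. (B * (norm h)\<^sup>2) * \<bar>f y\<bar>)"
    proof (intro Bochner_Integration.integral_norm_bound_integral Bochner_Integration.integrable_diff int)
      fix y
      have "\<bar>\<eta> ((x - y) + h) - \<eta> (x - y) - ?D h (x - y)\<bar> * \<bar>f y\<bar> \<le> (B * (norm h)\<^sup>2) * \<bar>f y\<bar>"
        by (intro mult_right_mono B(2)) auto
      then show "norm (\<eta> (x + h - y) * f y - \<eta> (x - y) * f y - ?D h (x - y) * f y) \<le> (B * (norm h)\<^sup>2) * \<bar>f y\<bar>"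
        by (simp add: abs_mult[symmetric] algebra_simps)
    qed (use f in auto)
    finally show ?thesis by (cases "h = 0") (auto simp: divide_simps power2_eq_square mult_ac)
  qed
  show "(\<lambda>h. norm (convolve \<eta> f (x + h) - convolve \<eta> f x - convolve (?D h) f x) / norm h) \<midarrow>0\<rightarrow> 0"
  proof (rule tendsto_sandwich[OF always_eventually always_eventually tendsto_const])
    show "((\<lambda>h. (B * ?I) * norm h) \<longlongrightarrow> 0) (at 0)"
      by (auto intro!: tendsto_eq_intros)
  qed (use bnd in auto)
qed

lemma convolve_C_k:
  assumes "test_function \<Omega> \<eta>" "integrable lebesgue f"
  shows "C_k k (convolve \<eta> f)"
  using assms(1)
proof (induction k arbitrary: \<eta>)
  case 0
  then show ?case
    using convolve_has_derivative[OF 0 assms(2)]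
    by (auto intro!: continuous_at_imp_continuous_on has_derivative_continuous)
next
  case (Suc k)
  show ?case
    by (rule C_k_SucI[OF convolve_has_derivative[OF Suc.prems assms(2)]])
      (intro Suc.IH test_function_partial Suc.prems)
qed

text \<open>The support is contained in the sum of the two compact sets, which is again
  compact.\<close>

lemma convolve_test_function:
  assumes "test_function \<Omega> \<eta>" "integrable lebesgue f" "compact K" "compact K'"
    "\<And>x. x \<notin> K \<Longrightarrow> \<eta> x = 0" "\<And>x. x \<notin> K' \<Longrightarrow> f x = 0" "\<And>x y. x \<in> K \<Longrightarrow> y \<in> K' \<Longrightarrow> x + y \<in> \<Omega>'"
  shows "test_function \<Omega>' (convolve \<eta> f)"
proof (rule test_functionI)
  show "C_k k (convolve \<eta> f)" for k by (rule convolve_C_k[OF assms(1,2)])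
  show "compact {x + y |x y. x \<in> K \<and> y \<in> K'}" by (intro compact_sums assms)
  show "{x + y |x y. x \<in> K \<and> y \<in> K'} \<subseteq> \<Omega>'" using assms(7) by auto
  fix x assume x: "x \<notin> {x + y |x y. x \<in> K \<and> y \<in> K'}"
  have "\<eta> (x - y) * f y = 0" for y
  proof (rule ccontr)
    assume "\<eta> (x - y) * f y \<noteq> 0"
    then have "x - y \<in> K" "y \<in> K'" using assms(5)[of "x - y"] assms(6)[of y] by auto
    moreover have "x = (x - y) + y" by simp
    ultimately show False using x by blast
  qed
  then have "(\<lambda>y. \<eta> (x - y) * f y) = (\<lambda>y. 0)" by (rule ext)
  then show "convolve \<eta> f x = 0" by (simp only: convolve_def Bochner_Integration.integral_zero)
qed

section \<open>Changes of variables and the integral of a derivative\<close>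

lemma nn_integral_lborel_affine:
  fixes x :: "'a::euclidean_space"
  assumes [measurable]: "f \<in> borel_measurable borel" and c: "c \<noteq> 0"
  shows "(\<integral>\<^sup>+y. f y \<partial>lborel) = ennreal (\<bar>c\<bar> ^ DIM('a)) * (\<integral>\<^sup>+y. f (x + c *\<^sub>R y) \<partial>lborel)"
  by (subst lborel_affine[OF c, of x])
    (simp add: nn_integral_density nn_integral_distr nn_integral_cmult)

lemma integral_lborel_reflect:
  fixes f :: "'a::euclidean_space \<Rightarrow> real"
  assumes [measurable]: "f \<in> borel_measurable borel"
  shows "(LINT y|lborel. f (x - y)) = (LINT y|lborel. f y)"
  by (subst (2) lborel_affine[of "-1" x]) (simp_all add: integral_distr density_1)

lemma integral_reflect_continuous:
  fixes f :: "'a::euclidean_space \<Rightarrow> real"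
  assumes "continuous_on UNIV f"
  shows "(LINT y|lebesgue. f (x - y)) = (LINT y|lebesgue. f y)"
proof -
  have "f \<in> borel_measurable borel" "(\<lambda>y. f (x - y)) \<in> borel_measurable borel"
    by (intro borel_measurable_continuous_onI assms continuous_on_compose2[OF assms] continuous_intros; simp)+
  then show ?thesis by (simp add: integral_completion integral_lborel_reflect)
qed

lemma integrable_indicator_compact:
  fixes K :: "'a::euclidean_space set"
  shows "compact K \<Longrightarrow> integrable lebesgue (indicator K :: 'a \<Rightarrow> real)"
  using lmeasurable_compact[of K] by (intro integrable_real_indicator) (auto simp: fmeasurable_def)

lemma test_function_integrable:
  assumes "test_function \<Omega> \<phi>"
  shows "integrable lebesgue \<phi>"
proof -
  obtain K where K: "compact K" "\<And>x. x \<notin> K \<Longrightarrow> \<phi> x = 0"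
    using test_function_supportE[OF assms(1)] by metis
  obtain M where M: "\<And>x. \<bar>\<phi> x\<bar> \<le> M" using test_function_bounded[OF assms(1)] by blast
  have "integrable lebesgue (\<lambda>x. \<phi> x * indicator K x)"
    using K(1) by (intro integrable_bounded_mult[OF continuous_imp_measurable_lebesgue M]
      test_function_continuous[OF assms] integrable_indicator_compact)
  moreover have "(\<lambda>x. \<phi> x * indicator K x) = \<phi>"
    using K(2) by (auto simp: fun_eq_iff indicator_def)
  ultimately show ?thesis by simp
qed

text \<open>Convolving with the indicator of a large ball gives a function that is constant near the
  origin, and whose derivative there is the integral in question.\<close>

lemma test_function_integral_partial:
  fixes \<phi> :: "real^'n \<Rightarrow> real"
  assumes "test_function \<Omega> \<phi>"
  shows "(LINT x|lebesgue. frechet_derivative \<phi> (at x) h) = 0"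
proof -
  obtain K where K: "compact K" "\<And>x. x \<notin> K \<Longrightarrow> \<phi> x = 0"
    "\<And>x. x \<notin> K \<Longrightarrow> frechet_derivative \<phi> (at x) = (\<lambda>h. 0)"
    using test_function_supportE[OF assms(1)] by metis
  obtain R where R: "R > 0" "\<And>x. x \<in> K \<Longrightarrow> norm x \<le> R"
    using compact_imp_bounded[OF K(1)] by (auto simp: bounded_pos)
  let ?f = "indicator (cball 0 (R + 1)) :: real^'n \<Rightarrow> real"
  have f: "integrable lebesgue ?f"
    by (intro integrable_indicator_compact compact_cball)
  \<comment> \<open>If |x| < 1 and x - y lies in \<open>K\<close>, then |y| is at most R + 1, so the
    indicator is 1 wherever the kernel is nonzero. This is used both for \<open>\<phi>\<close> and
    for its partial derivatives.\<close>
  have eq: "convolve \<psi> ?f x = (LINT x|lebesgue. \<psi> x)"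
    if "continuous_on UNIV \<psi>" "\<And>x. x \<notin> K \<Longrightarrow> \<psi> x = 0" "norm x < 1" for \<psi> x
  proof -
    have "\<psi> (x - y) * ?f y = \<psi> (x - y)" for y
    proof (cases "x - y \<in> K")
      case True
      then have "norm y \<le> R + 1"
        using R(2)[of "x - y"] that(3) norm_triangle_ineq4[of x "x - y"] by simp
      then show ?thesis by simp
    qed (use that(2) in auto)
    then have "(\<lambda>y. \<psi> (x - y) * ?f y) = (\<lambda>y. \<psi> (x - y))" by (rule ext)
    then show ?thesis using integral_reflect_continuous[OF that(1), of x] by (simp only: convolve_def)
  qed
  have "(convolve \<phi> ?f has_derivative (\<lambda>h. 0)) (at 0)"
    by (rule has_derivative_transform_within_open[of "\<lambda>x. LINT x|lebesgue. \<phi> x" _ _ _ "ball 0 1"])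
      (use eq[OF test_function_continuous[OF assms] K(2)] in auto)
  from has_derivative_unique[OF this convolve_has_derivative[OF assms f]]
  have "convolve (\<lambda>z. frechet_derivative \<phi> (at z) h) ?f 0 = 0" by metis
  then show ?thesis
    by (subst (asm) eq) (use K(3) test_function_continuous[OF test_function_partial[OF assms]] in auto)
qed

section \<open>Mollifiers\<close>

definition mollifier :: "real \<Rightarrow> (real^'n \<Rightarrow> real) \<Rightarrow> bool" where
  "mollifier \<epsilon> \<eta> \<longleftrightarrow> test_function UNIV \<eta> \<and> (\<forall>x. 0 \<le> \<eta> x) \<and> (\<forall>x. \<epsilon> < norm x \<longrightarrow> \<eta> x = 0) \<and>
     (LINT x|lebesgue. \<eta> x) = 1"

lemma mollifier_exists:
  assumes "0 < \<epsilon>"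
  obtains \<eta> :: "real^'n \<Rightarrow> real" where "mollifier \<epsilon> \<eta>"
proof -
  define b :: "real^'n \<Rightarrow> real" where "b x = inv_pow_exp 0 (\<epsilon>\<^sup>2 - x \<bullet> x)" for x
  have nz: "b x \<noteq> 0 \<longleftrightarrow> norm x < \<epsilon>" for x
    using assms norm_lt_square[of x \<epsilon>] by (simp add: b_def inv_pow_exp_def)
  have test: "test_function UNIV b"
  proof (rule test_functionI)
    show "C_k k b" for k unfolding b_def by (rule C_k_bump)
    show "b x = 0" if "x \<notin> cball 0 \<epsilon>" for x using nz[of x] that by auto
  qed auto
  note int = test_function_integrable[OF test]
  have pos: "0 \<le> b x" for x by (simp add: b_def inv_pow_exp_nonneg)
  \<comment> \<open>The bump is positive on a ball, and a nonempty open set is not negligible, so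
    the normalising division is legitimate.\<close>
  have "(LINT x|lebesgue. b x) \<noteq> 0"
  proof
    assume "(LINT x|lebesgue. b x) = 0"
    then have "AE x in lebesgue. b x = 0"
      using integral_nonneg_eq_0_iff_AE[OF int] pos by auto
    then have "AE x in lebesgue. x \<notin> ball (0::real^'n) \<epsilon>"
      by (rule AE_mp) (use nz in \<open>intro AE_I2, auto\<close>)
    then have "negligible (ball (0::real^'n) \<epsilon>)"
      by (simp add: negligible_iff_null_sets AE_iff_null_sets)
    then show False using open_not_negligible[of "ball (0::real^'n) \<epsilon>"] assms by auto
  qed
  then have I: "(LINT x|lebesgue. b x) > 0"
    using Bochner_Integration.integral_nonneg[of lebesgue b] pos by (simp add: order_less_le)
  let ?c = "1 / (LINT x|lebesgue. b x)"
  have "test_function UNIV (\<lambda>x. b x * ?c)"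
    by (rule test_function_mult[OF test C_k_const])
  moreover have "(\<forall>x. \<epsilon> < norm x \<longrightarrow> b x * ?c = 0)" using nz by force
  ultimately have "mollifier \<epsilon> (\<lambda>x. b x * ?c)"
    unfolding mollifier_def using pos I by auto
  then show ?thesis by (rule that)
qed

lemma mollifier_test: "mollifier \<epsilon> \<eta> \<Longrightarrow> test_function UNIV \<eta>"
  and mollifier_nonneg: "mollifier \<epsilon> \<eta> \<Longrightarrow> 0 \<le> \<eta> x"
  and mollifier_zero: "mollifier \<epsilon> \<eta> \<Longrightarrow> \<epsilon> < norm x \<Longrightarrow> \<eta> x = 0"
  and mollifier_integral: "mollifier \<epsilon> \<eta> \<Longrightarrow> (LINT x|lebesgue. \<eta> x) = 1"
  by (auto simp: mollifier_def)

lemma mollifier_integral_reflect: "mollifier \<epsilon> \<eta> \<Longrightarrow> (LINT y|lebesgue. \<eta> (x - y)) = 1"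
  using integral_reflect_continuous[OF test_function_continuous[OF mollifier_test]] mollifier_integral by metis

section \<open>Jensen's inequality and the contraction property of mollification\<close>

lemma powr_above_tangent:
  fixes s c p :: real
  assumes "1 \<le> p" "0 \<le> s" "0 < c"
  shows "c powr p + p * c powr (p - 1) * (s - c) \<le> s powr p"
proof (cases "s = 0")
  \<comment> \<open>Convexity of the power is used on the open half-line, so the end point s = 0 is
    checked by hand.\<close>
  case True
  define k where "k = c powr (p - 1)"
  have cp: "c powr p = c * k"
    using assms(3) powr_mult_base[of c "p - 1"] by (simp add: k_def)
  have "c powr p + p * c powr (p - 1) * (s - c) = - ((p - 1) * (c * k))"
    unfolding cp k_def[symmetric] True by algebra
  moreover have "0 \<le> (p - 1) * (c * k)" using assms by (simp add: k_def)
  moreover have "0 \<le> s powr p" by simp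
  ultimately show ?thesis by linarith
next
  case False
  have "((\<lambda>x. x powr p) has_real_derivative p * c powr (p - 1)) (at c within {0<..})"
    by (rule has_field_derivative_at_within[OF has_real_derivative_powr[OF assms(3)]])
  then have "p * c powr (p - 1) * (s - c) \<le> s powr p - c powr p"
    using False assms
    by (intro convex_on_imp_above_tangent[OF powr_convex[OF assms(1)] connected_Ioi]) (auto simp: interior_open)
  then show ?thesis by linarith
qed

text \<open>Jensen's inequality for the probability density \<open>w\<close>: integrate the tangent
  inequality at the mean \<open>c\<close>, where the linear term integrates to zero.\<close>

lemma integral_powr_le:
  fixes w f :: "'a \<Rightarrow> real"
  assumes "1 \<le> p" "integrable M w" "(LINT x|M. w x) = 1" "\<And>x. 0 \<le> w x" "\<And>x. 0 \<le> f x"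
    "integrable M (\<lambda>x. w x * f x)" "integrable M (\<lambda>x. w x * f x powr p)"
  shows "(LINT x|M. w x * f x) powr p \<le> (LINT x|M. w x * f x powr p)"
proof -
  define c where "c = (LINT x|M. w x * f x)"
  have "c \<ge> 0" unfolding c_def using assms by (intro Bochner_Integration.integral_nonneg) auto
  show ?thesis
  proof (cases "c = 0")
    case True
    then show ?thesis
      using assms unfolding c_def by (auto intro!: Bochner_Integration.integral_nonneg)
  next
    case False
    then have "c > 0" using \<open>c \<ge> 0\<close> by simp
    define a where "a = p * c powr (p - 1)"
    have "c powr p = (LINT x|M. (c powr p - a * c) * w x + a * (w x * f x))"
      using assms by (simp add: c_def[symmetric])
    also have "\<dots> \<le> (LINT x|M. w x * f x powr p)"
    proof (rule integral_mono)
      fix x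
      have "w x * (c powr p + a * (f x - c)) \<le> w x * f x powr p"
        unfolding a_def using assms \<open>c > 0\<close> by (intro mult_left_mono powr_above_tangent) auto
      then show "(c powr p - a * c) * w x + a * (w x * f x) \<le> w x * f x powr p"
        by (simp add: algebra_simps)
    qed (use assms in auto)
    finally show ?thesis by (simp add: c_def)
  qed
qed

text \<open>Bounding a sum by twice the larger summand gives the constant 2^p for every nonnegative
  exponent.\<close>

lemma powr_add_le:
  fixes a b p :: real
  assumes "0 \<le> p" "0 \<le> a" "0 \<le> b"
  shows "(a + b) powr p \<le> 2 powr p * (a powr p + b powr p)"
proof -
  have "(a + b) powr p \<le> (2 * max a b) powr p"
    using assms by (intro powr_mono2) auto
  also have "\<dots> = 2 powr p * max a b powr p"
    using assms by (intro powr_mult)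
  also have "\<dots> \<le> 2 powr p * (a powr p + b powr p)"
    by (intro mult_left_mono) (auto simp: max_def)
  finally show ?thesis .
qed

lemma convolve_add:
  assumes "test_function \<Omega> \<eta>" "integrable lebesgue f" "integrable lebesgue g"
  shows "convolve \<eta> (\<lambda>x. f x + g x) x = convolve \<eta> f x + convolve \<eta> g x"
  using integrable_test_convolve[OF assms(1,2)] integrable_test_convolve[OF assms(1,3)]
  by (simp add: convolve_def distrib_left)

lemma convolve_diff:
  assumes "test_function \<Omega> \<eta>" "integrable lebesgue f" "integrable lebesgue g"
  shows "convolve \<eta> (\<lambda>x. f x - g x) x = convolve \<eta> f x - convolve \<eta> g x"
  using integrable_test_convolve[OF assms(1,2)] integrable_test_convolve[OF assms(1,3)]
  by (simp add: convolve_def right_diff_distrib)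

lemma convolve_cmult: "convolve \<eta> (\<lambda>x. c * f x) x = c * convolve \<eta> f x"
  by (simp add: convolve_def mult.left_commute)

lemma convolve_cong_AE:
  assumes "test_function \<Omega> \<eta>" "AE x in lebesgue. f x = g x"
    "f \<in> borel_measurable lebesgue" "g \<in> borel_measurable lebesgue"
  shows "convolve \<eta> f x = convolve \<eta> g x"
  unfolding convolve_def
  using assms measurable_reflect_lebesgue[OF test_function_continuous[OF assms(1)]]
  by (intro integral_cong_AE borel_measurable_times) auto

lemma convolve_continuous:
  assumes "test_function \<Omega> \<eta>" "integrable lebesgue f"
  shows "continuous_on UNIV (convolve \<eta> f)"
  using convolve_C_k[OF assms, of 0] by simp

lemma convolve_measurable:
  assumes "test_function \<Omega> \<eta>" "integrable lebesgue f"
  shows "convolve \<eta> f \<in> borel_measurable lebesgue"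
  by (rule continuous_imp_measurable_lebesgue[OF convolve_continuous[OF assms]])

lemma convolve_abs_le:
  assumes "mollifier \<epsilon> \<eta>" "integrable lebesgue f"
  shows "\<bar>convolve \<eta> f x\<bar> \<le> convolve \<eta> (\<lambda>y. \<bar>f y\<bar>) x"
proof -
  note t = mollifier_test[OF assms(1)]
  have "norm (convolve \<eta> f x) \<le> (LINT y|lebesgue. \<eta> (x - y) * \<bar>f y\<bar>)"
    unfolding convolve_def
    using integrable_test_convolve[OF t assms(2)] integrable_test_convolve[OF t integrable_abs[OF assms(2)]]
      mollifier_nonneg[OF assms(1)]
    by (intro Bochner_Integration.integral_norm_bound_integral) (auto simp: abs_mult)
  then show ?thesis by (simp add: convolve_def)
qed

text \<open>Jensen's inequality for the density y |-> \<open>\<eta> (x - y)\<close>, whose total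
  mass is 1.\<close>

lemma convolve_abs_powr_le:
  assumes "mollifier \<epsilon> \<eta>" "1 \<le> p" "integrable lebesgue f" "integrable lebesgue (\<lambda>y. \<bar>f y\<bar> powr p)"
  shows "\<bar>convolve \<eta> f x\<bar> powr p \<le> convolve \<eta> (\<lambda>y. \<bar>f y\<bar> powr p) x"
proof -
  note t = mollifier_test[OF assms(1)]
  have "\<bar>convolve \<eta> f x\<bar> powr p \<le> convolve \<eta> (\<lambda>y. \<bar>f y\<bar>) x powr p"
    using convolve_abs_le[OF assms(1,3)] assms(2) by (intro powr_mono2) auto
  also have "\<dots> \<le> convolve \<eta> (\<lambda>y. \<bar>f y\<bar> powr p) x"
    unfolding convolve_def
  proof (rule integral_powr_le[OF assms(2)])
    show "integrable lebesgue (\<lambda>y. \<eta> (x - y))"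
      by (rule test_function_integrable[OF test_function_reflect[OF t]])
  qed (use assms mollifier_nonneg[OF assms(1)] mollifier_integral_reflect[OF assms(1)] in
    \<open>auto intro!: integrable_test_convolve[OF t]\<close>)
  finally show ?thesis .
qed

text \<open>Interchange the integrals: for each fixed \<open>y\<close> the kernel has mass 1 in
  \<open>x\<close>.\<close>

lemma nn_integral_mollify:
  fixes \<eta> :: "real^'n \<Rightarrow> real"
  assumes "mollifier \<epsilon> \<eta>" and [measurable]: "g \<in> borel_measurable borel"
  shows "(\<integral>\<^sup>+x. (\<integral>\<^sup>+y. ennreal (\<eta> (x - y)) * g y \<partial>lborel) \<partial>lborel) = (\<integral>\<^sup>+y. g y \<partial>lborel)"
proof -
  note t = mollifier_test[OF assms(1)]
  have [measurable]: "\<eta> \<in> borel_measurable borel"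
    by (intro borel_measurable_continuous_onI test_function_continuous[OF t])
  have "(\<integral>\<^sup>+x. ennreal (\<eta> x) \<partial>lborel) = ennreal (LINT x|lborel. \<eta> x)"
    using test_function_integrable[OF t] mollifier_nonneg[OF assms(1)]
    by (intro nn_integral_eq_integral) (auto simp: integrable_completion)
  also have "\<dots> = 1"
    using mollifier_integral[OF assms(1)] by (simp add: integral_completion)
  finally have 1: "(\<integral>\<^sup>+x. ennreal (\<eta> (x - y)) \<partial>lborel) = 1" for y
    using nn_integral_lborel_affine[of "\<lambda>x. ennreal (\<eta> x)" 1 "-y"] by simp
  have "(\<integral>\<^sup>+x. (\<integral>\<^sup>+y. ennreal (\<eta> (x - y)) * g y \<partial>lborel) \<partial>lborel) =
    (\<integral>\<^sup>+y. (\<integral>\<^sup>+x. ennreal (\<eta> (x - y)) * g y \<partial>lborel) \<partial>lborel)"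
    by (rule lborel_pair.Fubini'[symmetric]) simp
  also have "\<dots> = (\<integral>\<^sup>+y. g y \<partial>lborel)"
    by (simp add: nn_integral_multc 1)
  finally show ?thesis .
qed

lemma convolve_nonneg:
  assumes "mollifier \<epsilon> \<eta>" "\<And>y. 0 \<le> f y"
  shows "0 \<le> convolve \<eta> f x"
  unfolding convolve_def using assms mollifier_nonneg[OF assms(1)]
  by (intro Bochner_Integration.integral_nonneg) auto

lemma mollify_integral:
  fixes \<eta> :: "real^'n \<Rightarrow> real"
  assumes \<eta>: "mollifier \<epsilon> \<eta>" and f: "integrable lebesgue f" and f0: "\<And>y. 0 \<le> f y"
  shows "integrable lebesgue (convolve \<eta> f)" "(LINT x|lebesgue. convolve \<eta> f x) = (LINT x|lebesgue. f x)"
proof -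
  note t = mollifier_test[OF \<eta>]
  \<comment> \<open>Tonelli's theorem is available for Borel functions only.\<close>
  obtain g0 where "g0 \<in> borel_measurable lborel" and g0: "AE x in lborel. f x = g0 x"
    using completion_ex_borel_measurable_real[OF borel_measurable_integrable[OF f]] by auto
  then have [measurable]: "g0 \<in> borel_measurable borel" by simp
  \<comment> \<open>The Borel representative agrees with \<open>f\<close> only almost everywhere;
    cutting it at 0 makes it nonnegative at every point.\<close>
  define g where "g x = max 0 (g0 x)" for x
  have [measurable]: "g \<in> borel_measurable borel" by (simp add: g_def[abs_def])
  have gnn: "0 \<le> g x" for x by (simp add: g_def)
  have ae: "AE x in lebesgue. f x = g x"
    using AE_completion[OF g0] by eventually_elim (metis f0 g_def max.absorb2)
  have gl: "g \<in> borel_measurable lebesgue" by (simp add: measurable_completion)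
  have g: "integrable lebesgue g"
    using integrable_cong_AE[OF borel_measurable_integrable[OF f] gl ae] f by blast
  have fg: "convolve \<eta> f x = convolve \<eta> g x" for x
    by (rule convolve_cong_AE[OF t ae _ gl]) (use f in auto)
  have [measurable]: "\<eta> \<in> borel_measurable borel"
    by (intro borel_measurable_continuous_onI test_function_continuous[OF t])
  have [measurable]: "convolve \<eta> g \<in> borel_measurable borel"
    by (intro borel_measurable_continuous_onI convolve_continuous[OF t g])
  have "ennreal (convolve \<eta> g x) = (\<integral>\<^sup>+y. ennreal (\<eta> (x - y)) * ennreal (g y) \<partial>lborel)" for x
  proof -
    have "ennreal (convolve \<eta> g x) = (\<integral>\<^sup>+y. ennreal (\<eta> (x - y) * g y) \<partial>lebesgue)"
      unfolding convolve_def
      using integrable_test_convolve[OF t g] mollifier_nonneg[OF \<eta>]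
      by (intro nn_integral_eq_integral[symmetric]) (auto simp: gnn)
    then show ?thesis
      using mollifier_nonneg[OF \<eta>] by (simp add: nn_integral_completion ennreal_mult' gnn)
  qed
  then have "(\<integral>\<^sup>+x. ennreal (convolve \<eta> g x) \<partial>lebesgue) = (\<integral>\<^sup>+x. ennreal (g x) \<partial>lebesgue)"
    using nn_integral_mollify[OF \<eta>, of "\<lambda>x. ennreal (g x)"] by (simp add: nn_integral_completion)
  also have "\<dots> = ennreal (LINT x|lebesgue. g x)"
    using g gnn by (intro nn_integral_eq_integral) auto
  finally have nn: "(\<integral>\<^sup>+x. ennreal (convolve \<eta> g x) \<partial>lebesgue) = ennreal (LINT x|lebesgue. g x)" .
  have 0: "0 \<le> convolve \<eta> g x" for x by (rule convolve_nonneg[OF \<eta> gnn])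
  have int: "integrable lebesgue (convolve \<eta> g)"
    using nn 0 by (intro integrableI_nonneg convolve_measurable[OF t g]) auto
  have "ennreal (LINT x|lebesgue. convolve \<eta> g x) = ennreal (LINT x|lebesgue. g x)"
    using nn_integral_eq_integral[OF int] nn 0 by simp
  then have "(LINT x|lebesgue. convolve \<eta> g x) = (LINT x|lebesgue. g x)"
    using Bochner_Integration.integral_nonneg[of lebesgue g, OF gnn]
      Bochner_Integration.integral_nonneg[of lebesgue "convolve \<eta> g", OF 0] by simp
  moreover have "(LINT x|lebesgue. f x) = (LINT x|lebesgue. g x)"
    using ae f gl by (intro integral_cong_AE) auto
  ultimately show "integrable lebesgue (convolve \<eta> f)"
    "(LINT x|lebesgue. convolve \<eta> f x) = (LINT x|lebesgue. f x)"
    using int by (simp_all add: fg[abs_def])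
qed

text \<open>Integrate the pointwise Jensen bound and use that mollification preserves the integral
  of nonnegative functions.\<close>

lemma mollify_powr_contraction:
  fixes \<eta> :: "real^'n \<Rightarrow> real"
  assumes \<eta>: "mollifier \<epsilon> \<eta>" and p: "1 \<le> p" and f: "integrable lebesgue f" "integrable lebesgue (\<lambda>y. \<bar>f y\<bar> powr p)"
  shows "integrable lebesgue (\<lambda>x. \<bar>convolve \<eta> f x\<bar> powr p)"
    "(LINT x|lebesgue. \<bar>convolve \<eta> f x\<bar> powr p) \<le> (LINT x|lebesgue. \<bar>f x\<bar> powr p)"
proof -
  note m = mollify_integral[OF \<eta> f(2)]
  have [measurable]: "convolve \<eta> f \<in> borel_measurable lebesgue"
    by (rule convolve_measurable[OF mollifier_test[OF \<eta>] f(1)])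
  show int: "integrable lebesgue (\<lambda>x. \<bar>convolve \<eta> f x\<bar> powr p)"
    by (rule Bochner_Integration.integrable_bound[OF m(1)])
      (auto intro!: AE_I2 order_trans[OF convolve_abs_powr_le[OF \<eta> p f]])
  show "(LINT x|lebesgue. \<bar>convolve \<eta> f x\<bar> powr p) \<le> (LINT x|lebesgue. \<bar>f x\<bar> powr p)"
    using integral_mono[OF int m(1) convolve_abs_powr_le[OF \<eta> p f]] m(2) by simp
qed

text \<open>\<open>mollifier\<close> bounds the radius only from above, so radii obtained from
  several approximation statements can be replaced by their minimum.\<close>

lemma mollifier_mono: "mollifier \<epsilon> \<eta> \<Longrightarrow> \<epsilon> \<le> \<epsilon>' \<Longrightarrow> mollifier \<epsilon>' \<eta>"
  by (auto simp: mollifier_def)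

lemma mollify_contraction:
  fixes \<eta> :: "real^'n \<Rightarrow> real"
  assumes \<eta>: "mollifier \<epsilon> \<eta>" and f: "integrable lebesgue f"
  shows "integrable lebesgue (convolve \<eta> f)"
    "(LINT x|lebesgue. \<bar>convolve \<eta> f x\<bar>) \<le> (LINT x|lebesgue. \<bar>f x\<bar>)"
proof -
  have eq: "\<bar>t\<bar> powr 1 = \<bar>t\<bar>" for t :: real by simp
  note m = mollify_powr_contraction[OF \<eta> order_refl f, unfolded eq, OF integrable_abs[OF f]]
  then show "integrable lebesgue (convolve \<eta> f)"
    using integrable_abs_iff[OF convolve_measurable[OF mollifier_test[OF \<eta>] f]] by simp
  show "(LINT x|lebesgue. \<bar>convolve \<eta> f x\<bar>) \<le> (LINT x|lebesgue. \<bar>f x\<bar>)" by (rule m(2))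
qed

lemma convolve_abs_le_bound:
  assumes \<eta>: "mollifier \<epsilon> \<eta>" and f: "integrable lebesgue f" and M: "\<And>x. \<bar>f x\<bar> \<le> M"
  shows "\<bar>convolve \<eta> f x\<bar> \<le> M"
proof -
  note t = mollifier_test[OF \<eta>]
  have "\<bar>convolve \<eta> f x\<bar> \<le> (LINT y|lebesgue. \<eta> (x - y) * \<bar>f y\<bar>)"
    using convolve_abs_le[OF \<eta> f] by (simp add: convolve_def)
  also have "\<dots> \<le> (LINT y|lebesgue. \<eta> (x - y) * M)"
    using M mollifier_nonneg[OF \<eta>]
    by (intro integral_mono integrable_test_convolve[OF t integrable_abs[OF f]] integrable_mult_left
         test_function_integrable[OF test_function_reflect[OF t]] mult_left_mono) auto
  also have "\<dots> = M" using mollifier_integral_reflect[OF \<eta>] by simp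
  finally show ?thesis .
qed

section \<open>Convergence of mollifications in L^1 and L^p\<close>

lemma convolve_indicator_le:
  fixes \<eta> :: "real^'n \<Rightarrow> real"
  assumes \<eta>: "mollifier d \<eta>" and K: "compact K" and U: "(\<Union>y\<in>K. cball y d) \<subseteq> U"
  shows "convolve \<eta> (indicator K) x \<le> indicator U x"
proof (cases "x \<in> U")
  case True
  have "\<bar>convolve \<eta> (indicator K) x\<bar> \<le> 1"
    by (rule convolve_abs_le_bound[OF \<eta> integrable_indicator_compact[OF K]]) (auto simp: indicator_def)
  then show ?thesis using True by simp
next
  case False
  have "\<eta> (x - y) * indicator K y = 0" for y
  proof (cases "y \<in> K")
    case True
    then have "x \<notin> cball y d" using U False by blast
    then show ?thesis
      using mollifier_zero[OF \<eta>, of "x - y"] by (simp add: dist_norm norm_minus_commute)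
  qed simp
  then have "(\<lambda>y. \<eta> (x - y) * indicator K y) = (\<lambda>y. 0)" by (rule ext)
  then show ?thesis by (simp only: convolve_def Bochner_Integration.integral_zero indicator_pos_le)
qed

lemma convolve_indicator_eq_1:
  fixes \<eta> :: "real^'n \<Rightarrow> real"
  assumes \<eta>: "mollifier d \<eta>" and "cball x d \<subseteq> K"
  shows "convolve \<eta> (indicator K) x = 1"
proof -
  have "\<eta> (x - y) * indicator K y = \<eta> (x - y)" for y
  proof (cases "y \<in> K")
    case False
    then have "y \<notin> cball x d" using assms(2) by blast
    then show ?thesis using mollifier_zero[OF \<eta>, of "x - y"] by (simp add: dist_norm)
  qed simp
  then have "(\<lambda>y. \<eta> (x - y) * indicator K y) = (\<lambda>y. \<eta> (x - y))" by (rule ext)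
  then show ?thesis using mollifier_integral_reflect[OF \<eta>] by (simp only: convolve_def)
qed

text \<open>\<open>A\<close> is approximated from inside by a compact \<open>K\<close>, and
  \<open>K\<close> from outside by an open \<open>U\<close>. For radius at most the distance from
  \<open>K\<close> to the complement of \<open>U\<close>, both the indicator of \<open>K\<close> and
  its mollification lie below the indicator of \<open>U\<close>.\<close>

lemma mollify_indicator_L1:
  assumes A: "A \<in> sets lebesgue" "emeasure lebesgue A < \<infinity>" and e: "e > 0"
  shows "\<exists>d>0. \<forall>\<eta>::real^'n \<Rightarrow> real. mollifier d \<eta> \<longrightarrow>
    (LINT x|lebesgue. \<bar>convolve \<eta> (indicator A) x - indicator A x\<bar>) < e"
proof -
  \<comment> \<open>The final estimate adds four measures below e / 5: that of A - K twice and that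
    of U - K twice.\<close>
  let ?e = "e / 5"
  have e': "?e > 0" using e by simp
  have intA: "integrable lebesgue (indicator A :: real^'n \<Rightarrow> real)"
    using A by (intro integrable_real_indicator) auto
  have "\<exists>K. compact K \<and> K \<subseteq> A \<and> (LINT x|lebesgue. indicator (A - K) x) < ?e"
  proof -
    obtain T where T: "closed T" "T \<subseteq> A" "A - T \<in> lmeasurable" "emeasure lebesgue (A - T) < ennreal (?e / 2)"
      using sets_lebesgue_inner_closed[OF A(1), of "?e / 2"] e' by auto
    have mAT: "measure lebesgue (A - T) < ?e / 2"
      using T(3,4) e' by (simp add: emeasure_eq_measure2 ennreal_less_iff)
    \<comment> \<open>The closed inner approximation may be unbounded; intersecting it with a large
      ball makes it compact at a small cost.\<close>
    let ?K = "\<lambda>n::nat. T \<inter> cball 0 (real n)"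
    have Ts: "T \<in> sets lebesgue" "\<And>n. ?K n \<in> sets lebesgue" using T(1) by auto
    have "(\<lambda>n. LINT x|lebesgue. indicator (T - ?K n) x) \<longlonglongrightarrow> (LINT x::real^'n|lebesgue. 0 :: real)"
    proof (rule integral_dominated_convergence[where w="indicator A"])
      show "AE x in lebesgue. (\<lambda>n. indicator (T - ?K n) x :: real) \<longlonglongrightarrow> 0"
      proof (intro AE_I2)
        fix x :: "real^'n"
        obtain n where n: "norm x \<le> real n" using real_arch_simple by blast
        have "eventually (\<lambda>m. indicator (T - ?K m) x = (0::real)) sequentially"
          using eventually_ge_at_top[of n] by eventually_elim (use n in \<open>auto simp: indicator_def\<close>)
        then show "(\<lambda>n. indicator (T - ?K n) x :: real) \<longlonglongrightarrow> 0"
          by (rule tendsto_eventually)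
      qed
      show "(indicator (T - ?K n) :: real^'n \<Rightarrow> real) \<in> borel_measurable lebesgue" for n
        by (intro borel_measurable_indicator sets.Diff Ts)
    qed (use T(2) intA in \<open>auto simp: indicator_def\<close>)
    then have "eventually (\<lambda>n. (LINT x|lebesgue. indicator (T - ?K n) x) < ?e / 2) sequentially"
      using e' by (intro order_tendstoD) auto
    then obtain n where n: "(LINT x|lebesgue. indicator (T - ?K n) x) < ?e / 2"
      by (auto simp: eventually_sequentially)
    have "(LINT x|lebesgue. indicator (A - ?K n) x) =
      (LINT x|lebesgue. indicator (A - T) x + indicator (T - ?K n) x :: real)"
      using T(2) by (intro Bochner_Integration.integral_cong) (auto simp: indicator_def)
    also have "\<dots> = (LINT x|lebesgue. indicator (A - T) x) + (LINT x|lebesgue. indicator (T - ?K n) x)"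
    proof (rule Bochner_Integration.integral_add)
      show "integrable lebesgue (indicator (A - T) :: real^'n \<Rightarrow> real)"
        using T(3) by (intro integrable_real_indicator) (auto simp: fmeasurable_def)
      show "integrable lebesgue (indicator (T - ?K n) :: real^'n \<Rightarrow> real)"
        by (rule Bochner_Integration.integrable_bound[OF intA]) (use Ts T(2) in \<open>auto simp: indicator_def\<close>)
    qed
    also have "\<dots> < ?e" using mAT n T(3) by simp
    finally show ?thesis
      using T(1,2) by (intro exI[of _ "?K n"]) (auto intro: closed_Int_compact)
  qed
  then obtain K where K: "compact K" "K \<subseteq> A" "(LINT x|lebesgue. indicator (A - K) x) < ?e" by auto
  have Ks: "K \<in> sets lebesgue" using K(1) by (simp add: compact_imp_closed)
  obtain U where U: "open U" "K \<subseteq> U" "U - K \<in> lmeasurable" "emeasure lebesgue (U - K) < ennreal ?e"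
    using sets_lebesgue_outer_open[OF Ks e'] by auto
  have mUK: "measure lebesgue (U - K) < ?e"
    using U(3,4) e' by (simp add: emeasure_eq_measure2 ennreal_less_iff)
  obtain d where d: "d > 0" "(\<Union>y\<in>K. cball y d) \<subseteq> U"
    using compact_subset_open_imp_cball_epsilon_subset[OF K(1) U(1,2)] by auto
  note intK = integrable_indicator_compact[OF K(1)]
  have intUK: "integrable lebesgue (indicator (U - K) :: real^'n \<Rightarrow> real)"
    using U(3) by (intro integrable_real_indicator) (auto simp: fmeasurable_def)
  have intAK: "integrable lebesgue (indicator (A - K) :: real^'n \<Rightarrow> real)"
    by (rule Bochner_Integration.integrable_bound[OF intA]) (use A Ks in \<open>auto simp: indicator_def\<close>)
  have IU: "indicator U x = indicator (U - K) x + (indicator K x :: real)" for x :: "real^'n"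
    using U(2) by (auto simp: indicator_def)
  have intU: "integrable lebesgue (indicator U :: real^'n \<Rightarrow> real)"
    using Bochner_Integration.integrable_add[OF intUK intK] by (simp add: IU[abs_def])
  show ?thesis
  proof (intro exI[of _ d] conjI d(1) allI impI)
    fix \<eta> :: "real^'n \<Rightarrow> real" assume \<eta>: "mollifier d \<eta>"
    note t = mollifier_test[OF \<eta>]
    let ?c = "convolve \<eta> (indicator K)"
    note mK = mollify_integral[OF \<eta> intK, simplified]
    note mAK = mollify_integral[OF \<eta> intAK, simplified]
    have "convolve \<eta> (indicator A) x = convolve \<eta> (indicator (A - K)) x + ?c x" for x
    proof -
      have "indicator A = (\<lambda>x. indicator (A - K) x + (indicator K x :: real))"
        using K(2) by (auto simp: fun_eq_iff indicator_def)
      then show ?thesis using convolve_add[OF t intAK intK] by simp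
    qed
    \<comment> \<open>Two numbers below the indicator of \<open>U\<close> differ by at most the sum
      of their gaps to it. This majorant is linear in the mollified functions, so preservation of
      mass gives its integral exactly.\<close>
    then have bound: "\<bar>convolve \<eta> (indicator A) x - indicator A x\<bar> \<le>
       convolve \<eta> (indicator (A - K)) x + (2 * indicator U x - ?c x - indicator K x) + indicator (A - K) x" for x
      using convolve_indicator_le[OF \<eta> K(1) d(2), of x] convolve_nonneg[OF \<eta>, of "indicator (A - K)" x]
        K(2) U(2) by (auto simp: indicator_def split: if_splits)
    note mA = mollify_integral[OF \<eta> intA, simplified]
    have "(LINT x|lebesgue. \<bar>convolve \<eta> (indicator A) x - indicator A x\<bar>) \<le>
       (LINT x|lebesgue. convolve \<eta> (indicator (A - K)) x + (2 * indicator U x - ?c x - indicator K x) + indicator (A - K) x)"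
      using mA(1) intA mK(1) mAK(1) intK intAK intU by (intro integral_mono bound) auto
    also have "\<dots> = (LINT x|lebesgue. indicator (A - K) x) + (2 * (LINT x|lebesgue. indicator U x)
       - (LINT x|lebesgue. indicator K x) - (LINT x|lebesgue. indicator K x)) + (LINT x|lebesgue. indicator (A - K) x)"
      using mK mAK intK intAK intU by simp
    also have "(LINT x::real^'n|lebesgue. indicator U x :: real) =
        (LINT x|lebesgue. indicator (U - K) x) + (LINT x|lebesgue. indicator K x)"
      unfolding IU by (rule Bochner_Integration.integral_add[OF intUK intK])
    finally show "(LINT x|lebesgue. \<bar>convolve \<eta> (indicator A) x - indicator A x\<bar>) < e"
      using K(3) mUK U(3) e by simp
  qed
qed

text \<open>Induction over integrable functions, starting from indicators. In the limit step the L^1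
  contraction transfers closeness of the approximant to the mollifications.\<close>

lemma mollify_L1:
  fixes f :: "real^'n \<Rightarrow> real"
  assumes "integrable lebesgue f" "e > 0"
  shows "\<exists>d>0. \<forall>\<eta>::real^'n \<Rightarrow> real. mollifier d \<eta> \<longrightarrow> (LINT x|lebesgue. \<bar>convolve \<eta> f x - f x\<bar>) < e"
  using assms
proof (induction f arbitrary: e rule: integrable_induct)
  case (base A c)
  obtain d where d: "d > 0" "\<And>\<eta>::real^'n \<Rightarrow> real. mollifier d \<eta> \<Longrightarrow>
     (LINT x|lebesgue. \<bar>convolve \<eta> (indicator A) x - indicator A x\<bar>) < e / (\<bar>c\<bar> + 1)"
    \<comment> \<open>Adding 1 to the denominator covers c = 0.\<close>
    using mollify_indicator_L1[OF base(1,2), of "e / (\<bar>c\<bar> + 1)"] base(3) by auto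
  show ?case
  proof (intro exI[of _ d] conjI d(1) allI impI)
    fix \<eta> :: "real^'n \<Rightarrow> real" assume \<eta>: "mollifier d \<eta>"
    let ?I = "LINT x|lebesgue. \<bar>convolve \<eta> (indicator A) x - indicator A x\<bar>"
    have "(LINT x|lebesgue. \<bar>convolve \<eta> (\<lambda>x. indicator A x *\<^sub>R c) x - indicator A x *\<^sub>R c\<bar>) =
      (LINT x|lebesgue. \<bar>c\<bar> * \<bar>convolve \<eta> (indicator A) x - indicator A x\<bar>)"
      using convolve_cmult[of \<eta> c "indicator A"]
      by (intro Bochner_Integration.integral_cong) (auto simp: mult.commute[of _ c] abs_mult[symmetric] right_diff_distrib)
    also have "\<dots> = \<bar>c\<bar> * ?I" by simp
    also have "\<dots> \<le> (\<bar>c\<bar> + 1) * ?I"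
      by (intro mult_right_mono) auto
    also have "\<dots> < e" using d(2)[OF \<eta>] by (simp add: field_simps)
    finally show "(LINT x|lebesgue. \<bar>convolve \<eta> (\<lambda>x. indicator A x *\<^sub>R c) x - indicator A x *\<^sub>R c\<bar>) < e" .
  qed
next
  case (add f g)
  obtain d1 where d1: "d1 > 0" "\<And>\<eta>::real^'n \<Rightarrow> real. mollifier d1 \<eta> \<Longrightarrow>
     (LINT x|lebesgue. \<bar>convolve \<eta> f x - f x\<bar>) < e / 2"
    using add(3)[of "e / 2"] add(5) by auto
  obtain d2 where d2: "d2 > 0" "\<And>\<eta>::real^'n \<Rightarrow> real. mollifier d2 \<eta> \<Longrightarrow>
     (LINT x|lebesgue. \<bar>convolve \<eta> g x - g x\<bar>) < e / 2"
    using add(4)[of "e / 2"] add(5) by auto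
  show ?case
  proof (intro exI[of _ "min d1 d2"] conjI allI impI)
    fix \<eta> :: "real^'n \<Rightarrow> real" assume \<eta>: "mollifier (min d1 d2) \<eta>"
    note t = mollifier_test[OF \<eta>]
    have int: "integrable lebesgue (convolve \<eta> f)" "integrable lebesgue (convolve \<eta> g)"
      "integrable lebesgue (convolve \<eta> (\<lambda>x. f x + g x))"
      using mollify_contraction(1)[OF \<eta>] add(1,2) by auto
    have "(LINT x|lebesgue. \<bar>convolve \<eta> (\<lambda>x. f x + g x) x - (f x + g x)\<bar>) \<le>
      (LINT x|lebesgue. \<bar>convolve \<eta> f x - f x\<bar> + \<bar>convolve \<eta> g x - g x\<bar>)"
      using add(1,2) int by (intro integral_mono) (auto simp: convolve_add[OF t])
    also have "\<dots> = (LINT x|lebesgue. \<bar>convolve \<eta> f x - f x\<bar>) + (LINT x|lebesgue. \<bar>convolve \<eta> g x - g x\<bar>)"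
      using add(1,2) int by simp
    also have "\<dots> < e"
      using d1(2)[of \<eta>] d2(2)[of \<eta>] mollifier_mono[OF \<eta>, of d1] mollifier_mono[OF \<eta>, of d2] by simp
    finally show "(LINT x|lebesgue. \<bar>convolve \<eta> (\<lambda>x. f x + g x) x - (f x + g x)\<bar>) < e" .
  qed (use d1(1) d2(1) in auto)
next
  case (lim f s)
  have "(\<lambda>i. LINT x|lebesgue. \<bar>s i x - f x\<bar>) \<longlonglongrightarrow> (LINT x::real^'n|lebesgue. 0 :: real)"
  proof (rule integral_dominated_convergence[where w="\<lambda>x. 3 * \<bar>f x\<bar>"])
    show "AE x in lebesgue. (\<lambda>i. \<bar>s i x - f x\<bar>) \<longlonglongrightarrow> 0"
      by (intro AE_I2 tendsto_rabs_zero LIM_zero lim(2))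
    show "AE x in lebesgue. norm \<bar>s i x - f x\<bar> \<le> 3 * \<bar>f x\<bar>" for i
    proof (intro AE_I2)
      fix x show "norm \<bar>s i x - f x\<bar> \<le> 3 * \<bar>f x\<bar>" using lim(3)[of x i] by simp
    qed
    show "(\<lambda>x. \<bar>s i x - f x\<bar>) \<in> borel_measurable lebesgue" for i
      using lim(1)[of i] lim(4) by (intro borel_measurable_abs borel_measurable_diff) auto
  qed (use lim(4) in auto)
  then have "eventually (\<lambda>i. (LINT x|lebesgue. \<bar>s i x - f x\<bar>) < e / 3) sequentially"
    using lim(6) by (intro order_tendstoD) auto
  then obtain i where i: "(LINT x|lebesgue. \<bar>s i x - f x\<bar>) < e / 3"
    by (auto simp: eventually_sequentially)
  obtain d where d: "d > 0" "\<And>\<eta>::real^'n \<Rightarrow> real. mollifier d \<eta> \<Longrightarrow>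
     (LINT x|lebesgue. \<bar>convolve \<eta> (s i) x - s i x\<bar>) < e / 3"
    using lim(5)[of "e / 3" i] lim(6) by auto
  show ?case
  proof (intro exI[of _ d] conjI d(1) allI impI)
    fix \<eta> :: "real^'n \<Rightarrow> real" assume \<eta>: "mollifier d \<eta>"
    note t = mollifier_test[OF \<eta>]
    have intsf: "integrable lebesgue (\<lambda>x. s i x - f x)" using lim(1,4) by auto
    note int = mollify_contraction[OF \<eta> lim(1)[of i]] mollify_contraction[OF \<eta> lim(4)] mollify_contraction[OF \<eta> intsf]
    have eq: "convolve \<eta> (\<lambda>x. s i x - f x) x = convolve \<eta> (s i) x - convolve \<eta> f x" for x
      by (rule convolve_diff[OF t lim(1,4)])
    have "(LINT x|lebesgue. \<bar>convolve \<eta> f x - f x\<bar>) \<le>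
      (LINT x|lebesgue. \<bar>convolve \<eta> (\<lambda>x. s i x - f x) x\<bar> + \<bar>convolve \<eta> (s i) x - s i x\<bar> + \<bar>s i x - f x\<bar>)"
      using lim(1,4) int by (intro integral_mono) (auto simp: eq)
    also have "\<dots> = (LINT x|lebesgue. \<bar>convolve \<eta> (\<lambda>x. s i x - f x) x\<bar>) +
       (LINT x|lebesgue. \<bar>convolve \<eta> (s i) x - s i x\<bar>) + (LINT x|lebesgue. \<bar>s i x - f x\<bar>)"
      using lim(1,4) int by simp
    also have "\<dots> < e" using int(6) i d(2)[OF \<eta>] by simp
    finally show "(LINT x|lebesgue. \<bar>convolve \<eta> f x - f x\<bar>) < e" .
  qed
qed

text \<open>Split \<open>f\<close> into a bounded part \<open>g\<close> and a tail \<open>h\<close>.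
  The tail is controlled by the L^p contraction; for the bounded part the p-th power is dominated by
  a multiple of the first power, which reduces it to L^1 convergence.\<close>

lemma mollify_Lp:
  fixes f :: "real^'n \<Rightarrow> real"
  assumes p: "1 \<le> p" and f: "integrable lebesgue f" "integrable lebesgue (\<lambda>x. \<bar>f x\<bar> powr p)" and e: "e > 0"
  shows "\<exists>d>0. \<forall>\<eta>::real^'n \<Rightarrow> real. mollifier d \<eta> \<longrightarrow>
    integrable lebesgue (\<lambda>x. \<bar>convolve \<eta> f x - f x\<bar> powr p) \<and>
    (LINT x|lebesgue. \<bar>convolve \<eta> f x - f x\<bar> powr p) < e"
proof -
  define C where "C = 2 powr p"
  have C: "C > 0" by (simp add: C_def)
  note [measurable] = borel_measurable_integrable[OF f(1)]
  let ?g = "\<lambda>n x. indicator {x. \<bar>f x\<bar> \<le> real n} x * f x"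
  have sets: "{x. \<bar>f x\<bar> \<le> real n} \<in> sets lebesgue" for n
    using measurable_sets[OF borel_measurable_abs[OF borel_measurable_integrable[OF f(1)]], of "{..real n}"]
    by (simp add: vimage_def)
  have gm[measurable]: "?g n \<in> borel_measurable lebesgue" for n
    by (intro borel_measurable_times borel_measurable_indicator sets borel_measurable_integrable[OF f(1)])
  have "(\<lambda>n. LINT x|lebesgue. \<bar>f x - ?g n x\<bar> powr p) \<longlonglongrightarrow> (LINT x::real^'n|lebesgue. 0 :: real)"
  proof (rule integral_dominated_convergence[OF _ _ f(2)])
    show "AE x in lebesgue. (\<lambda>n. \<bar>f x - ?g n x\<bar> powr p) \<longlonglongrightarrow> 0"
    proof (intro AE_I2)
      fix x :: "real^'n"
      obtain n where n: "\<bar>f x\<bar> \<le> real n" using real_arch_simple by blast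
      have "eventually (\<lambda>m. \<bar>f x - ?g m x\<bar> powr p = 0) sequentially"
        using eventually_ge_at_top[of n] by eventually_elim (use n in \<open>auto simp: indicator_def\<close>)
      then show "(\<lambda>n. \<bar>f x - ?g n x\<bar> powr p) \<longlonglongrightarrow> 0"
        by (rule tendsto_eventually)
    qed
    show "AE x in lebesgue. norm (\<bar>f x - ?g n x\<bar> powr p) \<le> \<bar>f x\<bar> powr p" for n
      by (intro AE_I2) (auto simp: indicator_def)
  qed auto
  \<comment> \<open>Two uses of \<open>powr_add_le\<close> give the tail, which appears once
    directly and once mollified, the total factor 2 C^2; this threshold keeps its contribution below
    e / 3.\<close>
  moreover have "e / (6 * C * C) > 0" using C e by simp
  ultimately have "eventually (\<lambda>n. (LINT x|lebesgue. \<bar>f x - ?g n x\<bar> powr p) < e / (6 * C * C)) sequentially"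
    by (intro order_tendstoD) auto
  then obtain n where n: "(LINT x|lebesgue. \<bar>f x - ?g n x\<bar> powr p) < e / (6 * C * C)"
    by (auto simp: eventually_sequentially)
  define g where "g = ?g n"
  define h where "h x = f x - g x" for x
  have gm'[measurable]: "g \<in> borel_measurable lebesgue" unfolding g_def by (rule gm)
  have g: "integrable lebesgue g"
    by (rule Bochner_Integration.integrable_bound[OF f(1)]) (auto simp: g_def indicator_def)
  have h: "integrable lebesgue h" unfolding h_def using f(1) g by simp
  have hp: "integrable lebesgue (\<lambda>x. \<bar>h x\<bar> powr p)"
    by (rule Bochner_Integration.integrable_bound[OF f(2)])
      (auto simp: h_def g_def indicator_def)
  have gb: "\<bar>g x\<bar> \<le> real n" for x by (auto simp: g_def indicator_def)
  \<comment> \<open>Both \<open>g\<close> and its mollification are bounded by \<open>n\<close>, so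
    their difference t satisfies t^p = t^(p-1) t, which is at most \<open>A\<close> t.\<close>
  define A where "A = (2 * real n) powr (p - 1)"
  have A: "0 \<le> A" by (simp add: A_def)
  have "e / (3 * C * C * (A + 1)) > 0" using C e A by simp
  then obtain d where d: "d > 0" "\<And>\<eta>::real^'n \<Rightarrow> real. mollifier d \<eta> \<Longrightarrow>
     (LINT x|lebesgue. \<bar>convolve \<eta> g x - g x\<bar>) < e / (3 * C * C * (A + 1))"
    using mollify_L1[OF g] by blast
  show ?thesis
  proof (intro exI[of _ d] conjI d(1) allI impI)
    fix \<eta> :: "real^'n \<Rightarrow> real" assume \<eta>: "mollifier d \<eta>"
    note t = mollifier_test[OF \<eta>]
    note [measurable] = convolve_measurable[OF t f(1)] convolve_measurable[OF t g]
    note mh = mollify_powr_contraction[OF \<eta> p h hp]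
    have cg: "integrable lebesgue (convolve \<eta> g)" by (rule mollify_contraction(1)[OF \<eta> g])
    have gbound: "\<bar>convolve \<eta> g x - g x\<bar> powr p \<le> A * \<bar>convolve \<eta> g x - g x\<bar>" for x
    proof -
      let ?t = "\<bar>convolve \<eta> g x - g x\<bar>"
      have "?t \<le> 2 * real n"
        using convolve_abs_le_bound[OF \<eta> g gb, of x] gb[of x] by linarith
      then have "?t powr (p - 1) \<le> A" unfolding A_def using p by (intro powr_mono2) auto
      then have "?t * ?t powr (p - 1) \<le> ?t * A" by (intro mult_left_mono) auto
      then show ?thesis
        by (cases "?t = 0") (simp_all add: powr_mult_base mult.commute)
    qed
    have gp: "integrable lebesgue (\<lambda>x. \<bar>convolve \<eta> g x - g x\<bar> powr p)"
    proof (rule Bochner_Integration.integrable_bound)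
      show "integrable lebesgue (\<lambda>x. A * \<bar>convolve \<eta> g x - g x\<bar>)" using cg g by simp
      show "AE x in lebesgue. norm (\<bar>convolve \<eta> g x - g x\<bar> powr p) \<le> norm (A * \<bar>convolve \<eta> g x - g x\<bar>)"
        using gbound A by (intro AE_I2) simp
    qed simp
    have bound: "\<bar>convolve \<eta> f x - f x\<bar> powr p \<le>
       C * (\<bar>h x\<bar> powr p + C * (\<bar>convolve \<eta> h x\<bar> powr p + \<bar>convolve \<eta> g x - g x\<bar> powr p))" for x
    proof -
      have "convolve \<eta> h x = convolve \<eta> f x - convolve \<eta> g x"
        unfolding h_def by (rule convolve_diff[OF t f(1) g])
      then have "\<bar>convolve \<eta> f x - f x\<bar> \<le> \<bar>h x\<bar> + (\<bar>convolve \<eta> h x\<bar> + \<bar>convolve \<eta> g x - g x\<bar>)"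
        by (simp add: h_def)
      then have "\<bar>convolve \<eta> f x - f x\<bar> powr p \<le> (\<bar>h x\<bar> + (\<bar>convolve \<eta> h x\<bar> + \<bar>convolve \<eta> g x - g x\<bar>)) powr p"
        using p by (intro powr_mono2) auto
      also have "\<dots> \<le> C * (\<bar>h x\<bar> powr p + (\<bar>convolve \<eta> h x\<bar> + \<bar>convolve \<eta> g x - g x\<bar>) powr p)"
        unfolding C_def using p by (intro powr_add_le) auto
      also have "\<dots> \<le> C * (\<bar>h x\<bar> powr p + C * (\<bar>convolve \<eta> h x\<bar> powr p + \<bar>convolve \<eta> g x - g x\<bar> powr p))"
        unfolding C_def using p by (intro mult_left_mono add_left_mono powr_add_le) auto
      finally show ?thesis .
    qed
    let ?B = "\<lambda>x. C * (\<bar>h x\<bar> powr p + C * (\<bar>convolve \<eta> h x\<bar> powr p + \<bar>convolve \<eta> g x - g x\<bar> powr p))"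
    have intB: "integrable lebesgue ?B" using hp mh(1) gp by simp
    show int: "integrable lebesgue (\<lambda>x. \<bar>convolve \<eta> f x - f x\<bar> powr p)"
      by (rule Bochner_Integration.integrable_bound[OF intB]) (auto intro!: AE_I2 order_trans[OF bound])
    let ?H = "LINT x|lebesgue. \<bar>h x\<bar> powr p"
    let ?G = "LINT x|lebesgue. \<bar>convolve \<eta> g x - g x\<bar>"
    have H: "?H < e / (6 * C * C)" using n by (simp add: h_def g_def)
    have H0: "0 \<le> ?H" by simp
    have C1: "1 \<le> C" unfolding C_def using p by (intro ge_one_powr_ge_zero) auto
    have "(LINT x|lebesgue. \<bar>convolve \<eta> f x - f x\<bar> powr p) \<le> (LINT x|lebesgue. ?B x)"
      by (rule integral_mono[OF int intB bound])
    also have "\<dots> = C * (?H + C * ((LINT x|lebesgue. \<bar>convolve \<eta> h x\<bar> powr p) + (LINT x|lebesgue. \<bar>convolve \<eta> g x - g x\<bar> powr p)))"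
      using hp mh(1) gp by simp
    also have "\<dots> \<le> C * (C * ?H + C * (?H + A * ?G))"
    proof (intro mult_left_mono add_mono mh(2))
      show "?H \<le> C * ?H" using C1 H0 mult_right_mono[of 1 C ?H] by simp
      show "(LINT x|lebesgue. \<bar>convolve \<eta> g x - g x\<bar> powr p) \<le> A * ?G"
        using integral_mono[OF gp _ gbound] cg g by simp
    qed (use C in auto)
    also have "\<dots> = 2 * C * C * ?H + C * C * (A * ?G)" by (simp add: algebra_simps)
    also have "\<dots> < e / 3 + e / 3"
    proof (rule add_strict_mono)
      show "2 * C * C * ?H < e / 3" using H C by (simp add: field_simps)
      have "A * ?G \<le> (A + 1) * ?G" by (intro mult_right_mono) auto
      also have "(A + 1) * ?G < e / (3 * C * C)"
      proof -
        have pos: "3 * C * C > 0" using C by simp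
        have "3 * C * C * (A + 1) > 0" using A C by simp
        then have "?G * (3 * C * C * (A + 1)) < e"
          using d(2)[OF \<eta>] by (simp only: pos_less_divide_eq)
        moreover have "(A + 1) * ?G * (3 * C * C) = ?G * (3 * C * C * (A + 1))" by algebra
        ultimately show ?thesis by (simp only: pos_less_divide_eq[OF pos])
      qed
      finally show "C * C * (A * ?G) < e / 3" using C by (simp add: field_simps)
    qed
    also have "\<dots> \<le> e" using e by simp
    finally show "(LINT x|lebesgue. \<bar>convolve \<eta> f x - f x\<bar> powr p) < e" .
  qed
qed

text \<open>Mollify, with radius d = r / 4, the indicator of the closed 2d-neighbourhood of
  \<open>K\<close>. The result is 1 on the d-neighbourhood and vanishes beyond distance 3d, which is
  less than \<open>r\<close>. Having the value 1 on an open set makes the derivative vanish on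
  \<open>K\<close>.\<close>

lemma test_function_cutoff:
  fixes K :: "(real^'n) set"
  assumes K: "compact K" and \<Omega>: "open \<Omega>" "K \<subseteq> \<Omega>"
  obtains \<kappa> U where "test_function \<Omega> \<kappa>" "\<And>x. 0 \<le> \<kappa> x" "\<And>x. \<kappa> x \<le> 1" "open U" "K \<subseteq> U" "U \<subseteq> \<Omega>" "\<And>x. x \<in> U \<Longrightarrow> \<kappa> x = 1"
proof -
  obtain r where r: "r > 0" "(\<Union>y\<in>K. cball y r) \<subseteq> \<Omega>"
    using compact_subset_open_imp_cball_epsilon_subset[OF K \<Omega>] by auto
  define d where "d = r / 4"
  have d: "d > 0" using r(1) by (simp add: d_def)
  obtain \<eta> :: "real^'n \<Rightarrow> real" where \<eta>: "mollifier d \<eta>" using mollifier_exists[OF d] .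
  note t = mollifier_test[OF \<eta>]
  define K2 where "K2 = {x + y |x y. x \<in> K \<and> y \<in> cball 0 (2 * d)}"
  have K2: "compact K2" unfolding K2_def by (intro compact_sums K compact_cball)
  note int = integrable_indicator_compact[OF K2]
  have "test_function \<Omega> (convolve \<eta> (indicator K2))"
  proof (rule convolve_test_function[OF t int compact_cball[of 0 d] K2])
    show "x + y \<in> \<Omega>" if "x \<in> cball 0 d" "y \<in> K2" for x y
    proof -
      note xy = that
      obtain k z where k: "y = k + z" "k \<in> K" "norm z \<le> 2 * d" using xy(2) by (auto simp: K2_def)
      have "norm (x + z) \<le> r"
        using norm_triangle_ineq[of x z] xy(1) k(3) d by (simp add: d_def)
      then have "x + y \<in> cball k r" by (simp add: k(1) dist_norm norm_minus_commute add.commute add.left_commute)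
      then show ?thesis using r(2) k(2) by blast
    qed
  qed (use mollifier_zero[OF \<eta>] in \<open>auto simp: not_le\<close>)
  moreover have "0 \<le> convolve \<eta> (indicator K2) x" for x by (rule convolve_nonneg[OF \<eta>]) simp
  moreover have "convolve \<eta> (indicator K2) x \<le> 1" for x
    using convolve_abs_le_bound[OF \<eta> int, of 1 x] by (simp add: indicator_def)
  moreover have "open (\<Union>y\<in>K. ball y d)" by auto
  moreover have "K \<subseteq> (\<Union>y\<in>K. ball y d)" using d by auto
  moreover have "(\<Union>y\<in>K. ball y d) \<subseteq> \<Omega>"
  proof -
    have "ball y d \<subseteq> cball y r" for y :: "real^'n" using d by (auto simp: d_def)
    then show ?thesis using r(2) by blast
  qed
  moreover have "convolve \<eta> (indicator K2) x = 1" if "x \<in> (\<Union>y\<in>K. ball y d)" for x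
  proof (rule convolve_indicator_eq_1[OF \<eta>], rule subsetI)
    fix z assume z: "z \<in> cball x d"
    obtain k where k: "k \<in> K" "dist k x < d" using \<open>x \<in> _\<close> by auto
    have "dist k z \<le> 2 * d" using dist_triangle[of k z x] k(2) z by simp
    then have "z - k \<in> cball 0 (2 * d)" by (simp add: dist_norm norm_minus_commute)
    moreover have "z = k + (z - k)" by simp
    ultimately show "z \<in> K2" unfolding K2_def using k(1) by blast
  qed
  ultimately show ?thesis by (rule that)
qed

section \<open>Weak derivatives\<close>

lemma integral_lebesgue_on_support:
  fixes f :: "'a::euclidean_space \<Rightarrow> 'b::{banach, second_countable_topology}"
  assumes "\<Omega> \<in> sets lebesgue" "\<And>x. x \<notin> \<Omega> \<Longrightarrow> f x = 0"
  shows "(LINT x|lebesgue_on \<Omega>. f x) = (LINT x|lebesgue. f x)"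
proof -
  have "(\<lambda>x. indicator \<Omega> x *\<^sub>R f x) = f" using assms(2) by (auto simp: fun_eq_iff indicator_def)
  then show ?thesis using assms(1) by (simp add: integral_restrict_space)
qed

lemma test_function_zero: "test_function \<Omega> \<phi> \<Longrightarrow> x \<notin> \<Omega> \<Longrightarrow> \<phi> x = 0"
  by (metis subsetD test_function_supportE)

lemma locally_integrable_test_mult:
  fixes f :: "real^'n \<Rightarrow> real"
  assumes "test_function \<Omega> \<phi>" "locally_integrable \<Omega> f"
  shows "integrable lebesgue (\<lambda>x. f x * \<phi> x)"
proof -
  obtain K where K: "compact K" "K \<subseteq> \<Omega>" "\<And>x. x \<notin> K \<Longrightarrow> \<phi> x = 0"
    using test_function_supportE[OF assms(1)] by metis
  obtain M where M: "\<And>x. \<bar>\<phi> x\<bar> \<le> M" using test_function_bounded[OF assms(1)] by blast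
  have "integrable lebesgue (\<lambda>x. indicator K x *\<^sub>R f x)"
    using assms(2) K(1,2) by (simp add: locally_integrable_def set_integrable_def)
  then have "integrable lebesgue (\<lambda>x. \<phi> x * (indicator K x *\<^sub>R f x))"
    by (intro integrable_bounded_mult[OF _ M] continuous_imp_measurable_lebesgue test_function_continuous[OF assms(1)])
  moreover have "\<phi> x * (indicator K x *\<^sub>R f x) = f x * \<phi> x" for x
    using K(3) by (cases "x \<in> K") auto
  ultimately show ?thesis by (simp only:)
qed

lemma integrable_imp_locally_integrable:
  fixes f :: "real^'n \<Rightarrow> 'b::euclidean_space"
  assumes "integrable lebesgue f"
  shows "locally_integrable \<Omega> f"
  unfolding locally_integrable_def set_integrable_def
proof (intro allI impI)
  fix K :: "(real^'n) set" assume K: "compact K \<and> K \<subseteq> \<Omega>"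
  then have "K \<in> sets lebesgue" by (auto simp: compact_imp_closed)
  then show "integrable lebesgue (\<lambda>x. indicator K x *\<^sub>R f x)"
    using assms by (rule integrable_mult_indicator)
qed

lemma continuous_imp_locally_integrable:
  fixes f :: "real^'n \<Rightarrow> 'b::euclidean_space"
  assumes "continuous_on UNIV f"
  shows "locally_integrable \<Omega> f"
  unfolding locally_integrable_def set_integrable_def
proof (intro allI impI)
  fix K :: "(real^'n) set" assume K: "compact K \<and> K \<subseteq> \<Omega>"
  have "integrable lborel (\<lambda>x. indicator K x *\<^sub>R f x)"
    using K by (intro borel_integrable_compact continuous_on_subset[OF assms]) auto
  moreover have "(\<lambda>x. indicator K x *\<^sub>R f x) \<in> borel_measurable lborel"
    using K borel_measurable_continuous_onI[OF assms]
    by (intro borel_measurable_scaleR borel_measurable_indicator) (auto simp: borel_compact)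
  ultimately show "integrable lebesgue (\<lambda>x. indicator K x *\<^sub>R f x)"
    by (simp add: integrable_completion)
qed

lemma locally_integrable_subset: "locally_integrable \<Omega> f \<Longrightarrow> \<Omega>' \<subseteq> \<Omega> \<Longrightarrow> locally_integrable \<Omega>' f"
  by (auto simp: locally_integrable_def)

lemma locally_integrable_add:
  "locally_integrable \<Omega> f \<Longrightarrow> locally_integrable \<Omega> g \<Longrightarrow> locally_integrable \<Omega> (\<lambda>x. f x + g x)"
  by (auto simp: locally_integrable_def intro: set_integral_add)

lemma locally_integrable_diff:
  "locally_integrable \<Omega> f \<Longrightarrow> locally_integrable \<Omega> g \<Longrightarrow> locally_integrable \<Omega> (\<lambda>x. f x - g x)"
  by (auto simp: locally_integrable_def intro: set_integral_diff)

lemma locally_integrable_bounded_linear: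
  fixes f :: "real^'n \<Rightarrow> 'b::euclidean_space" and T :: "'b \<Rightarrow> 'c::euclidean_space"
  assumes "bounded_linear T" "locally_integrable \<Omega> f"
  shows "locally_integrable \<Omega> (\<lambda>x. T (f x))"
  unfolding locally_integrable_def set_integrable_def
proof (intro allI impI)
  fix K :: "(real^'n) set" assume "compact K \<and> K \<subseteq> \<Omega>"
  then have "integrable lebesgue (\<lambda>x. T (indicator K x *\<^sub>R f x))"
    using assms by (intro integrable_bounded_linear[OF assms(1)]) (auto simp: locally_integrable_def set_integrable_def)
  then show "integrable lebesgue (\<lambda>x. indicator K x *\<^sub>R T (f x))"
    by (simp add: linear_simps[OF assms(1)])
qed

lemma locally_integrable_vec:
  fixes f :: "real^'n \<Rightarrow> 'b::euclidean_space^'m"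
  assumes "\<And>i. locally_integrable \<Omega> (\<lambda>x. f x $ i)"
  shows "locally_integrable \<Omega> f"
  unfolding locally_integrable_def set_integrable_def
proof (intro allI impI)
  fix K :: "(real^'n) set" assume K: "compact K \<and> K \<subseteq> \<Omega>"
  have rep: "v = (\<Sum>i\<in>UNIV. axis i (v $ i))" for v :: "'b^'m"
    by (simp add: vec_eq_iff axis_def if_distrib cong: if_cong)
  have bl: "bounded_linear (axis i :: 'b \<Rightarrow> 'b^'m)" for i
  proof (rule bounded_linear_intro[where K=1])
    show "norm (axis i x :: 'b^'m) \<le> norm x * 1" for x
    proof -
      have "norm (axis i x :: 'b^'m) \<le> (\<Sum>k\<in>UNIV. norm ((axis i x :: 'b^'m) $ k))"
        unfolding norm_vec_def by (intro L2_set_le_sum) auto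
      also have "\<dots> = norm x"
        by (simp add: axis_def if_distrib cong: if_cong)
      finally show ?thesis by simp
    qed
  qed (auto simp: vec_eq_iff axis_def)
  have "integrable lebesgue (\<lambda>x. axis i (indicator K x *\<^sub>R f x $ i) :: 'b^'m)" for i
    using assms[of i] K by (intro integrable_bounded_linear[OF bl]) (auto simp: locally_integrable_def set_integrable_def)
  then have "integrable lebesgue (\<lambda>x. \<Sum>i\<in>UNIV. axis i ((indicator K x *\<^sub>R f x) $ i) :: 'b^'m)"
    by (intro Bochner_Integration.integrable_sum) simp
  then show "integrable lebesgue (\<lambda>x. indicator K x *\<^sub>R f x)"
    by (simp only: rep[symmetric])
qed

text \<open>One entry of a weak gradient. The integrals run over the whole space, where the test
  function makes the values outside \<open>\<Omega>\<close> irrelevant; this lets local statements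
  be combined with convolutions.\<close>

definition weak_pd :: "(real^'n) set \<Rightarrow> 'n \<Rightarrow> (real^'n \<Rightarrow> real) \<Rightarrow> (real^'n \<Rightarrow> real) \<Rightarrow> bool" where
  "weak_pd \<Omega> j u g \<longleftrightarrow> locally_integrable \<Omega> u \<and> locally_integrable \<Omega> g \<and>
     (\<forall>\<phi>. test_function \<Omega> \<phi> \<longrightarrow>
        (LINT x|lebesgue. u x * frechet_derivative \<phi> (at x) (axis j 1)) = - (LINT x|lebesgue. g x * \<phi> x))"

lemma has_weak_gradient_iff:
  assumes "open \<Omega>"
  shows "has_weak_gradient \<Omega> u G \<longleftrightarrow> (\<forall>i j. weak_pd \<Omega> j (\<lambda>x. u x $ i) (\<lambda>x. G x $ i $ j))"
proof -
  have \<Omega>: "\<Omega> \<in> sets lebesgue" using assms by auto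
  have eq: "(LINT x|lebesgue_on \<Omega>. u x $ i * frechet_derivative \<phi> (at x) (axis j 1)) =
      (LINT x|lebesgue. u x $ i * frechet_derivative \<phi> (at x) (axis j 1))"
     "(LINT x|lebesgue_on \<Omega>. G x $ i $ j * \<phi> x) = (LINT x|lebesgue. G x $ i $ j * \<phi> x)"
     if "test_function \<Omega> \<phi>" for \<phi> i j
    using test_function_zero[OF that] test_function_zero[OF test_function_partial[OF that]]
    by (auto intro!: integral_lebesgue_on_support[OF \<Omega>])
  have "locally_integrable \<Omega> u \<longleftrightarrow> (\<forall>i. locally_integrable \<Omega> (\<lambda>x. u x $ i))"
    using locally_integrable_vec locally_integrable_bounded_linear[OF bounded_linear_vec_nth] by blast
  moreover have "locally_integrable \<Omega> G \<longleftrightarrow> (\<forall>i j. locally_integrable \<Omega> (\<lambda>x. G x $ i $ j))"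
  proof (intro iffI allI)
    fix i j assume "locally_integrable \<Omega> G"
    then show "locally_integrable \<Omega> (\<lambda>x. G x $ i $ j)"
      by (intro locally_integrable_bounded_linear[OF bounded_linear_vec_nth, of \<Omega> "\<lambda>x. G x $ i"]
        locally_integrable_bounded_linear[OF bounded_linear_vec_nth, of \<Omega> G])
  qed (intro locally_integrable_vec, auto)
  ultimately show ?thesis
    unfolding has_weak_gradient_def weak_pd_def using eq by (auto cong: imp_cong)
qed

lemma weak_pdD:
  assumes "weak_pd \<Omega> j u g"
  shows "locally_integrable \<Omega> u" "locally_integrable \<Omega> g"
    "test_function \<Omega> \<phi> \<Longrightarrow>
      (LINT x|lebesgue. u x * frechet_derivative \<phi> (at x) (axis j 1)) = - (LINT x|lebesgue. g x * \<phi> x)"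
  using assms by (auto simp: weak_pd_def)

lemma weak_pd_subset: "weak_pd \<Omega> j u g \<Longrightarrow> \<Omega>' \<subseteq> \<Omega> \<Longrightarrow> weak_pd \<Omega>' j u g"
  unfolding weak_pd_def
  using locally_integrable_subset[of \<Omega> _ \<Omega>'] test_function_mono[of \<Omega>' _ \<Omega>] by blast

lemma weak_pd_add:
  assumes "weak_pd \<Omega> j u g" "weak_pd \<Omega> j v h"
  shows "weak_pd \<Omega> j (\<lambda>x. u x + v x) (\<lambda>x. g x + h x)"
  unfolding weak_pd_def
proof (intro conjI allI impI)
  fix \<phi> :: "real^'a \<Rightarrow> real" assume t: "test_function \<Omega> \<phi>"
  note i = locally_integrable_test_mult[OF t] locally_integrable_test_mult[OF test_function_partial[OF t]]
  show "(LINT x|lebesgue. (u x + v x) * frechet_derivative \<phi> (at x) (axis j 1)) = - (LINT x|lebesgue. (g x + h x) * \<phi> x)"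
    using i weak_pdD[OF assms(1)] weak_pdD[OF assms(2)] t by (simp add: distrib_right)
qed (use weak_pdD[OF assms(1)] weak_pdD[OF assms(2)] in \<open>auto intro: locally_integrable_add\<close>)

lemma weak_pd_cmult:
  assumes "weak_pd \<Omega> j u g"
  shows "weak_pd \<Omega> j (\<lambda>x. c * u x) (\<lambda>x. c * g x)"
  unfolding weak_pd_def
  using weak_pdD[OF assms] locally_integrable_bounded_linear[OF bounded_linear_mult_right[of c]]
  by (auto simp: mult.assoc)

lemma weak_pd_diff:
  assumes "weak_pd \<Omega> j u g" "weak_pd \<Omega> j v h"
  shows "weak_pd \<Omega> j (\<lambda>x. u x - v x) (\<lambda>x. g x - h x)"
  using weak_pd_add[OF assms(1) weak_pd_cmult[OF assms(2), of "-1"]] by simp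

text \<open>Integration by parts: the derivative of the compactly supported product of
  \<open>f\<close> with a test function integrates to 0.\<close>

lemma weak_pd_smooth:
  assumes "\<And>k. C_k k f"
  shows "weak_pd \<Omega> j f (\<lambda>x. frechet_derivative f (at x) (axis j 1))"
  unfolding weak_pd_def
proof (intro conjI allI impI)
  have c: "continuous_on UNIV f" "continuous_on UNIV (\<lambda>x. frechet_derivative f (at x) (axis j 1))"
    using assms[of 0] C_k_SucD(2)[OF assms, of 0] by auto
  then show l: "locally_integrable \<Omega> f" "locally_integrable \<Omega> (\<lambda>x. frechet_derivative f (at x) (axis j 1))"
    by (auto intro: continuous_imp_locally_integrable)
  fix \<phi> :: "real^'a \<Rightarrow> real" assume t: "test_function \<Omega> \<phi>"
  have "0 = (LINT x|lebesgue. frechet_derivative (\<lambda>x. \<phi> x * f x) (at x) (axis j 1))"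
    by (rule test_function_integral_partial[OF test_function_mult[OF t assms], symmetric])
  also have "\<dots> = (LINT x|lebesgue. f x * frechet_derivative \<phi> (at x) (axis j 1) + frechet_derivative f (at x) (axis j 1) * \<phi> x)"
    using differentiableI[OF test_function_deriv[OF t]] differentiableI[OF C_k_SucD(1)[OF assms]]
    by (simp add: frechet_derivative_mult mult.commute add.commute)
  also have "\<dots> = (LINT x|lebesgue. f x * frechet_derivative \<phi> (at x) (axis j 1)) + (LINT x|lebesgue. frechet_derivative f (at x) (axis j 1) * \<phi> x)"
    by (intro Bochner_Integration.integral_add locally_integrable_test_mult[OF t] l
        locally_integrable_test_mult[OF test_function_partial[OF t]])
  finally show "(LINT x|lebesgue. f x * frechet_derivative \<phi> (at x) (axis j 1)) = - (LINT x|lebesgue. frechet_derivative f (at x) (axis j 1) * \<phi> x)"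
    by simp
qed

text \<open>The product lives on the whole space because \<open>\<phi>\<close> vanishes outside \<open>\<Omega>\<close>.\<close>

lemma weak_pd_test_mult:
  assumes "weak_pd \<Omega> j u g" and t: "test_function \<Omega> \<phi>"
  shows "weak_pd UNIV j (\<lambda>x. \<phi> x * u x) (\<lambda>x. \<phi> x * g x + frechet_derivative \<phi> (at x) (axis j 1) * u x)"
proof -
  note l = weak_pdD(1,2)[OF assms(1)]
  let ?D = "\<lambda>x. frechet_derivative \<phi> (at x) (axis j 1)"
  have i: "integrable lebesgue (\<lambda>x. \<phi> x * u x)" "integrable lebesgue (\<lambda>x. \<phi> x * g x + ?D x * u x)"
    using locally_integrable_test_mult[OF t l(1)] locally_integrable_test_mult[OF t l(2)]
      locally_integrable_test_mult[OF test_function_partial[OF t] l(1)]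
    by (auto simp: mult.commute)
  show ?thesis unfolding weak_pd_def
  proof (intro conjI allI impI i integrable_imp_locally_integrable)
    fix \<psi> :: "real^'a \<Rightarrow> real" assume s: "test_function UNIV \<psi>"
    \<comment> \<open>\<open>\<psi>\<close> need not vanish outside \<open>\<Omega>\<close>, but the
      product of \<open>\<phi>\<close> and \<open>\<psi>\<close> does, so the derivative of
      \<open>u\<close> may be tested against this product.\<close>
    note ts = test_function_mult[OF t test_function_C_k[OF s]]
    let ?E = "\<lambda>x. frechet_derivative \<psi> (at x) (axis j 1)"
    have D: "frechet_derivative (\<lambda>x. \<phi> x * \<psi> x) (at x) (axis j 1) = \<phi> x * ?E x + ?D x * \<psi> x" for x
      using differentiableI[OF test_function_deriv[OF t]] differentiableI[OF test_function_deriv[OF s]]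
      by (simp add: frechet_derivative_mult)
    have tD: "test_function \<Omega> (\<lambda>x. ?D x * \<psi> x)"
      by (rule test_function_mult[OF test_function_partial[OF t] test_function_C_k[OF s]])
    have "(LINT x|lebesgue. \<phi> x * u x * ?E x) =
       (LINT x|lebesgue. u x * (\<phi> x * ?E x + ?D x * \<psi> x) - u x * (?D x * \<psi> x))"
      by (simp add: algebra_simps)
    also have "\<dots> = (LINT x|lebesgue. u x * (\<phi> x * ?E x + ?D x * \<psi> x)) - (LINT x|lebesgue. u x * (?D x * \<psi> x))"
      using locally_integrable_test_mult[OF test_function_partial[OF ts] l(1), of "axis j 1"]
        locally_integrable_test_mult[OF tD l(1)]
      by (intro Bochner_Integration.integral_diff) (auto simp: D)
    also have "(LINT x|lebesgue. u x * (\<phi> x * ?E x + ?D x * \<psi> x)) = - (LINT x|lebesgue. g x * (\<phi> x * \<psi> x))"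
      using weak_pdD(3)[OF assms(1) ts] by (simp add: D)
    also have "\<dots> - (LINT x|lebesgue. u x * (?D x * \<psi> x)) =
        - (LINT x|lebesgue. g x * (\<phi> x * \<psi> x) + u x * (?D x * \<psi> x))"
      using locally_integrable_test_mult[OF ts l(2)] locally_integrable_test_mult[OF tD l(1)] by simp
    also have "\<dots> = - (LINT x|lebesgue. (\<phi> x * g x + ?D x * u x) * \<psi> x)"
      by (simp add: algebra_simps)
    finally show "(LINT x|lebesgue. \<phi> x * u x * ?E x) = - (LINT x|lebesgue. (\<phi> x * g x + ?D x * u x) * \<psi> x)" .
  qed
qed

lemma frechet_derivative_reflect:
  fixes \<eta> :: "real^'n \<Rightarrow> real"
  assumes "test_function \<Omega> \<eta>"
  shows "frechet_derivative (\<lambda>y. \<eta> (x - y)) (at y) h = - frechet_derivative \<eta> (at (x - y)) h"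
proof -
  note d = test_function_deriv[OF assms, of "x - y"]
  have "((\<lambda>y. \<eta> (x - y)) has_derivative (\<lambda>h. frechet_derivative \<eta> (at (x - y)) (0 - h))) (at y)"
    by (rule has_derivative_compose[where f="\<lambda>y. x - y" and g=\<eta>, OF _ d]) (intro derivative_intros)
  from frechet_derivative_at[OF this] show ?thesis
    using linear_neg[OF has_derivative_linear[OF d]] by (metis diff_0)
qed

text \<open>Test the weak derivative with y |-> \<open>\<eta> (x - y)\<close>: the sign produced by
  the reflection cancels the one in the definition.\<close>

lemma convolve_weak_pd:
  assumes "weak_pd UNIV j u g" and t: "test_function UNIV \<eta>"
  shows "convolve (\<lambda>z. frechet_derivative \<eta> (at z) (axis j 1)) u x = convolve \<eta> g x"
proof -
  have "(LINT y|lebesgue. u y * frechet_derivative (\<lambda>y. \<eta> (x - y)) (at y) (axis j 1)) = - (LINT y|lebesgue. g y * \<eta> (x - y))"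
    by (rule weak_pdD(3)[OF assms(1) test_function_reflect[OF t]])
  then show ?thesis by (simp add: frechet_derivative_reflect[OF t] convolve_def mult.commute)
qed

text \<open>Localise \<open>h\<close> by a cut-off that is 1 on a compact piece of
  \<open>\<Omega>\<close>. Every value of a mollification of the product is \<open>h\<close> tested
  with a test function, hence 0, whereas the mollifications approximate the product in L^1.\<close>

lemma fundamental_lemma:
  fixes h :: "real^'n \<Rightarrow> real"
  assumes \<Omega>: "open \<Omega>" and l: "locally_integrable \<Omega> h"
    and 0: "\<And>\<phi>. test_function \<Omega> \<phi> \<Longrightarrow> (LINT x|lebesgue. h x * \<phi> x) = 0"
  shows "AE x in lebesgue. x \<in> \<Omega> \<longrightarrow> h x = 0"
proof -
  obtain C where C: "\<And>n::nat. compact (C n)" "\<And>n. C n \<subseteq> \<Omega>" "\<Union>(range C) = \<Omega>"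
    using open_Union_compact_subsets[OF \<Omega>] by metis
  have "AE x in lebesgue. x \<in> C n \<longrightarrow> h x = 0" for n
  proof -
    obtain \<kappa> U where \<kappa>: "test_function \<Omega> \<kappa>" "C n \<subseteq> U" "\<And>x. x \<in> U \<Longrightarrow> \<kappa> x = (1::real)"
      using test_function_cutoff[OF C(1) \<Omega> C(2), of n] by metis
    let ?f = "\<lambda>x. h x * \<kappa> x"
    have f: "integrable lebesgue ?f" by (rule locally_integrable_test_mult[OF \<kappa>(1) l])
    have "(LINT x|lebesgue. \<bar>?f x\<bar>) < e" if e: "e > 0" for e
    proof -
      obtain d where d: "d > 0" "\<And>\<eta>::real^'n \<Rightarrow> real. mollifier d \<eta> \<Longrightarrow> (LINT x|lebesgue. \<bar>convolve \<eta> ?f x - ?f x\<bar>) < e"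
        using mollify_L1[OF f e] by blast
      obtain \<eta> :: "real^'n \<Rightarrow> real" where \<eta>: "mollifier d \<eta>" using mollifier_exists[OF d(1)] .
      note t = mollifier_test[OF \<eta>]
      have "convolve \<eta> ?f x = 0" for x
        using 0[OF test_function_mult[OF \<kappa>(1) test_function_C_k[OF test_function_reflect[OF t]]], of x]
        by (simp add: convolve_def mult_ac)
      then show ?thesis using d(2)[OF \<eta>] by simp
    qed
    \<comment> \<open>If the norm were positive, it would be smaller than itself.\<close>
    from this[of "LINT x|lebesgue. \<bar>?f x\<bar>"] have "(LINT x|lebesgue. \<bar>?f x\<bar>) = 0"
      by (smt (verit) Bochner_Integration.integral_nonneg abs_ge_zero)
    then have "AE x in lebesgue. \<bar>?f x\<bar> = 0"
      using integral_nonneg_eq_0_iff_AE[OF integrable_abs[OF f]] by simp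
    then show ?thesis
    proof (rule AE_mp, intro AE_I2 impI)
      fix x assume "\<bar>?f x\<bar> = 0" "x \<in> C n"
      then show "h x = 0" using \<kappa>(2,3) by fastforce
    qed
  qed
  then have "AE x in lebesgue. \<forall>n. x \<in> C n \<longrightarrow> h x = 0" unfolding AE_all_countable ..
  then show ?thesis by (rule AE_mp, intro AE_I2) (use C(3) in blast)
qed

lemma weak_pd_unique:
  assumes \<Omega>: "open \<Omega>" and 1: "weak_pd \<Omega> j u g" and 2: "weak_pd \<Omega> j u h"
  shows "AE x in lebesgue. x \<in> \<Omega> \<longrightarrow> g x = h x"
proof -
  have "AE x in lebesgue. x \<in> \<Omega> \<longrightarrow> g x - h x = 0"
  proof (rule fundamental_lemma[OF \<Omega>])
    show "locally_integrable \<Omega> (\<lambda>x. g x - h x)"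
      by (intro locally_integrable_diff weak_pdD(2)[OF 1] weak_pdD(2)[OF 2])
    fix \<phi> :: "real^'a \<Rightarrow> real" assume t: "test_function \<Omega> \<phi>"
    show "(LINT x|lebesgue. (g x - h x) * \<phi> x) = 0"
      using weak_pdD(3)[OF 1 t] weak_pdD(3)[OF 2 t]
        locally_integrable_test_mult[OF t weak_pdD(2)[OF 1]] locally_integrable_test_mult[OF t weak_pdD(2)[OF 2]]
      by (simp add: left_diff_distrib)
  qed
  then show ?thesis by simp
qed

lemma has_weak_gradient_unique:
  assumes \<Omega>: "open \<Omega>" and "has_weak_gradient \<Omega> u G" "has_weak_gradient \<Omega> u H"
  shows "AE x in lebesgue. x \<in> \<Omega> \<longrightarrow> G x = H x"
proof -
  have "AE x in lebesgue. x \<in> \<Omega> \<longrightarrow> G x $ i $ j = H x $ i $ j" for i j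
    using assms(2,3) weak_pd_unique[OF \<Omega>, of j "\<lambda>x. u x $ i"] by (simp add: has_weak_gradient_iff[OF \<Omega>])
  then have "AE x in lebesgue. \<forall>i j. x \<in> \<Omega> \<longrightarrow> G x $ i $ j = H x $ i $ j"
    unfolding AE_all_countable by blast
  then show ?thesis by (rule AE_mp, intro AE_I2) (auto simp: vec_eq_iff)
qed

lemma has_weak_gradient_wgrad: "has_weak_gradient \<Omega> u G \<Longrightarrow> has_weak_gradient \<Omega> u (wgrad \<Omega> u)"
  unfolding wgrad_def by (rule someI[of "has_weak_gradient \<Omega> u"])

lemma wgrad_eq_AE:
  assumes "open \<Omega>" "has_weak_gradient \<Omega> u G"
  shows "AE x in lebesgue_on \<Omega>. wgrad \<Omega> u x = G x"
  using has_weak_gradient_unique[OF assms(1) has_weak_gradient_wgrad[OF assms(2)] assms(2)] assms(1)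
  by (simp add: AE_restrict_space_iff)

section \<open>Sobolev functions\<close>

text \<open>Pointwise limit of the restrictions to a compact exhaustion; each restriction is
  integrable by hypothesis.\<close>

lemma locally_integrable_measurable:
  fixes f :: "real^'n \<Rightarrow> 'b::euclidean_space"
  assumes \<Omega>: "open \<Omega>" and l: "locally_integrable \<Omega> f"
  shows "f \<in> borel_measurable (lebesgue_on \<Omega>)"
proof -
  obtain C where C: "\<And>n::nat. compact (C n)" "\<And>n. C n \<subseteq> \<Omega>" "\<And>n. C n \<subseteq> interior (C (Suc n))" "\<Union>(range C) = \<Omega>"
    by (rule open_Union_compact_subsets[OF \<Omega>]) (rule that)
  have mono: "C n \<subseteq> C m" if "n \<le> m" for n m
    by (rule lift_Suc_mono_le[of C, OF _ that]) (use C(3) interior_subset in blast)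
  have \<Omega>s: "\<Omega> \<in> sets lebesgue" using \<Omega> by auto
  show ?thesis
  proof (rule borel_measurable_LIMSEQ_metric)
    show "(\<lambda>x. indicator (C n) x *\<^sub>R f x) \<in> borel_measurable (lebesgue_on \<Omega>)" for n
      using l C(1,2)[of n]
      by (intro measurable_restrict_space1 borel_measurable_integrable)
        (auto simp: locally_integrable_def set_integrable_def)
    show "(\<lambda>n. indicator (C n) x *\<^sub>R f x) \<longlonglongrightarrow> f x" if x: "x \<in> space (lebesgue_on \<Omega>)" for x
    proof -
      have "x \<in> \<Omega>" using x by simp
      then obtain n where n: "x \<in> C n" using C(4) by blast
      have "eventually (\<lambda>m. indicator (C m) x *\<^sub>R f x = f x) sequentially"
        using eventually_ge_at_top[of n] by eventually_elim (use n mono in \<open>auto simp: indicator_def\<close>)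
      then show ?thesis by (rule tendsto_eventually)
    qed
  qed
qed

section \<open>The spaces L^p and W^{1,p}\<close>

lemma LpD:
  assumes "Lp \<Omega> p f"
  shows "f \<in> borel_measurable (lebesgue_on \<Omega>)" "integrable (lebesgue_on \<Omega>) (\<lambda>x. norm (f x) powr p)"
  using assms by (auto simp: Lp_def)

lemma Lp_bound:
  fixes f :: "real^'n \<Rightarrow> 'b::euclidean_space" and g :: "real^'n \<Rightarrow> 'c::euclidean_space"
  assumes "Lp \<Omega> p g" "0 \<le> p" "f \<in> borel_measurable (lebesgue_on \<Omega>)" "0 \<le> C"
    "\<And>x. x \<in> \<Omega> \<Longrightarrow> norm (f x) \<le> C * norm (g x)"
  shows "Lp \<Omega> p f"
  unfolding Lp_def
proof (rule conjI[OF assms(3) Bochner_Integration.integrable_bound])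
  show "integrable (lebesgue_on \<Omega>) (\<lambda>x. C powr p * norm (g x) powr p)"
    using LpD(2)[OF assms(1)] by simp
  show "(\<lambda>x. norm (f x) powr p) \<in> borel_measurable (lebesgue_on \<Omega>)" using assms(3) by simp
  show "AE x in lebesgue_on \<Omega>. norm (norm (f x) powr p) \<le> norm (C powr p * norm (g x) powr p)"
  proof (rule AE_I2)
    fix x assume "x \<in> space (lebesgue_on \<Omega>)"
    then have "norm (f x) powr p \<le> (C * norm (g x)) powr p"
      using assms(2,5) by (intro powr_mono2) auto
    then show "norm (norm (f x) powr p) \<le> norm (C powr p * norm (g x) powr p)"
      using assms(4) by (simp add: powr_mult)
  qed
qed

lemma Lp_add:
  fixes f g :: "real^'n \<Rightarrow> 'b::euclidean_space"
  assumes "0 \<le> p" "Lp \<Omega> p f" "Lp \<Omega> p g"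
  shows "Lp \<Omega> p (\<lambda>x. f x + g x)"
  unfolding Lp_def
proof (rule conjI[OF _ Bochner_Integration.integrable_bound])
  note [measurable] = LpD(1)[OF assms(2)] LpD(1)[OF assms(3)]
  show "(\<lambda>x. f x + g x) \<in> borel_measurable (lebesgue_on \<Omega>)" by simp
  show "(\<lambda>x. norm (f x + g x) powr p) \<in> borel_measurable (lebesgue_on \<Omega>)" by simp
  show "integrable (lebesgue_on \<Omega>) (\<lambda>x. 2 powr p * (norm (f x) powr p + norm (g x) powr p))"
    using LpD(2)[OF assms(2)] LpD(2)[OF assms(3)] by simp
  show "AE x in lebesgue_on \<Omega>. norm (norm (f x + g x) powr p) \<le> norm (2 powr p * (norm (f x) powr p + norm (g x) powr p))"
  proof (rule AE_I2)
    fix x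
    have "norm (f x + g x) powr p \<le> (norm (f x) + norm (g x)) powr p"
      using assms(1) norm_triangle_ineq by (intro powr_mono2) auto
    also have "\<dots> \<le> 2 powr p * (norm (f x) powr p + norm (g x) powr p)"
      using assms(1) by (intro powr_add_le) auto
    finally show "norm (norm (f x + g x) powr p) \<le> norm (2 powr p * (norm (f x) powr p + norm (g x) powr p))"
      by simp
  qed
qed

lemma Lp_scaleR:
  fixes f :: "real^'n \<Rightarrow> 'b::euclidean_space"
  assumes "0 \<le> p" "Lp \<Omega> p f"
  shows "Lp \<Omega> p (\<lambda>x. c *\<^sub>R f x)"
  by (rule Lp_bound[OF assms(2,1), of _ "\<bar>c\<bar>"]) (use LpD(1)[OF assms(2)] in auto)

lemma Lp_cong_AE:
  fixes f g :: "real^'n \<Rightarrow> 'b::euclidean_space"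
  assumes "Lp \<Omega> p g" "f \<in> borel_measurable (lebesgue_on \<Omega>)" "AE x in lebesgue_on \<Omega>. f x = g x"
  shows "Lp \<Omega> p f"
  unfolding Lp_def
proof (intro conjI assms(2))
  note [measurable] = assms(2) LpD(1)[OF assms(1)]
  have "AE x in lebesgue_on \<Omega>. norm (f x) powr p = norm (g x) powr p"
    using assms(3) by eventually_elim simp
  from integrable_cong_AE[OF _ _ this] LpD(2)[OF assms(1)]
  show "integrable (lebesgue_on \<Omega>) (\<lambda>x. norm (f x) powr p)" by simp
qed

lemma has_weak_gradient_add:
  assumes "open \<Omega>" "has_weak_gradient \<Omega> u G" "has_weak_gradient \<Omega> v H"
  shows "has_weak_gradient \<Omega> (\<lambda>x. u x + v x) (\<lambda>x. G x + H x)"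
  using assms(2,3) by (simp add: has_weak_gradient_iff[OF assms(1)] weak_pd_add)

lemma has_weak_gradient_diff:
  assumes "open \<Omega>" "has_weak_gradient \<Omega> u G" "has_weak_gradient \<Omega> v H"
  shows "has_weak_gradient \<Omega> (\<lambda>x. u x - v x) (\<lambda>x. G x - H x)"
  using assms(2,3) by (simp add: has_weak_gradient_iff[OF assms(1)] weak_pd_diff)

lemma has_weak_gradient_scaleR:
  assumes "open \<Omega>" "has_weak_gradient \<Omega> u G"
  shows "has_weak_gradient \<Omega> (\<lambda>x. c *\<^sub>R u x) (\<lambda>x. c *\<^sub>R G x)"
  using assms(2) by (simp add: has_weak_gradient_iff[OF assms(1)] weak_pd_cmult)

lemma wgrad_measurable:
  assumes "open \<Omega>" "has_weak_gradient \<Omega> u G"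
  shows "wgrad \<Omega> u \<in> borel_measurable (lebesgue_on \<Omega>)" "G \<in> borel_measurable (lebesgue_on \<Omega>)"
  using locally_integrable_measurable[OF assms(1)] has_weak_gradient_wgrad[OF assms(2)] assms(2)
  by (auto simp: has_weak_gradient_def)

lemma W1pI: "Lp \<Omega> p u \<Longrightarrow> has_weak_gradient \<Omega> u G \<Longrightarrow> Lp \<Omega> p G \<Longrightarrow> u \<in> W1p \<Omega> p"
  by (auto simp: W1p_def)

text \<open>Membership provides some gradient in L^p, while \<open>wgrad\<close> is an arbitrary
  choice; uniqueness almost everywhere transfers the integrability.\<close>

lemma W1pD:
  assumes "open \<Omega>" "u \<in> W1p \<Omega> p"
  shows "Lp \<Omega> p u" "has_weak_gradient \<Omega> u (wgrad \<Omega> u)" "Lp \<Omega> p (wgrad \<Omega> u)"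
proof -
  obtain G where G: "Lp \<Omega> p u" "has_weak_gradient \<Omega> u G" "Lp \<Omega> p G"
    using assms(2) by (auto simp: W1p_def)
  show "Lp \<Omega> p u" "has_weak_gradient \<Omega> u (wgrad \<Omega> u)" by (fact G(1), fact has_weak_gradient_wgrad[OF G(2)])
  show "Lp \<Omega> p (wgrad \<Omega> u)"
    by (rule Lp_cong_AE[OF G(3) wgrad_measurable(1)[OF assms(1) G(2)] wgrad_eq_AE[OF assms(1) G(2)]])
qed

lemma W1p_add:
  assumes "open \<Omega>" "0 \<le> p" "u \<in> W1p \<Omega> p" "v \<in> W1p \<Omega> p"
  shows "(\<lambda>x. u x + v x) \<in> W1p \<Omega> p"
    "AE x in lebesgue_on \<Omega>. wgrad \<Omega> (\<lambda>x. u x + v x) x = wgrad \<Omega> u x + wgrad \<Omega> v x"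
proof -
  note u = W1pD[OF assms(1,3)] and v = W1pD[OF assms(1,4)]
  note w = has_weak_gradient_add[OF assms(1) u(2) v(2)]
  show "(\<lambda>x. u x + v x) \<in> W1p \<Omega> p" by (rule W1pI[OF _ w]) (intro Lp_add u v assms)+
  show "AE x in lebesgue_on \<Omega>. wgrad \<Omega> (\<lambda>x. u x + v x) x = wgrad \<Omega> u x + wgrad \<Omega> v x"
    by (rule wgrad_eq_AE[OF assms(1) w])
qed

lemma W1p_scaleR:
  assumes "open \<Omega>" "0 \<le> p" "u \<in> W1p \<Omega> p"
  shows "(\<lambda>x. c *\<^sub>R u x) \<in> W1p \<Omega> p"
    "AE x in lebesgue_on \<Omega>. wgrad \<Omega> (\<lambda>x. c *\<^sub>R u x) x = c *\<^sub>R wgrad \<Omega> u x"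
proof -
  note u = W1pD[OF assms(1,3)]
  note w = has_weak_gradient_scaleR[OF assms(1) u(2)]
  show "(\<lambda>x. c *\<^sub>R u x) \<in> W1p \<Omega> p" by (rule W1pI[OF _ w]) (intro Lp_scaleR u assms)+
  show "AE x in lebesgue_on \<Omega>. wgrad \<Omega> (\<lambda>x. c *\<^sub>R u x) x = c *\<^sub>R wgrad \<Omega> u x"
    by (rule wgrad_eq_AE[OF assms(1) w])
qed

lemma W1p_norm_powr:
  assumes "0 < p"
  shows "W1p_norm \<Omega> p u powr p =
     (LINT x|lebesgue_on \<Omega>. norm (u x) powr p) + (LINT x|lebesgue_on \<Omega>. norm (wgrad \<Omega> u x) powr p)"
  using assms by (simp add: W1p_norm_def powr_powr Bochner_Integration.integral_nonneg add_nonneg_nonneg)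

lemma W1p_norm_nonneg: "0 \<le> W1p_norm \<Omega> p u"
  by (simp add: W1p_norm_def)

lemma integral_wgrad:
  assumes "open \<Omega>" "has_weak_gradient \<Omega> u G"
  shows "(LINT x|lebesgue_on \<Omega>. norm (wgrad \<Omega> u x) powr p) = (LINT x|lebesgue_on \<Omega>. norm (G x) powr p)"
proof (rule integral_cong_AE)
  note [measurable] = wgrad_measurable[OF assms]
  show "(\<lambda>x. norm (wgrad \<Omega> u x) powr p) \<in> borel_measurable (lebesgue_on \<Omega>)"
    "(\<lambda>x. norm (G x) powr p) \<in> borel_measurable (lebesgue_on \<Omega>)" by simp_all
  show "AE x in lebesgue_on \<Omega>. norm (wgrad \<Omega> u x) powr p = norm (G x) powr p"
    using wgrad_eq_AE[OF assms] by eventually_elim simp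
qed

section \<open>Sobolev functions with compact support\<close>

lemma norm_vec_powr_le:
  fixes v :: "'b::real_normed_vector^'m"
  assumes "0 \<le> p"
  shows "norm v powr p \<le> real CARD('m) powr p * (\<Sum>i\<in>UNIV. norm (v $ i) powr p)"
proof -
  define M where "M = Max (range (\<lambda>i. norm (v $ i)))"
  have "M \<in> range (\<lambda>i. norm (v $ i))" unfolding M_def by (intro Max_in) auto
  then obtain k where k: "M = norm (v $ k)" by auto
  have le: "norm (v $ i) \<le> norm (v $ k)" for i
    unfolding k[symmetric] M_def by (intro Max_ge) auto
  have "norm v \<le> (\<Sum>i\<in>UNIV. norm (v $ i))"
    unfolding norm_vec_def by (intro L2_set_le_sum) auto
  also have "\<dots> \<le> real CARD('m) * norm (v $ k)"
    using sum_bounded_above[of UNIV "\<lambda>i. norm (v $ i)", OF le] by simp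
  finally have "norm v powr p \<le> (real CARD('m) * norm (v $ k)) powr p"
    using assms by (intro powr_mono2) auto
  also have "\<dots> = real CARD('m) powr p * norm (v $ k) powr p"
    by (simp add: powr_mult)
  also have "\<dots> \<le> real CARD('m) powr p * (\<Sum>i\<in>UNIV. norm (v $ i) powr p)"
    by (intro mult_left_mono member_le_sum) auto
  finally show ?thesis .
qed

lemma powr_le_one_add_powr:
  fixes t p :: real
  assumes "1 \<le> p" "0 \<le> t"
  shows "t \<le> 1 + t powr p"
proof (cases "t \<le> 1")
  case False
  then have "t powr 1 \<le> t powr p" using assms by (intro powr_mono) auto
  then show ?thesis using False by simp
qed (simp add: add_increasing2)

text \<open>On the compact support, t is at most 1 + t^p, so L^p functions are integrable there and
  can be mollified on the whole space.\<close>

lemma Lp_UNIV_component: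
  fixes f :: "real^'n \<Rightarrow> 'b::euclidean_space" and T :: "'b \<Rightarrow> real"
  assumes p: "1 \<le> p" and f: "Lp UNIV p f" and K: "compact K" "\<And>x. x \<notin> K \<Longrightarrow> f x = 0"
    and T: "bounded_linear T" "\<And>v. \<bar>T v\<bar> \<le> norm v"
  shows "integrable lebesgue (\<lambda>x. T (f x))" "integrable lebesgue (\<lambda>x. \<bar>T (f x)\<bar> powr p)"
proof -
  have fm: "f \<in> borel_measurable lebesgue" and fi: "integrable lebesgue (\<lambda>x. norm (f x) powr p)"
    using LpD[OF f] by (simp_all add: lebesgue_on_UNIV_eq)
  have Tm: "(\<lambda>x. T (f x)) \<in> borel_measurable lebesgue"
    using borel_measurable_continuous_onI[OF linear_continuous_on[OF T(1), of UNIV]] fm by (rule measurable_compose[rotated])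
  show "integrable lebesgue (\<lambda>x. T (f x))"
  proof (rule Bochner_Integration.integrable_bound[OF _ Tm])
    show "integrable lebesgue (\<lambda>x. indicator K x + norm (f x) powr p)"
      using integrable_indicator_compact[OF K(1)] fi by (rule Bochner_Integration.integrable_add)
    have "\<bar>T (f x)\<bar> \<le> indicator K x + norm (f x) powr p" for x
    proof (cases "x \<in> K")
      case True
      then show ?thesis using T(2)[of "f x"] powr_le_one_add_powr[OF p norm_ge_zero, of "f x"] by simp
    next
      case False
      then show ?thesis using K(2)[of x] linear_simps(3)[OF T(1)] by simp
    qed
    then show "AE x in lebesgue. norm (T (f x)) \<le> norm (indicator K x + norm (f x) powr p)"
      by (intro AE_I2) (auto intro: order_trans[OF _ abs_ge_self])
  qed
  show "integrable lebesgue (\<lambda>x. \<bar>T (f x)\<bar> powr p)"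
  proof (rule Bochner_Integration.integrable_bound[OF fi])
    show "(\<lambda>x. \<bar>T (f x)\<bar> powr p) \<in> borel_measurable lebesgue" using Tm by simp
    show "AE x in lebesgue. norm (\<bar>T (f x)\<bar> powr p) \<le> norm (norm (f x) powr p)"
      using p T(2) by (intro AE_I2) (auto intro!: powr_mono2)
  qed
qed

lemma integral_lebesgue_on_le:
  fixes f :: "'a::euclidean_space \<Rightarrow> real"
  assumes "\<Omega> \<in> sets lebesgue" "integrable lebesgue f" "\<And>x. 0 \<le> f x"
  shows "integrable (lebesgue_on \<Omega>) f" "(LINT x|lebesgue_on \<Omega>. f x) \<le> (LINT x|lebesgue. f x)"
proof -
  have i: "integrable lebesgue (\<lambda>x. indicator \<Omega> x *\<^sub>R f x)"
    by (rule integrable_mult_indicator[OF assms(1,2)])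
  then show "integrable (lebesgue_on \<Omega>) f" using assms(1) by (simp add: integrable_restrict_space)
  show "(LINT x|lebesgue_on \<Omega>. f x) \<le> (LINT x|lebesgue. f x)"
    using assms(1) integral_mono[OF i assms(2)] assms(3)
    by (simp add: integral_restrict_space indicator_def)
qed

text \<open>All components of a function and all entries of its gradient must be approximated with
  one and the same kernel, hence a common radius.\<close>

lemma mollify_Lp_finite:
  fixes f :: "'i \<Rightarrow> real^'n \<Rightarrow> real"
  assumes p: "1 \<le> p" and I: "finite I" and f: "\<And>i. i \<in> I \<Longrightarrow> integrable lebesgue (f i)"
    "\<And>i. i \<in> I \<Longrightarrow> integrable lebesgue (\<lambda>x. \<bar>f i x\<bar> powr p)" and e: "e > 0"
  shows "\<exists>d>0. \<forall>\<eta>::real^'n \<Rightarrow> real. mollifier d \<eta> \<longrightarrow> (\<forall>i\<in>I.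
    integrable lebesgue (\<lambda>x. \<bar>convolve \<eta> (f i) x - f i x\<bar> powr p) \<and>
    (LINT x|lebesgue. \<bar>convolve \<eta> (f i) x - f i x\<bar> powr p) < e)"
  using I f
proof (induction I)
  case empty
  show ?case by (auto intro: exI[of _ 1])
next
  case (insert k I)
  obtain d1 where d1: "d1 > 0" "\<And>\<eta>::real^'n \<Rightarrow> real. mollifier d1 \<eta> \<Longrightarrow> (\<forall>i\<in>I.
    integrable lebesgue (\<lambda>x. \<bar>convolve \<eta> (f i) x - f i x\<bar> powr p) \<and>
    (LINT x|lebesgue. \<bar>convolve \<eta> (f i) x - f i x\<bar> powr p) < e)"
    using insert by auto
  obtain d2 where d2: "d2 > 0" "\<And>\<eta>::real^'n \<Rightarrow> real. mollifier d2 \<eta> \<Longrightarrow>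
    integrable lebesgue (\<lambda>x. \<bar>convolve \<eta> (f k) x - f k x\<bar> powr p) \<and>
    (LINT x|lebesgue. \<bar>convolve \<eta> (f k) x - f k x\<bar> powr p) < e"
    using mollify_Lp[OF p, of "f k" e] insert.prems e by auto
  show ?case
  proof (intro exI[of _ "min d1 d2"] conjI allI impI)
    show "min d1 d2 > 0" using d1(1) d2(1) by simp
    fix \<eta> :: "real^'n \<Rightarrow> real" assume \<eta>: "mollifier (min d1 d2) \<eta>"
    show "\<forall>i\<in>insert k I. integrable lebesgue (\<lambda>x. \<bar>convolve \<eta> (f i) x - f i x\<bar> powr p) \<and>
      (LINT x|lebesgue. \<bar>convolve \<eta> (f i) x - f i x\<bar> powr p) < e"
      using d1(2)[OF mollifier_mono[OF \<eta>]] d2(2)[OF mollifier_mono[OF \<eta>]] by simp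
  qed
qed

lemma convolve_weak_pd_smooth:
  assumes "weak_pd UNIV j u g" "integrable lebesgue u" and t: "test_function UNIV \<eta>"
  shows "frechet_derivative (convolve \<eta> u) (at x) (axis j 1) = convolve \<eta> g x"
  using frechet_derivative_at[OF convolve_has_derivative[OF t assms(2)], of x]
    convolve_weak_pd[OF assms(1) t, of x] by metis

text \<open>Mollify each component. For a radius below the distance from \<open>K\<close> to the
  boundary the support stays in \<open>\<Omega>\<close>, and since mollification commutes with weak
  differentiation the gradients converge in L^p as well.\<close>

lemma W1p0I:
  fixes u :: "real^'n \<Rightarrow> real^'m" and G :: "real^'n \<Rightarrow> real^'n^'m"
  assumes \<Omega>: "open \<Omega>" and p: "1 \<le> p" and w: "has_weak_gradient UNIV u G"
    and K: "compact K" "K \<subseteq> \<Omega>" "\<And>x. x \<notin> K \<Longrightarrow> u x = 0" "\<And>x. x \<notin> K \<Longrightarrow> G x = 0"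
    and L: "Lp UNIV p u" "Lp UNIV p G"
  shows "u \<in> W1p0 \<Omega> p"
proof -
  have \<Omega>s: "\<Omega> \<in> sets lebesgue" using \<Omega> by auto
  have p0: "0 \<le> p" "0 < p" using p by auto
  have pd: "weak_pd UNIV j (\<lambda>x. u x $ i) (\<lambda>x. G x $ i $ j)" for i j
    using w by (simp add: has_weak_gradient_iff)
  have pd\<Omega>: "weak_pd \<Omega> j (\<lambda>x. u x $ i) (\<lambda>x. G x $ i $ j)" for i j
    by (rule weak_pd_subset[OF pd]) simp
  have w\<Omega>: "has_weak_gradient \<Omega> u G" using pd\<Omega> by (simp add: has_weak_gradient_iff[OF \<Omega>])
  have Lres: "Lp \<Omega> p f" if "Lp UNIV p f" for f :: "real^'n \<Rightarrow> 'x::euclidean_space"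
    using LpD[OF that] integral_lebesgue_on_le(1)[OF \<Omega>s, of "\<lambda>x. norm (f x) powr p"]
    by (auto simp: Lp_def lebesgue_on_UNIV_eq intro: measurable_restrict_space1)
  have W: "u \<in> W1p \<Omega> p" by (rule W1pI[OF Lres[OF L(1)] w\<Omega> Lres[OF L(2)]])
  have bl: "bounded_linear (\<lambda>v::real^'m. v $ i)" "\<bar>v $ i\<bar> \<le> norm v" for i and v :: "real^'m"
    by (auto intro: bounded_linear_vec_nth component_le_norm_cart)
  have bl2: "bounded_linear (\<lambda>v::real^'n^'m. v $ i $ j)" for i j
    using bounded_linear_compose[OF bounded_linear_vec_nth bounded_linear_vec_nth] .
  have bl2': "\<bar>v $ i $ j\<bar> \<le> norm v" for i j and v :: "real^'n^'m"
    by (rule order_trans[OF component_le_norm_cart Finite_Cartesian_Product.norm_nth_le])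
  note ui = Lp_UNIV_component[OF p L(1) K(1,3) bl]
  note Gi = Lp_UNIV_component[OF p L(2) K(1,4) bl2 bl2']
  \<comment> \<open>\<open>A\<close> and \<open>B\<close> are the constants of
    \<open>norm_vec_powr_le\<close> for rows and for columns; \<open>D\<close> collects the total
    factor in front of the error of a single entry.\<close>
  define A where "A = real CARD('m) powr p"
  define B where "B = real CARD('n) powr p"
  define D where "D = A * real CARD('m) + A * (real CARD('m) * (B * real CARD('n)))"
  have AB: "A \<ge> 0" "B \<ge> 0" "D \<ge> 0" by (auto simp: A_def B_def D_def)
  obtain r where r: "r > 0" "(\<Union>y\<in>K. cball y r) \<subseteq> \<Omega>"
    using compact_subset_open_imp_cball_epsilon_subset[OF K(1) \<Omega> K(2)] by auto
  have "\<exists>\<phi>. (\<forall>i. test_function \<Omega> (\<lambda>x. \<phi> x $ i)) \<and> W1p_norm \<Omega> p (\<lambda>x. u x - \<phi> x) < \<epsilon>" if \<epsilon>: "\<epsilon> > 0" for \<epsilon>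
  proof -
    \<comment> \<open>Chosen so that \<open>D * e\<close> is strictly below the p-th power of
      \<open>\<epsilon>\<close>, also when \<open>D\<close> is 0.\<close>
    define e where "e = \<epsilon> powr p / (D + 1)"
    have e: "e > 0" using \<epsilon> AB by (simp add: e_def)
    obtain d1 where d1: "d1 > 0" "\<And>\<eta>::real^'n \<Rightarrow> real. mollifier d1 \<eta> \<Longrightarrow> (\<forall>i\<in>UNIV.
      integrable lebesgue (\<lambda>x. \<bar>convolve \<eta> (\<lambda>x. u x $ i) x - u x $ i\<bar> powr p) \<and>
      (LINT x|lebesgue. \<bar>convolve \<eta> (\<lambda>x. u x $ i) x - u x $ i\<bar> powr p) < e)"
      using mollify_Lp_finite[OF p finite_class.finite_UNIV, of "\<lambda>i x. u x $ i" e, OF ui e] by blast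
    obtain d2 where d2: "d2 > 0" "\<And>\<eta>::real^'n \<Rightarrow> real. mollifier d2 \<eta> \<Longrightarrow> (\<forall>ij\<in>UNIV.
      integrable lebesgue (\<lambda>x. \<bar>convolve \<eta> (\<lambda>x. G x $ fst ij $ snd ij) x - G x $ fst ij $ snd ij\<bar> powr p) \<and>
      (LINT x|lebesgue. \<bar>convolve \<eta> (\<lambda>x. G x $ fst ij $ snd ij) x - G x $ fst ij $ snd ij\<bar> powr p) < e)"
      using mollify_Lp_finite[OF p finite_class.finite_UNIV, of "\<lambda>ij x. G x $ fst ij $ snd ij" e, OF Gi e] by blast
    define d where "d = min r (min d1 d2)"
    have d: "d > 0" "d \<le> r" "d \<le> d1" "d \<le> d2" using r(1) d1(1) d2(1) by (auto simp: d_def)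
    obtain \<eta> :: "real^'n \<Rightarrow> real" where \<eta>: "mollifier d \<eta>" using mollifier_exists[OF d(1)] .
    note t = mollifier_test[OF \<eta>]
    note c1 = d1(2)[OF mollifier_mono[OF \<eta> d(3)]]
    have c2: "integrable lebesgue (\<lambda>x. \<bar>convolve \<eta> (\<lambda>x. G x $ i $ j) x - G x $ i $ j\<bar> powr p)"
      "(LINT x|lebesgue. \<bar>convolve \<eta> (\<lambda>x. G x $ i $ j) x - G x $ i $ j\<bar> powr p) < e" for i j
      using bspec[OF d2(2)[OF mollifier_mono[OF \<eta> d(4)]], of "(i, j)"] by simp_all
    define \<phi> :: "real^'n \<Rightarrow> real^'m" where "\<phi> x = (\<chi> i. convolve \<eta> (\<lambda>x. u x $ i) x)" for x
    define H :: "real^'n \<Rightarrow> real^'n^'m" where "H x = (\<chi> i j. G x $ i $ j - convolve \<eta> (\<lambda>x. G x $ i $ j) x)" for x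
    have "test_function \<Omega> (convolve \<eta> (\<lambda>x. u x $ i))" for i
    proof (rule convolve_test_function[OF t ui(1) compact_cball[of 0 d] K(1)])
      show "x + y \<in> \<Omega>" if "x \<in> cball 0 d" "y \<in> K" for x y
      proof -
        have "x + y \<in> cball y r" using that(1) d(2) by (simp add: dist_norm)
        then show ?thesis using r(2) that(2) by blast
      qed
    qed (use mollifier_zero[OF \<eta>] K(3) in \<open>auto simp: not_le\<close>)
    then have 1: "\<forall>i. test_function \<Omega> (\<lambda>x. \<phi> x $ i)" by (simp add: \<phi>_def)
    have "weak_pd \<Omega> j (\<lambda>x. u x $ i - convolve \<eta> (\<lambda>x. u x $ i) x) (\<lambda>x. G x $ i $ j - convolve \<eta> (\<lambda>x. G x $ i $ j) x)" for i j
      using weak_pd_diff[OF pd\<Omega> weak_pd_smooth[OF convolve_C_k[OF t ui(1)]], of j i i]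
      by (simp add: convolve_weak_pd_smooth[OF pd ui(1) t])
    then have wH: "has_weak_gradient \<Omega> (\<lambda>x. u x - \<phi> x) H"
      by (simp add: has_weak_gradient_iff[OF \<Omega>] \<phi>_def H_def)
    have "norm (u x - \<phi> x) powr p \<le> A * (\<Sum>i\<in>UNIV. \<bar>convolve \<eta> (\<lambda>x. u x $ i) x - u x $ i\<bar> powr p)" for x
      using norm_vec_powr_le[OF p0(1), of "u x - \<phi> x"] by (simp add: A_def \<phi>_def abs_minus_commute)
    then have "(LINT x|lebesgue_on \<Omega>. norm (u x - \<phi> x) powr p) \<le>
        (LINT x|lebesgue_on \<Omega>. A * (\<Sum>i\<in>UNIV. \<bar>convolve \<eta> (\<lambda>x. u x $ i) x - u x $ i\<bar> powr p))"
      using c1 AB by (intro integral_mono' integral_lebesgue_on_le(1)[OF \<Omega>s]) (auto intro!: mult_nonneg_nonneg sum_nonneg)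
    also have "\<dots> \<le> (LINT x|lebesgue. A * (\<Sum>i\<in>UNIV. \<bar>convolve \<eta> (\<lambda>x. u x $ i) x - u x $ i\<bar> powr p))"
      using c1 AB by (intro integral_lebesgue_on_le(2)[OF \<Omega>s]) (auto intro!: mult_nonneg_nonneg sum_nonneg)
    also have "\<dots> = A * (\<Sum>i\<in>UNIV. (LINT x|lebesgue. \<bar>convolve \<eta> (\<lambda>x. u x $ i) x - u x $ i\<bar> powr p))"
      using c1 by (simp add: Bochner_Integration.integral_sum)
    also have "\<dots> \<le> A * (\<Sum>i\<in>(UNIV::'m set). e)"
      using c1 AB by (intro mult_left_mono sum_mono) (auto intro: less_imp_le)
    finally have I1: "(LINT x|lebesgue_on \<Omega>. norm (u x - \<phi> x) powr p) \<le> A * real CARD('m) * e" by simp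
    let ?S = "\<lambda>x. A * (\<Sum>i\<in>UNIV. B * (\<Sum>j\<in>UNIV. \<bar>convolve \<eta> (\<lambda>x. G x $ i $ j) x - G x $ i $ j\<bar> powr p))"
    have S0: "0 \<le> ?S x" for x using AB by (auto intro!: mult_nonneg_nonneg sum_nonneg)
    have Si: "integrable lebesgue ?S" using c2(1) by auto
    have Hb: "norm (H x) powr p \<le> ?S x" for x
    proof -
      have "norm (H x) powr p \<le> A * (\<Sum>i\<in>UNIV. norm (H x $ i) powr p)"
        unfolding A_def by (rule norm_vec_powr_le[OF p0(1)])
      also have "\<dots> \<le> A * (\<Sum>i\<in>UNIV. B * (\<Sum>j\<in>UNIV. norm (H x $ i $ j) powr p))"
        unfolding B_def using AB by (intro mult_left_mono sum_mono norm_vec_powr_le[OF p0(1)]) auto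
      finally show ?thesis by (simp add: H_def abs_minus_commute)
    qed
    have "(LINT x|lebesgue_on \<Omega>. norm (H x) powr p) \<le> (LINT x|lebesgue_on \<Omega>. ?S x)"
      by (intro integral_mono' integral_lebesgue_on_le(1)[OF \<Omega>s Si S0] Hb S0)
    also have "\<dots> \<le> (LINT x|lebesgue. ?S x)"
      by (rule integral_lebesgue_on_le(2)[OF \<Omega>s Si S0])
    also have "\<dots> = A * (\<Sum>i\<in>UNIV. B * (\<Sum>j\<in>UNIV. (LINT x|lebesgue. \<bar>convolve \<eta> (\<lambda>x. G x $ i $ j) x - G x $ i $ j\<bar> powr p)))"
      using c2(1) by (simp add: Bochner_Integration.integral_sum)
    also have "\<dots> \<le> A * (\<Sum>i\<in>(UNIV::'m set). B * (\<Sum>j\<in>(UNIV::'n set). e))"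
      using c2(2) AB by (intro mult_left_mono sum_mono) (auto intro: less_imp_le)
    finally have I2: "(LINT x|lebesgue_on \<Omega>. norm (H x) powr p) \<le> A * (real CARD('m) * (B * real CARD('n))) * e"
      by (simp add: mult_ac)
    have "W1p_norm \<Omega> p (\<lambda>x. u x - \<phi> x) powr p \<le> D * e"
      unfolding W1p_norm_powr[OF p0(2)] integral_wgrad[OF \<Omega> wH]
      using I1 I2 by (simp add: D_def distrib_right)
    also have "D * e < \<epsilon> powr p"
      using AB \<epsilon> by (simp add: e_def field_simps)
    finally have "W1p_norm \<Omega> p (\<lambda>x. u x - \<phi> x) < \<epsilon>"
      using powr_less_cancel2[of p] p0(2) \<epsilon> W1p_norm_nonneg[of \<Omega> p "\<lambda>x. u x - \<phi> x"] 
      by (metis (no_types, lifting) not_le powr_mono2 less_imp_le)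
    with 1 show ?thesis by blast
  qed
  with W show ?thesis by (simp add: W1p0_def)
qed

section \<open>Weakly convergent sequences are bounded\<close>

text \<open>The sign of \<open>c k\<close> prevents the \<open>k\<close>-th term from cancelling the earlier ones, and the later
  terms add up to at most half of it.\<close>

lemma gliding_hump:
  fixes F :: "nat \<Rightarrow> 'x \<Rightarrow> real" and N :: "'x \<Rightarrow> real" and v :: "nat \<Rightarrow> 'x"
  assumes v: "\<And>n. v n \<in> W" and N: "\<And>u. u \<in> W \<Longrightarrow> 0 \<le> N u"
    and F: "\<And>n u. u \<in> W \<Longrightarrow> \<bar>F n u\<bar> \<le> 2 * N u" "\<And>n. F n (v n) = N (v n)"
    and unb: "\<And>B. \<exists>n. B < N (v n)"
  obtains r :: "nat \<Rightarrow> nat" and c :: "nat \<Rightarrow> real"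
    where "\<And>k. \<bar>c k\<bar> = (1/5) ^ k" "\<And>B. \<exists>n. B < \<bar>\<Sum>k. c k * F (r k) (v n)\<bar>"
proof -
  \<comment> \<open>The factor 5^k compensates the coefficient (1/5)^k, so the k-th term contributes
    at least k at its own vector.\<close>
  have "\<exists>n. real k * 5 ^ k < N (v n)" for k :: nat using unb by blast
  then obtain r where r: "\<And>k::nat. real k * 5 ^ k < N (v (r k))" by metis
  define sg where "sg s = (if s \<ge> 0 then 1 else -1 :: real)" for s :: real
  \<comment> \<open>The partial sums are defined recursively, as functions, because the sign of each
    coefficient depends on the preceding partial sum evaluated at \<open>v (r k)\<close>.\<close>
  define S where "S = rec_nat (\<lambda>u. 0) (\<lambda>k Sk u. Sk u + sg (Sk (v (r k))) * (1/5) ^ k * F (r k) u)"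
  define c where "c k = sg (S k (v (r k))) * (1/5) ^ k" for k
  have c: "\<bar>c k\<bar> = (1/5) ^ k" for k by (simp add: c_def sg_def abs_mult)
  have S: "S k u = (\<Sum>i<k. c i * F (r i) u)" for k u
    by (induction k) (simp_all add: S_def c_def)
  have "\<exists>n. B < \<bar>\<Sum>k. c k * F (r k) (v n)\<bar>" for B
  proof -
    obtain k :: nat where k: "2 * B < real k" using reals_Archimedean2 by blast
    let ?w = "v (r k)" and ?f = "\<lambda>i. c i * F (r i) (v (r k))"
    have bnd: "norm (?f i) \<le> (1/5) ^ i * (2 * N ?w)" for i
      unfolding real_norm_def abs_mult c using F(1)[OF v] by (intro mult_left_mono) auto
    have geo: "summable (\<lambda>i. (1/5::real) ^ i)" by (intro summable_geometric) simp
    have sumg: "summable (\<lambda>i. (1/5) ^ i * (2 * N ?w))" by (intro summable_mult2 geo)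
    have sf: "summable ?f" by (rule summable_comparison_test'[OF sumg, of 0]) (use bnd in auto)
    have split: "suminf ?f = (\<Sum>i. ?f (i + Suc k)) + (\<Sum>i<Suc k. ?f i)"
      by (rule suminf_split_initial_segment[OF sf])
    have "norm (\<Sum>i. ?f (i + Suc k)) \<le> (\<Sum>i. (1/5) ^ (i + Suc k) * (2 * N ?w))"
      by (rule norm_suminf_le[OF bnd]) (use sumg in \<open>rule summable_ignore_initial_segment\<close>)
    also have "(\<Sum>i. (1/5) ^ (i + Suc k) * (2 * N ?w)) = (\<Sum>i. (1/5::real) ^ i * ((1/5) ^ Suc k * (2 * N ?w)))"
      by (simp add: power_add mult_ac)
    also have "\<dots> = (\<Sum>i. (1/5::real) ^ i) * ((1/5) ^ Suc k * (2 * N ?w))"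
      by (rule suminf_mult2[OF geo, symmetric])
    \<comment> \<open>The geometric series sums to 5/4, and 5/4 times 1/5 times 2 is 1/2. The ratio
      1/5 is matched to the factor 2 in the bound on \<open>F\<close>, so that half of the k-th term
      survives.\<close>
    also have "\<dots> = (1/5) ^ k * N ?w / 2"
      by (subst suminf_geometric) auto
    finally have tail: "\<bar>\<Sum>i. ?f (i + Suc k)\<bar> \<le> (1/5) ^ k * N ?w / 2" by simp
    have "(\<Sum>i<Suc k. ?f i) = S k ?w + sg (S k ?w) * ((1/5) ^ k * N ?w)"
      by (simp only: sum.lessThan_Suc S[of k, symmetric] c_def[of k] F(2) mult.assoc)
    then have head: "\<bar>\<Sum>i<Suc k. ?f i\<bar> \<ge> (1/5) ^ k * N ?w"
    proof -
      have "0 \<le> q \<Longrightarrow> q \<le> \<bar>t + sg t * q\<bar>" for q t :: real by (simp add: sg_def)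
      moreover have "0 \<le> (1/5) ^ k * N ?w" using N[OF v, of "r k"] by simp
      ultimately show ?thesis using \<open>(\<Sum>i<Suc k. ?f i) = _\<close> by simp
    qed
    have "real k = (1/5) ^ k * (real k * 5 ^ k)" by (simp add: power_divide)
    also have "\<dots> \<le> (1/5) ^ k * N ?w" using less_imp_le[OF r[of k]] by (intro mult_left_mono) auto
    finally have "real k / 2 \<le> \<bar>suminf ?f\<bar>" using split tail head by linarith
    then show ?thesis using k by (intro exI[of _ "r k"]) linarith
  qed
  with c show ?thesis by (rule that)
qed

section \<open>Functionals on W^{1,p} given by integration\<close>

lemma powr_mult_le_add:
  fixes a b p :: real
  assumes "1 \<le> p" "0 \<le> a" "0 \<le> b"
  shows "a powr (p - 1) * b \<le> a powr p + b powr p"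
proof (cases "b \<le> a")
  case True
  then have "a powr (p - 1) * b \<le> a powr (p - 1) * a" by (intro mult_left_mono) auto
  also have "\<dots> = a powr p" using assms(2) powr_mult_base[of a "p - 1"] by (cases "a = 0") (auto simp: mult.commute)
  finally show ?thesis by (simp add: add_increasing2)
next
  case False
  then have "a powr (p - 1) * b \<le> b powr (p - 1) * b" using assms by (intro mult_right_mono powr_mono2) auto
  also have "\<dots> = b powr p" using False assms(2) powr_mult_base[of b "p - 1"] by (auto simp: mult.commute)
  finally show ?thesis by (simp add: add_increasing)
qed

text \<open>\<open>T\<close> is either the identity or the weak gradient. The latter is linear only
  up to null sets, which dictates the form of the assumptions; the boundedness argument is then
  carried out once for both.\<close>

locale W1p_operator =
  fixes \<Omega> :: "(real^'n) set" and p :: real and T :: "(real^'n \<Rightarrow> real^'m) \<Rightarrow> real^'n \<Rightarrow> 'b::euclidean_space"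
  assumes open_\<Omega>: "open \<Omega>" and p_gt_1: "1 < p"
    and T_Lp: "\<And>u. u \<in> W1p \<Omega> p \<Longrightarrow> Lp \<Omega> p (T u)"
    and T_add: "\<And>u v. u \<in> W1p \<Omega> p \<Longrightarrow> v \<in> W1p \<Omega> p \<Longrightarrow>
      AE x in lebesgue_on \<Omega>. T (\<lambda>x. u x + v x) x = T u x + T v x"
    and T_scale: "\<And>u c. u \<in> W1p \<Omega> p \<Longrightarrow> AE x in lebesgue_on \<Omega>. T (\<lambda>x. c *\<^sub>R u x) x = c *\<^sub>R T u x"
    and T_norm: "\<And>u. u \<in> W1p \<Omega> p \<Longrightarrow> (LINT x|lebesgue_on \<Omega>. norm (T u x) powr p) \<le> W1p_norm \<Omega> p u powr p"
begin

definition Lnorm :: "(real^'n \<Rightarrow> real^'m) \<Rightarrow> real" where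
  "Lnorm u = (LINT x|lebesgue_on \<Omega>. norm (T u x) powr p) powr (1 / p)"

lemma Lnorm_nonneg: "0 \<le> Lnorm u"
  by (simp add: Lnorm_def)

lemma Lnorm_powr: "Lnorm u powr p = (LINT x|lebesgue_on \<Omega>. norm (T u x) powr p)"
  using p_gt_1 by (simp add: Lnorm_def powr_powr Bochner_Integration.integral_nonneg)

lemma Lnorm_le: "u \<in> W1p \<Omega> p \<Longrightarrow> Lnorm u \<le> W1p_norm \<Omega> p u"
proof -
  assume "u \<in> W1p \<Omega> p"
  then have "Lnorm u \<le> (W1p_norm \<Omega> p u powr p) powr (1 / p)"
    unfolding Lnorm_def using T_norm p_gt_1 by (intro powr_mono2) (auto intro: Bochner_Integration.integral_nonneg)
  then show ?thesis using p_gt_1 W1p_norm_nonneg[of \<Omega> p u] by (simp add: powr_powr)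
qed

text \<open>\<open>k\<close> represents an element of a ball in the dual of L^p: the bound by
  s^(p-1), with \<open>s\<close> in the unit ball of L^p, is membership in the conjugate space
  expressed through \<open>p\<close> alone.\<close>

context
  fixes k :: "real^'n \<Rightarrow> 'b" and s :: "real^'n \<Rightarrow> real"
  assumes k: "k \<in> borel_measurable (lebesgue_on \<Omega>)" and s0: "\<And>x. 0 \<le> s x"
    and ks: "\<And>x. x \<in> \<Omega> \<Longrightarrow> norm (k x) \<le> s x powr (p - 1)"
    and s: "integrable (lebesgue_on \<Omega>) (\<lambda>x. s x powr p)" "(LINT x|lebesgue_on \<Omega>. s x powr p) \<le> 1"
begin

lemma inner_T_le:
  assumes "0 < c" "x \<in> \<Omega>"
  shows "\<bar>k x \<bullet> T u x\<bar> \<le> c * (s x powr p + norm (T u x) powr p / c powr p)"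
proof -
  have "\<bar>k x \<bullet> T u x\<bar> \<le> norm (k x) * norm (T u x)" by (rule Cauchy_Schwarz_ineq2)
  also have "\<dots> \<le> s x powr (p - 1) * norm (T u x)" by (intro mult_right_mono ks assms) auto
  also have "\<dots> = c * (s x powr (p - 1) * (norm (T u x) / c))" using assms by simp
  also have "\<dots> \<le> c * (s x powr p + (norm (T u x) / c) powr p)"
    using assms p_gt_1 s0 by (intro mult_left_mono powr_mult_le_add) auto
  finally show ?thesis using assms by (simp add: powr_divide)
qed

lemma integrable_inner_T:
  assumes "u \<in> W1p \<Omega> p"
  shows "integrable (lebesgue_on \<Omega>) (\<lambda>x. k x \<bullet> T u x)"
proof (rule Bochner_Integration.integrable_bound)
  note T = LpD[OF T_Lp[OF assms]]
  note [measurable] = k T(1)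
  show "(\<lambda>x. k x \<bullet> T u x) \<in> borel_measurable (lebesgue_on \<Omega>)" by measurable
  show "integrable (lebesgue_on \<Omega>) (\<lambda>x. s x powr p + norm (T u x) powr p)"
    using s(1) T(2) by simp
  show "AE x in lebesgue_on \<Omega>. norm (k x \<bullet> T u x) \<le> norm (s x powr p + norm (T u x) powr p)"
    using inner_T_le[of 1] by (intro AE_I2) auto
qed

text \<open>Hoelder's inequality with constant 2. Young's inequality without sharp constants, scaled
  by c = \<open>Lnorm u\<close>, gives c (1 + 1); if the norm is 0, then \<open>T u\<close> vanishes
  almost everywhere.\<close>

lemma inner_T_bound:
  assumes u: "u \<in> W1p \<Omega> p"
  shows "\<bar>LINT x|lebesgue_on \<Omega>. k x \<bullet> T u x\<bar> \<le> 2 * Lnorm u"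
proof (cases "Lnorm u = 0")
  case True
  note T = LpD[OF T_Lp[OF u]]
  have "(LINT x|lebesgue_on \<Omega>. norm (T u x) powr p) = 0"
    using Lnorm_powr[of u] True by simp
  then have "AE x in lebesgue_on \<Omega>. norm (T u x) powr p = 0"
    using integral_nonneg_eq_0_iff_AE[OF T(2)] by simp
  then have "AE x in lebesgue_on \<Omega>. k x \<bullet> T u x = 0"
    by (rule AE_mp) (auto intro!: AE_I2)
  then have "(LINT x|lebesgue_on \<Omega>. k x \<bullet> T u x) = 0"
    by (rule integral_eq_zero_AE)
  then show ?thesis using True by simp
next
  case False
  then have c: "Lnorm u > 0" using Lnorm_nonneg[of u] by simp
  let ?c = "Lnorm u"
  note T = LpD[OF T_Lp[OF u]]
  have "norm (LINT x|lebesgue_on \<Omega>. k x \<bullet> T u x) \<le>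
      (LINT x|lebesgue_on \<Omega>. ?c * (s x powr p + norm (T u x) powr p / ?c powr p))"
    using inner_T_le[OF c] s(1) T(2)
    by (intro Bochner_Integration.integral_norm_bound_integral integrable_inner_T[OF u]) auto
  also have "\<dots> = ?c * ((LINT x|lebesgue_on \<Omega>. s x powr p) + (LINT x|lebesgue_on \<Omega>. norm (T u x) powr p) / ?c powr p)"
    using s(1) T(2) by simp
  also have "\<dots> \<le> ?c * (1 + 1)"
    using c s(2) Lnorm_powr[of u] by (intro mult_left_mono add_mono) auto
  finally show ?thesis by simp
qed

lemma inner_T_add:
  assumes "u \<in> W1p \<Omega> p" "v \<in> W1p \<Omega> p"
  shows "(LINT x|lebesgue_on \<Omega>. k x \<bullet> T (\<lambda>x. u x + v x) x) =
    (LINT x|lebesgue_on \<Omega>. k x \<bullet> T u x) + (LINT x|lebesgue_on \<Omega>. k x \<bullet> T v x)"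
proof -
  have "(\<lambda>x. u x + v x) \<in> W1p \<Omega> p" 
    by (rule W1p_add(1)[OF open_\<Omega> _ assms]) (use p_gt_1 in simp)
  note i = integrable_inner_T[OF this] integrable_inner_T[OF assms(1)] integrable_inner_T[OF assms(2)]
  have "(LINT x|lebesgue_on \<Omega>. k x \<bullet> T (\<lambda>x. u x + v x) x) = (LINT x|lebesgue_on \<Omega>. k x \<bullet> T u x + k x \<bullet> T v x)"
  proof (rule integral_cong_AE)
    show "AE x in lebesgue_on \<Omega>. k x \<bullet> T (\<lambda>x. u x + v x) x = k x \<bullet> T u x + k x \<bullet> T v x"
      using T_add[OF assms] by eventually_elim (simp add: inner_add_right)
  qed (use i in \<open>auto intro: borel_measurable_integrable borel_measurable_add\<close>)
  then show ?thesis using i by simp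
qed

lemma inner_T_scale:
  assumes "u \<in> W1p \<Omega> p"
  shows "(LINT x|lebesgue_on \<Omega>. k x \<bullet> T (\<lambda>x. c *\<^sub>R u x) x) = c * (LINT x|lebesgue_on \<Omega>. k x \<bullet> T u x)"
proof -
  have "(\<lambda>x. c *\<^sub>R u x) \<in> W1p \<Omega> p" 
    by (rule W1p_scaleR(1)[OF open_\<Omega> _ assms]) (use p_gt_1 in simp)
  note i = integrable_inner_T[OF this] integrable_inner_T[OF assms(1)]
  have "(LINT x|lebesgue_on \<Omega>. k x \<bullet> T (\<lambda>x. c *\<^sub>R u x) x) = (LINT x|lebesgue_on \<Omega>. c * (k x \<bullet> T u x))"
  proof (rule integral_cong_AE)
    show "AE x in lebesgue_on \<Omega>. k x \<bullet> T (\<lambda>x. c *\<^sub>R u x) x = c * (k x \<bullet> T u x)"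
      using T_scale[OF assms, of c] by eventually_elim simp
  qed (use i in \<open>auto intro: borel_measurable_integrable\<close>)
  then show ?thesis by simp
qed

lemma inner_T_dual: "(\<lambda>u. a * (LINT x|lebesgue_on \<Omega>. k x \<bullet> T u x)) \<in> W1p_dual \<Omega> p"
  unfolding W1p_dual_def
proof (intro CollectI conjI ballI allI exI[of _ "\<bar>a\<bar> * 2"])
  fix u v :: "real^'n \<Rightarrow> real^'m"
  assume u: "u \<in> W1p \<Omega> p"
  show "a * (LINT x|lebesgue_on \<Omega>. k x \<bullet> T (\<lambda>x. c *\<^sub>R u x) x) = c * (a * (LINT x|lebesgue_on \<Omega>. k x \<bullet> T u x))" for c
    by (simp add: inner_T_scale[OF u])
  have "\<bar>a\<bar> * \<bar>LINT x|lebesgue_on \<Omega>. k x \<bullet> T u x\<bar> \<le> \<bar>a\<bar> * (2 * W1p_norm \<Omega> p u)"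
    using inner_T_bound[OF u] Lnorm_le[OF u] by (intro mult_left_mono) auto
  then show "\<bar>a * (LINT x|lebesgue_on \<Omega>. k x \<bullet> T u x)\<bar> \<le> \<bar>a\<bar> * 2 * W1p_norm \<Omega> p u"
    by (simp add: abs_mult)
  assume v: "v \<in> W1p \<Omega> p"
  show "a * (LINT x|lebesgue_on \<Omega>. k x \<bullet> T (\<lambda>x. u x + v x) x) =
    a * (LINT x|lebesgue_on \<Omega>. k x \<bullet> T u x) + a * (LINT x|lebesgue_on \<Omega>. k x \<bullet> T v x)"
    by (simp add: inner_T_add[OF u v] distrib_left)
qed

end

text \<open>The duality map of L^p: with \<open>h\<close> the normalised \<open>T v\<close>, the
  weight |h|^(p-2) h has norm at most |h|^(p-1) and pairs with \<open>T v\<close> to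
  \<open>Lnorm v\<close>. Where \<open>h\<close> vanishes, so does the weight.\<close>

lemma norming_functional:
  assumes v: "v \<in> W1p \<Omega> p"
  shows "\<exists>F. (\<forall>u\<in>W1p \<Omega> p. \<forall>w\<in>W1p \<Omega> p. F (\<lambda>x. u x + w x) = F u + F w) \<and>
    (\<forall>c. \<forall>u\<in>W1p \<Omega> p. F (\<lambda>x. c *\<^sub>R u x) = c * F u) \<and> (\<forall>u\<in>W1p \<Omega> p. \<bar>F u\<bar> \<le> 2 * Lnorm u) \<and> F v = Lnorm v"
proof (cases "Lnorm v = 0")
  case True
  then show ?thesis using Lnorm_nonneg by (intro exI[of _ "\<lambda>_. 0"]) auto
next
  case False
  then have a: "Lnorm v > 0" using Lnorm_nonneg[of v] by simp
  let ?a = "Lnorm v"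
  define h where "h x = (1 / ?a) *\<^sub>R T v x" for x
  define k where "k x = norm (h x) powr (p - 2) *\<^sub>R h x" for x
  note T = LpD[OF T_Lp[OF v]]
  have hm[measurable]: "h \<in> borel_measurable (lebesgue_on \<Omega>)" unfolding h_def using T(1) by measurable
  have km: "k \<in> borel_measurable (lebesgue_on \<Omega>)" unfolding k_def by measurable
  have hp: "norm (h x) powr p = norm (T v x) powr p / ?a powr p" for x
    using a by (simp add: h_def powr_divide)
  have hi: "integrable (lebesgue_on \<Omega>) (\<lambda>x. norm (h x) powr p)" using T(2) by (simp add: hp)
  have h1: "(LINT x|lebesgue_on \<Omega>. norm (h x) powr p) = 1"
    unfolding hp integral_divide_zero Lnorm_powr[symmetric] using a by simp
  have ks: "norm (k x) \<le> norm (h x) powr (p - 1)" for x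
    using powr_mult_base[of "norm (h x)" "p - 2"] by (cases "h x = 0") (auto simp: k_def mult.commute)
  note c = km norm_ge_zero ks hi order_eq_refl[OF h1]
  have "k x \<bullet> T v x = ?a * norm (h x) powr p" for x
  proof -
    have "k x \<bullet> T v x = ?a * (norm (h x) powr (p - 2) * (h x \<bullet> h x))"
      using a by (simp add: k_def h_def)
    also have "norm (h x) powr (p - 2) * (h x \<bullet> h x) = norm (h x) powr p"
    proof (cases "h x = 0")
      case False
      have "h x \<bullet> h x = norm (h x) powr 2" using False by (simp add: dot_square_norm powr_numeral)
      then show ?thesis using False by (simp add: powr_add[symmetric] del: powr_numeral)
    qed simp
    finally show ?thesis .
  qed
  then have "(LINT x|lebesgue_on \<Omega>. k x \<bullet> T v x) = ?a" using h1 by simp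
  then show ?thesis
    using inner_T_add[OF c] inner_T_scale[OF c] inner_T_bound[OF c]
    by (intro exI[of _ "\<lambda>u. LINT x|lebesgue_on \<Omega>. k x \<bullet> T u x"]) auto
qed

text \<open>Completeness of the dual is only needed for absolutely convergent series of functionals,
  which converge pointwise.\<close>

lemma weakly_convergent_bounded:
  assumes "W1p_weakly_tendsto \<Omega> p v u"
  obtains B where "\<And>n. (LINT x|lebesgue_on \<Omega>. norm (T (v n) x) powr p) \<le> B"
proof -
  have v: "v n \<in> W1p \<Omega> p" for n using assms by (simp add: W1p_weakly_tendsto_def)
  have "\<exists>B. \<forall>n. Lnorm (v n) \<le> B"
  proof (rule ccontr)
    assume "\<not> ?thesis"
    then have unb: "\<exists>n. B < Lnorm (v n)" for B by (simp add: not_le)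
    define F where "F n = (SOME F. (\<forall>u\<in>W1p \<Omega> p. \<forall>w\<in>W1p \<Omega> p. F (\<lambda>x. u x + w x) = F u + F w) \<and>
      (\<forall>c. \<forall>u\<in>W1p \<Omega> p. F (\<lambda>x. c *\<^sub>R u x) = c * F u) \<and> (\<forall>u\<in>W1p \<Omega> p. \<bar>F u\<bar> \<le> 2 * Lnorm u) \<and>
      F (v n) = Lnorm (v n))" for n
    note F' = someI_ex[OF norming_functional[OF v], folded F_def]
    have F: "F n (\<lambda>x. u x + w x) = F n u + F n w" "F n (\<lambda>x. c *\<^sub>R u x) = c * F n u"
      "\<bar>F n u\<bar> \<le> 2 * Lnorm u" "F n (v n) = Lnorm (v n)" if "u \<in> W1p \<Omega> p" "w \<in> W1p \<Omega> p" for n c u w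
      using F'[of n] that by blast+
    obtain r c where c: "\<And>k. \<bar>c k\<bar> = (1/5) ^ k" and un: "\<And>B. \<exists>n. B < \<bar>\<Sum>k. c k * F (r k) (v n)\<bar>"
      by (rule gliding_hump[of v "W1p \<Omega> p" Lnorm F, OF v Lnorm_nonneg F(3)[OF _ v] F(4)[OF v v] unb]) (assumption, rule that)
    define \<Phi> where "\<Phi> u = (\<Sum>k. c k * F (r k) u)" for u
    have geo: "summable (\<lambda>i. (1/5::real) ^ i)" by (intro summable_geometric) simp
    have bnd: "norm (c i * F (r i) u) \<le> (1/5) ^ i * (2 * W1p_norm \<Omega> p u)" if "u \<in> W1p \<Omega> p" for i u
      unfolding real_norm_def abs_mult c using order_trans[OF F(3)[OF that that]] Lnorm_le[OF that]
      by (intro mult_left_mono) auto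
    have sumg: "summable (\<lambda>i. (1/5) ^ i * (2 * W1p_norm \<Omega> p u))" for u by (intro summable_mult2 geo)
    have sf: "summable (\<lambda>i. c i * F (r i) u)" if "u \<in> W1p \<Omega> p" for u
      by (rule summable_comparison_test'[OF sumg[of u], of 0]) (use bnd[OF that] in auto)
    have "\<Phi> \<in> W1p_dual \<Omega> p"
      unfolding W1p_dual_def
    proof (intro CollectI conjI ballI allI exI[of _ "5 / 2"])
      fix u w :: "real^'n \<Rightarrow> real^'m"
      assume u: "u \<in> W1p \<Omega> p"
      show "\<Phi> (\<lambda>x. a *\<^sub>R u x) = a * \<Phi> u" for a
        unfolding \<Phi>_def using suminf_mult[OF sf[OF u], of a] by (simp add: F(2)[OF u u] mult_ac)
      have "norm (\<Phi> u) \<le> (\<Sum>i. (1/5) ^ i * (2 * W1p_norm \<Omega> p u))"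
        unfolding \<Phi>_def by (rule norm_suminf_le[OF bnd[OF u] sumg])
      also have "\<dots> = (\<Sum>i. (1/5::real) ^ i) * (2 * W1p_norm \<Omega> p u)"
        by (rule suminf_mult2[OF geo, symmetric])
      also have "\<dots> = 5 / 2 * W1p_norm \<Omega> p u"
        by (subst suminf_geometric) auto
      finally show "\<bar>\<Phi> u\<bar> \<le> 5 / 2 * W1p_norm \<Omega> p u" by simp
      assume w: "w \<in> W1p \<Omega> p"
      show "\<Phi> (\<lambda>x. u x + w x) = \<Phi> u + \<Phi> w"
        unfolding \<Phi>_def using suminf_add[OF sf[OF u] sf[OF w]] by (simp add: F(1)[OF u w] distrib_left)
    qed
    then have "(\<lambda>n. \<Phi> (v n)) \<longlonglongrightarrow> \<Phi> u"
      using assms by (auto simp: W1p_weakly_tendsto_def)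
    \<comment> \<open>The series is an admissible functional, so weak convergence bounds its values
      along the sequence, contrary to the gliding hump.\<close>
    then have "Bseq (\<lambda>n. \<Phi> (v n))" by (rule convergent_imp_Bseq[OF convergentI])
    then obtain K where "\<And>n. \<bar>\<Phi> (v n)\<bar> \<le> K" by (auto simp: Bseq_def)
    then show False using un[of K] by (auto simp: \<Phi>_def not_le[symmetric])
  qed
  then obtain B where B: "\<And>n. Lnorm (v n) \<le> B" by auto
  have "(LINT x|lebesgue_on \<Omega>. norm (T (v n) x) powr p) \<le> B powr p" for n
    unfolding Lnorm_powr[symmetric] using B Lnorm_nonneg p_gt_1 by (intro powr_mono2) auto
  then show ?thesis by (rule that)
qed

end

lemma W1p_operator_id:
  assumes "open \<Omega>" "1 < p"
  shows "W1p_operator \<Omega> p (\<lambda>u. u :: real^'n \<Rightarrow> real^'m)"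
proof
  show "(LINT x|lebesgue_on \<Omega>. norm (u x) powr p) \<le> W1p_norm \<Omega> p u powr p" for u :: "real^'n \<Rightarrow> real^'m"
    using assms(2) by (simp add: W1p_norm_powr Bochner_Integration.integral_nonneg)
qed (use assms W1pD(1) in auto)

lemma W1p_operator_wgrad:
  assumes "open \<Omega>" "1 < p"
  shows "W1p_operator \<Omega> p (wgrad \<Omega> :: (real^'n \<Rightarrow> real^'m) \<Rightarrow> _)"
proof
  show "(LINT x|lebesgue_on \<Omega>. norm (wgrad \<Omega> u x) powr p) \<le> W1p_norm \<Omega> p u powr p" for u :: "real^'n \<Rightarrow> real^'m"
    using assms(2) by (simp add: W1p_norm_powr Bochner_Integration.integral_nonneg)
  have p0: "0 \<le> p" using assms(2) by simp
  show "AE x in lebesgue_on \<Omega>. wgrad \<Omega> (\<lambda>x. u x + v x) x = wgrad \<Omega> u x + wgrad \<Omega> v x"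
    if "u \<in> W1p \<Omega> p" "v \<in> W1p \<Omega> p" for u v :: "real^'n \<Rightarrow> real^'m"
    by (rule W1p_add(2)[OF assms(1) p0 that])
  show "AE x in lebesgue_on \<Omega>. wgrad \<Omega> (\<lambda>x. c *\<^sub>R u x) x = c *\<^sub>R wgrad \<Omega> u x"
    if "u \<in> W1p \<Omega> p" for u :: "real^'n \<Rightarrow> real^'m" and c
    by (rule W1p_scaleR(2)[OF assms(1) p0 that])
qed (use assms W1pD(3)[OF assms(1)] in auto)

section \<open>Morrey's estimate and uniform convergence\<close>

lemma integrable_indicator_continuous:
  fixes g :: "real^'n \<Rightarrow> real"
  assumes "continuous_on UNIV g" "compact K"
  shows "integrable lebesgue (\<lambda>x. indicator K x * g x)"
  using continuous_imp_locally_integrable[OF assms(1), of UNIV] assms(2)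
  by (simp add: locally_integrable_def set_integrable_def)

lemma integral_cbox_eq_lebesgue:
  fixes g :: "real^'n \<Rightarrow> real"
  assumes "continuous_on UNIV g"
  shows "integral (cbox a b) g = (LINT x|lebesgue. indicator (cbox a b) x * g x)"
  using set_lebesgue_integral_eq_integral(2)[of "cbox a b" g] integrable_indicator_continuous[OF assms compact_cbox]
  by (simp add: set_integrable_def set_lebesgue_integral_def)

text \<open>Jensen's inequality on \<open>Q\<close> followed by the substitution that contracts
  towards \<open>x\<close> by the factor \<open>t\<close>. Its Jacobian t^N, to the power -1/p, is
  the source of the singular factor.\<close>

lemma integral_powr_affine_le:
  fixes G :: "real^'n \<Rightarrow> real"
  assumes G: "continuous_on UNIV G" "\<And>x. 0 \<le> G x" "integrable lebesgue (\<lambda>x. G x powr p)"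
    and p: "1 \<le> p" and Q: "compact Q" "measure lebesgue Q > 0" and t: "t > 0"
  shows "(LINT y|lebesgue. indicator Q y * G (x + t *\<^sub>R (y - x))) \<le>
    measure lebesgue Q powr (1 - 1 / p) * (LINT y|lebesgue. G y powr p) powr (1 / p) * t powr (- real CARD('n) / p)"
proof -
  let ?\<mu> = "measure lebesgue Q" and ?B = "LINT y|lebesgue. G y powr p"
  let ?g = "\<lambda>y. G (x + t *\<^sub>R (y - x))"
  have gc: "continuous_on UNIV ?g"
    by (intro continuous_on_compose2[OF G(1)] continuous_intros) auto
  have gpc: "continuous_on UNIV (\<lambda>y. ?g y powr p)"
    using p G(2) by (intro continuous_on_powr' gc continuous_intros) auto
  have Gpc: "continuous_on UNIV (\<lambda>y. G y powr p)"
    using p G(2) by (intro continuous_on_powr' G(1) continuous_intros) auto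
  let ?I = "LINT y|lebesgue. indicator Q y * ?g y" and ?J = "LINT y|lebesgue. indicator Q y * ?g y powr p"
  have int: "integrable lebesgue (\<lambda>y. indicator Q y * ?g y)" "integrable lebesgue (\<lambda>y. indicator Q y * ?g y powr p)"
    by (intro integrable_indicator_continuous gc gpc Q(1))+
  \<comment> \<open>The uniform distribution on \<open>Q\<close> is the probability density
    here.\<close>
  have "(LINT y|lebesgue. (indicator Q y / ?\<mu>) * ?g y) powr p \<le> (LINT y|lebesgue. (indicator Q y / ?\<mu>) * ?g y powr p)"
    using int integrable_indicator_compact[OF Q(1)] Q(2) G(2)
    by (intro integral_powr_le[OF p]) (auto simp: compact_imp_closed[OF Q(1)])
  then have jensen: "(?I / ?\<mu>) powr p \<le> ?J / ?\<mu>" by simp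
  \<comment> \<open>Dropping the indicator before substituting replaces the contracted cube by the
    whole space, so the bound is independent of \<open>x\<close>.\<close>
  have J: "t ^ CARD('n) * ?J \<le> ?B"
  proof -
    have bm: "(\<lambda>y. ennreal (G y powr p)) \<in> borel_measurable borel"
      using borel_measurable_continuous_onI[OF Gpc] by simp
    have eq: "x - t *\<^sub>R x + t *\<^sub>R y = x + t *\<^sub>R (y - x)" for y by (simp add: algebra_simps)
    have "ennreal (t ^ CARD('n) * ?J) = ennreal (t ^ CARD('n)) * ennreal ?J"
      using t by (intro ennreal_mult) (auto intro!: Bochner_Integration.integral_nonneg)
    also have "ennreal ?J = (\<integral>\<^sup>+y. ennreal (indicator Q y * ?g y powr p) \<partial>lebesgue)"
      by (rule nn_integral_eq_integral[OF int(2), symmetric]) auto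
    also have "\<dots> \<le> (\<integral>\<^sup>+y. ennreal (?g y powr p) \<partial>lebesgue)"
      by (intro nn_integral_mono ennreal_leI) (auto simp: indicator_def)
    also have "(\<integral>\<^sup>+y. ennreal (?g y powr p) \<partial>lebesgue) = (\<integral>\<^sup>+y. ennreal (?g y powr p) \<partial>lborel)"
      by (rule nn_integral_completion)
    also have "ennreal (t ^ CARD('n)) * \<dots> = (\<integral>\<^sup>+y. ennreal (G y powr p) \<partial>lborel)"
      using nn_integral_lborel_affine[OF bm, of t "x - t *\<^sub>R x"] t by (simp add: eq)
    also have "\<dots> = (\<integral>\<^sup>+y. ennreal (G y powr p) \<partial>lebesgue)"
      by (rule nn_integral_completion[symmetric])
    also have "\<dots> = ennreal ?B"
      by (rule nn_integral_eq_integral[OF G(3)]) auto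
    finally have "ennreal (t ^ CARD('n) * ?J) \<le> ennreal ?B"
      by (simp add: mult_left_mono)
    then show ?thesis by (subst (asm) ennreal_le_iff) (auto intro!: Bochner_Integration.integral_nonneg)
  qed
  have B0: "0 \<le> ?B" by (auto intro!: Bochner_Integration.integral_nonneg)
  have I0: "0 \<le> ?I" using G(2) by (auto intro!: Bochner_Integration.integral_nonneg)
  have "?J \<le> ?B * t powr (- real CARD('n))"
    using J t by (simp add: powr_minus powr_realpow divide_simps mult.commute)
  then have "(?I / ?\<mu>) powr p \<le> ?B * t powr (- real CARD('n)) / ?\<mu>"
    using jensen Q(2) by (meson divide_right_mono less_imp_le order_trans)
  then have "((?I / ?\<mu>) powr p) powr (1 / p) \<le> (?B * t powr (- real CARD('n)) / ?\<mu>) powr (1 / p)"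
    using p by (intro powr_mono2) auto
  also have "((?I / ?\<mu>) powr p) powr (1 / p) = ?I / ?\<mu>"
    using p I0 Q(2) by (simp add: powr_powr)
  also have "(?B * t powr (- real CARD('n)) / ?\<mu>) powr (1 / p) = ?B powr (1 / p) * t powr (- real CARD('n) / p) / ?\<mu> powr (1 / p)"
    using B0 Q(2) t p by (simp add: powr_divide powr_mult powr_powr)
  finally have "?I \<le> ?\<mu> * (?B powr (1 / p) * t powr (- real CARD('n) / p) / ?\<mu> powr (1 / p))"
    using Q(2) by (simp add: pos_divide_le_eq mult.commute)
  also have "\<dots> = ?\<mu> powr (1 - 1 / p) * ?B powr (1 / p) * t powr (- real CARD('n) / p)"
    using Q(2) by (simp add: powr_diff)
  finally show ?thesis .
qed

text \<open>The mean of \<open>u\<close> over the cube contracted towards \<open>x\<close> by the factor \<open>t\<close> has a derivative of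
  order \<open>t\<close> to the power \<open>-N / p\<close>, which is integrable on \<open>[0, 1]\<close> because \<open>p > N\<close>.\<close>

lemma morrey_smooth:
  fixes u G :: "real^'n \<Rightarrow> real"
  assumes p: "real CARD('n) < p" and u: "\<And>k. C_k k u"
    and G: "continuous_on UNIV G" "\<And>x h. \<bar>frechet_derivative u (at x) h\<bar> \<le> G x * norm h"
      "integrable lebesgue (\<lambda>x. G x powr p)"
    and Q: "measure lebesgue (cbox a b) > 0" "\<And>x y. x \<in> cbox a b \<Longrightarrow> y \<in> cbox a b \<Longrightarrow> norm (y - x) \<le> \<delta>"
    and x: "x \<in> cbox a b"
  shows "\<bar>measure lebesgue (cbox a b) * u x - integral (cbox a b) u\<bar> \<le>
    \<delta> * measure lebesgue (cbox a b) powr (1 - 1 / p) * (LINT y|lebesgue. G y powr p) powr (1 / p) / (1 - real CARD('n) / p)"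
proof -
  let ?N = "real CARD('n)" and ?Q = "cbox a b"
  have N1: "1 \<le> ?N" by simp
  then have p1: "1 \<le> p" using p by linarith
  have al: "0 < 1 - ?N / p" using p p1 by simp
  have \<delta>: "0 \<le> \<delta>" using Q(2)[OF x x] by simp
  have G0: "0 \<le> G z" for z
    using G(2)[of z "axis undefined 1"] order_trans[OF abs_ge_zero] by simp
  note du = C_k_SucD(1)[OF u]
  have uc: "continuous_on UNIV u" using u[of 0] by simp
  define c where "c t y = x + t *\<^sub>R (y - x)" for t y
  define D where "D t y = frechet_derivative u (at (c t y)) (y - x)" for t y
  \<comment> \<open>The mean without the volume factor, with the cube kept fixed and the argument
    moving: \<open>m 1\<close> is the integral of \<open>u\<close> and \<open>m 0\<close> is the
    volume times \<open>u x\<close>.\<close>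
  define m where "m t = integral ?Q (\<lambda>y. u (c t y))" for t
  define K where "K = \<delta> * (measure lebesgue ?Q powr (1 - 1 / p) * (LINT y|lebesgue. G y powr p) powr (1 / p))"
  have K0: "0 \<le> K" using \<delta> by (simp add: K_def)
  have cc: "continuous_on UNIV (c t)" for t
    unfolding c_def by (intro continuous_intros)
  have Dc: "continuous_on UNIV (\<lambda>(t, y). D t y)"
  proof -
    have rep: "D t y = (\<Sum>j\<in>Basis. ((y - x) \<bullet> j) * frechet_derivative u (at (c t y)) j)" for t y
      unfolding D_def by (rule linear_eq_sum_Basis[OF has_derivative_linear[OF du]])
    have "continuous_on UNIV (\<lambda>z. frechet_derivative u (at z) j)" for j
      using C_k_SucD(2)[OF u, of 0 j] by simp
    then have "continuous_on UNIV (\<lambda>ty. frechet_derivative u (at (c (fst ty) (snd ty))) j)" for j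
      unfolding c_def by (rule continuous_on_compose2) (auto intro!: continuous_intros)
    then show ?thesis
      unfolding rep case_prod_beta by (intro continuous_intros) auto
  qed
  have deriv: "((\<lambda>t. u (c t y)) has_vector_derivative D t y) (at t)" for t y
  proof -
    have "((\<lambda>t. c t y) has_derivative (\<lambda>s. s *\<^sub>R (y - x))) (at t)"
      unfolding c_def by (auto intro!: derivative_eq_intros)
    from has_derivative_compose[OF this du[of "c t y"]]
    show ?thesis
      unfolding has_vector_derivative_def D_def
      using linear_scale[OF has_derivative_linear[OF du[of "c t y"]]] by simp
  qed
  have uci: "continuous_on UNIV (\<lambda>y. u (c t y))" for t
    by (rule continuous_on_compose2[OF uc cc]) auto
  have md: "(m has_vector_derivative integral ?Q (D t)) (at t)" for t
  proof -
    have "(m has_vector_derivative integral ?Q (D t)) (at t within UNIV)"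
      unfolding m_def
    proof (rule leibniz_rule_vector_derivative)
      show "(\<lambda>y. u (c t y)) integrable_on ?Q" for t
        by (intro integrable_continuous continuous_on_subset[OF uci]) auto
      show "continuous_on (UNIV \<times> ?Q) (\<lambda>(t, y). D t y)"
        by (rule continuous_on_subset[OF Dc]) auto
    qed (auto simp: deriv)
    then show ?thesis by simp
  qed
  have bnd: "norm (integral ?Q (D t)) \<le> K * t powr (- ?N / p)" if "0 < t" for t
  proof -
    have gc: "continuous_on UNIV (\<lambda>y. G (c t y))" by (rule continuous_on_compose2[OF G(1) cc]) auto
    have Dtc: "continuous_on UNIV (D t)"
    proof -
      have "continuous_on UNIV (\<lambda>y::real^'n. (t, y))" by (intro continuous_on_Pair continuous_intros)
      from continuous_on_compose2[OF Dc this] show ?thesis by simp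
    qed
    have "norm (integral ?Q (D t)) \<le> integral ?Q (\<lambda>y. \<delta> * G (c t y))"
    proof (rule integral_norm_bound_integral)
      show "D t integrable_on ?Q" "(\<lambda>y. \<delta> * G (c t y)) integrable_on ?Q"
        by (intro integrable_continuous continuous_intros continuous_on_subset[OF gc] continuous_on_subset[OF Dtc]; simp)+
      fix y assume y: "y \<in> ?Q"
      have "\<bar>D t y\<bar> \<le> G (c t y) * norm (y - x)" unfolding D_def by (rule G(2))
      also have "\<dots> \<le> G (c t y) * \<delta>" by (intro mult_left_mono Q(2) x y G0)
      finally show "norm (D t y) \<le> \<delta> * G (c t y)" by (simp add: mult.commute)
    qed
    also have "\<dots> = \<delta> * integral ?Q (\<lambda>y. G (c t y))" by simp
    also have "integral ?Q (\<lambda>y. G (c t y)) = (LINT y|lebesgue. indicator ?Q y * G (c t y))"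
      by (rule integral_cbox_eq_lebesgue[OF gc])
    also have "\<delta> * \<dots> \<le> \<delta> * (measure lebesgue ?Q powr (1 - 1 / p) * (LINT y|lebesgue. G y powr p) powr (1 / p) * t powr (- ?N / p))"
      unfolding c_def by (intro mult_left_mono integral_powr_affine_le G(1,3) G0 p1 compact_cbox Q(1) that \<delta>)
    finally show ?thesis by (simp add: K_def mult_ac)
  qed
  \<comment> \<open>The comparison function is the primitive of the bound on the derivative. That
    bound is available only for t > 0, but the primitive is continuous up to t = 0 because its
    exponent 1 - N / p is positive.\<close>
  have "norm (m 1 - m 0) \<le> K * 1 powr (1 - ?N / p) / (1 - ?N / p) - K * 0 powr (1 - ?N / p) / (1 - ?N / p)"
  proof (rule differentiable_bound_general)
    show "continuous_on {0..1} m"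
      using md by (auto intro!: continuous_at_imp_continuous_on has_vector_derivative_continuous)
    show "continuous_on {0..1} (\<lambda>t. K * t powr (1 - ?N / p) / (1 - ?N / p))"
      using al by (intro continuous_intros continuous_on_powr') auto
    show "((\<lambda>t. K * t powr (1 - ?N / p) / (1 - ?N / p)) has_vector_derivative K * t powr (- ?N / p)) (at t)"
      if "0 < t" "t < 1" for t
    proof -
      define q where "q = 1 - ?N / p"
      have q: "q \<noteq> 0" "- ?N / p = q - 1" using al by (auto simp: q_def)
      have "((\<lambda>t. K * t powr q / q) has_real_derivative K * t powr (q - 1)) (at t)"
        by (rule DERIV_cong[OF DERIV_cdivide[OF DERIV_cmult[OF has_real_derivative_powr[OF that(1)]]]])
          (use q(1) in simp)
      then have "((\<lambda>t. K * t powr (1 - ?N / p) / (1 - ?N / p)) has_real_derivative K * t powr (- ?N / p)) (at t)"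
        unfolding q(2) by (simp only: q_def)
      then show ?thesis by (simp add: has_real_derivative_iff_has_vector_derivative)
    qed
  qed (use md bnd in auto)
  then have "\<bar>m 1 - m 0\<bar> \<le> K / (1 - ?N / p)" using al by simp
  moreover have "m 1 = integral ?Q u" by (simp add: m_def c_def)
  moreover have "m 0 = measure lebesgue ?Q * u x" by (simp add: m_def c_def)
  ultimately show ?thesis by (simp add: K_def abs_minus_commute mult.assoc)
qed

section \<open>From smooth to weakly differentiable functions\<close>

lemma sum_powr_le:
  fixes f :: "'i \<Rightarrow> real"
  assumes "0 \<le> p" "finite I" "\<And>i. i \<in> I \<Longrightarrow> 0 \<le> f i"
  shows "(\<Sum>i\<in>I. f i) powr p \<le> real (card I) powr p * (\<Sum>i\<in>I. f i powr p)"
proof (cases "I = {}")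
  case False
  have "Max (f ` I) \<in> f ` I" using assms(2) False by (intro Max_in) auto
  then obtain k where k: "k \<in> I" "Max (f ` I) = f k" by auto
  have le: "f i \<le> f k" if "i \<in> I" for i
    unfolding k(2)[symmetric] using assms(2) that by (intro Max_ge) auto
  have "(\<Sum>i\<in>I. f i) powr p \<le> (real (card I) * f k) powr p"
    using sum_bounded_above[of I f, OF le] assms by (intro powr_mono2 sum_nonneg) auto
  also have "\<dots> = real (card I) powr p * f k powr p"
    using assms(3)[OF k(1)] by (simp add: powr_mult)
  also have "\<dots> \<le> real (card I) powr p * (\<Sum>i\<in>I. f i powr p)"
    using assms(2) k(1) by (intro mult_left_mono member_le_sum) auto
  finally show ?thesis .
qed simp

text \<open>Apply the smooth estimate to mollifications of \<open>u\<close>. The L^p contraction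
  makes the right-hand side independent of the mollifier, and a subsequence of the mollifications
  converges almost everywhere as well as in the mean over the cube.\<close>

lemma morrey_weak:
  fixes u :: "real^'n \<Rightarrow> real" and g :: "'n \<Rightarrow> real^'n \<Rightarrow> real"
  assumes p: "real CARD('n) < p" and u: "integrable lebesgue u"
    and w: "\<And>j. weak_pd UNIV j u (g j)"
    and g: "\<And>j. integrable lebesgue (g j)" "\<And>j. integrable lebesgue (\<lambda>x. \<bar>g j x\<bar> powr p)"
      "\<And>j. (LINT x|lebesgue. \<bar>g j x\<bar> powr p) \<le> B"
    and Q: "measure lebesgue (cbox a b) > 0" "\<And>x y. x \<in> cbox a b \<Longrightarrow> y \<in> cbox a b \<Longrightarrow> norm (y - x) \<le> \<delta>"
  shows "AE x in lebesgue. x \<in> cbox a b \<longrightarrow>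
    \<bar>measure lebesgue (cbox a b) * u x - (LINT x|lebesgue. indicator (cbox a b) x * u x)\<bar> \<le>
      \<delta> * measure lebesgue (cbox a b) powr (1 - 1 / p) *
      (real CARD('n) powr p * (real CARD('n) * B)) powr (1 / p) / (1 - real CARD('n) / p)"
proof -
  let ?N = "real CARD('n)" and ?Q = "cbox a b"
  have "1 \<le> ?N" by simp
  then have p1: "1 \<le> p" using p by linarith
  have al: "0 < 1 - ?N / p" using p p1 by simp
  have "cbox a b \<noteq> {}" using Q(1) by auto
  then obtain x0 where x0: "x0 \<in> cbox a b" by auto
  have \<delta>: "0 \<le> \<delta>" using Q(2)[OF x0 x0] by simp
  define R where "R = \<delta> * measure lebesgue ?Q powr (1 - 1 / p) * (?N powr p * (?N * B)) powr (1 / p) / (1 - ?N / p)"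
  have "\<exists>\<eta>::real^'n \<Rightarrow> real. (\<exists>d. mollifier d \<eta>) \<and> (LINT x|lebesgue. \<bar>convolve \<eta> u x - u x\<bar>) < inverse (real (Suc k))" for k
  proof -
    obtain d where d: "d > 0" "\<And>\<eta>::real^'n \<Rightarrow> real. mollifier d \<eta> \<Longrightarrow> (LINT x|lebesgue. \<bar>convolve \<eta> u x - u x\<bar>) < inverse (real (Suc k))"
      using mollify_L1[OF u, of "inverse (real (Suc k))"] by auto
    obtain \<eta> :: "real^'n \<Rightarrow> real" where "mollifier d \<eta>" using mollifier_exists[OF d(1)] .
    with d(2) show ?thesis by blast
  qed
  then obtain \<eta> d where \<eta>: "\<And>k. mollifier (d k) (\<eta> k :: real^'n \<Rightarrow> real)"
    "\<And>k. (LINT x|lebesgue. \<bar>convolve (\<eta> k) u x - u x\<bar>) < inverse (real (Suc k))" by metis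
  note t = mollifier_test[OF \<eta>(1)]
  define U where "U k = convolve (\<eta> k) u" for k
  have Ui: "integrable lebesgue (U k)" for k unfolding U_def by (rule mollify_contraction(1)[OF \<eta>(1) u])
  have L1: "(\<lambda>k. LINT x|lebesgue. norm (U k x - u x)) \<longlonglongrightarrow> 0"
  proof (rule tendsto_sandwich[OF always_eventually always_eventually tendsto_const])
    show "(\<lambda>k. inverse (real (Suc k))) \<longlonglongrightarrow> 0" by (rule LIMSEQ_inverse_real_of_nat)
  qed (use \<eta>(2) in \<open>auto simp: U_def intro: less_imp_le Bochner_Integration.integral_nonneg\<close>)
  obtain r where r: "strict_mono r" "AE x in lebesgue. (\<lambda>k. U (r k) x - u x) \<longlonglongrightarrow> 0"
    using tendsto_L1_AE_subseq[OF _ L1] Ui u by auto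
  have Qi: "integrable lebesgue (\<lambda>x. indicator ?Q x * f x)" if "integrable lebesgue f" for f :: "real^'n \<Rightarrow> real"
    using integrable_mult_indicator[OF _ that, of ?Q] by simp
  have IQ: "(\<lambda>k. LINT x|lebesgue. indicator ?Q x * U k x) \<longlonglongrightarrow> (LINT x|lebesgue. indicator ?Q x * u x)"
  proof (rule LIM_zero_cancel, rule tendsto_norm_zero_cancel, rule tendsto_sandwich[OF always_eventually always_eventually tendsto_const L1])
    show "\<forall>k. norm ((LINT x|lebesgue. indicator ?Q x * U k x) - (LINT x|lebesgue. indicator ?Q x * u x)) \<le> (LINT x|lebesgue. norm (U k x - u x))"
    proof
      fix k
      have "(LINT x|lebesgue. indicator ?Q x * U k x) - (LINT x|lebesgue. indicator ?Q x * u x) =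
        (LINT x|lebesgue. indicator ?Q x * (U k x - u x))"
        using Qi[OF Ui] Qi[OF u] by (simp add: right_diff_distrib)
      also have "norm \<dots> \<le> (LINT x|lebesgue. norm (U k x - u x))"
        using Ui[of k] u Qi[of "\<lambda>x. U k x - u x"]
        by (intro Bochner_Integration.integral_norm_bound_integral) (auto simp: indicator_def)
      finally show "norm ((LINT x|lebesgue. indicator ?Q x * U k x) - (LINT x|lebesgue. indicator ?Q x * u x)) \<le> (LINT x|lebesgue. norm (U k x - u x))" .
    qed
  qed auto
  have bound: "\<bar>measure lebesgue ?Q * U k x - (LINT x|lebesgue. indicator ?Q x * U k x)\<bar> \<le> R" if x: "x \<in> ?Q" for k x
  proof -
    \<comment> \<open>The sum of the absolute partial derivatives dominates the derivative in every
      direction. Its p-th power costs the factor N^p and N summands, each with integral at most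
      \<open>B\<close>.\<close>
    define G where "G z = (\<Sum>j\<in>UNIV. \<bar>convolve (\<eta> k) (g j) z\<bar>)" for z
    have gc: "continuous_on UNIV (convolve (\<eta> k) (g j))" for j by (rule convolve_continuous[OF t g(1)])
    have Gc: "continuous_on UNIV G" unfolding G_def by (intro continuous_intros gc)
    have G0: "0 \<le> G z" for z by (simp add: G_def sum_nonneg)
    note mg = mollify_powr_contraction[OF \<eta>(1) p1 g(1,2)]
    have Gb: "G z powr p \<le> ?N powr p * (\<Sum>j\<in>UNIV. \<bar>convolve (\<eta> k) (g j) z\<bar> powr p)" for z
      unfolding G_def using p1 by (intro sum_powr_le) auto
    have Sb: "integrable lebesgue (\<lambda>z. ?N powr p * (\<Sum>j\<in>UNIV. \<bar>convolve (\<eta> k) (g j) z\<bar> powr p))"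
      using mg(1) by auto
    have Gp: "integrable lebesgue (\<lambda>z. G z powr p)"
    proof (rule Bochner_Integration.integrable_bound[OF Sb])
      show "(\<lambda>z. G z powr p) \<in> borel_measurable lebesgue"
        using continuous_imp_measurable_lebesgue[OF Gc] by simp
      show "AE z in lebesgue. norm (G z powr p) \<le> norm (?N powr p * (\<Sum>j\<in>UNIV. \<bar>convolve (\<eta> k) (g j) z\<bar> powr p))"
        using Gb by (intro AE_I2) (auto intro: order_trans[OF _ abs_ge_self])
    qed
    have "(LINT z|lebesgue. G z powr p) \<le> (LINT z|lebesgue. ?N powr p * (\<Sum>j\<in>UNIV. \<bar>convolve (\<eta> k) (g j) z\<bar> powr p))"
      by (rule integral_mono[OF Gp Sb Gb])
    also have "\<dots> = ?N powr p * (\<Sum>j\<in>UNIV. (LINT z|lebesgue. \<bar>convolve (\<eta> k) (g j) z\<bar> powr p))"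
      using mg(1) by (simp add: Bochner_Integration.integral_sum)
    also have "\<dots> \<le> ?N powr p * (\<Sum>j\<in>(UNIV::'n set). B)"
      using order_trans[OF mg(2) g(3)] by (intro mult_left_mono sum_mono) auto
    finally have GB: "(LINT z|lebesgue. G z powr p) \<le> ?N powr p * (?N * B)" by simp
    have Uk: "C_k i (U k)" for i unfolding U_def by (rule convolve_C_k[OF t u])
    have D: "\<bar>frechet_derivative (U k) (at z) h\<bar> \<le> G z * norm h" for z h
    proof -
      interpret D: linear "frechet_derivative (U k) (at z)" using has_derivative_linear[OF C_k_SucD(1)[OF Uk]] .
      have Dj: "frechet_derivative (U k) (at z) (axis j 1) = convolve (\<eta> k) (g j) z" for j
        unfolding U_def by (rule convolve_weak_pd_smooth[OF w u t])
      have "h = (\<Sum>j\<in>UNIV. (h $ j) *\<^sub>R axis j 1)"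
        using basis_expansion[of h] by (simp add: scalar_mult_eq_scaleR)
      then have "frechet_derivative (U k) (at z) h = frechet_derivative (U k) (at z) (\<Sum>j\<in>UNIV. (h $ j) *\<^sub>R axis j 1)"
        by simp
      also have "\<dots> = (\<Sum>j\<in>UNIV. (h $ j) * convolve (\<eta> k) (g j) z)"
        by (simp only: D.sum D.scaleR real_scaleR_def Dj)
      also have "\<bar>\<dots>\<bar> \<le> (\<Sum>j\<in>UNIV. norm h * \<bar>convolve (\<eta> k) (g j) z\<bar>)"
        by (intro order_trans[OF sum_abs] sum_mono) (auto simp: abs_mult intro!: mult_right_mono component_le_norm_cart)
      finally show ?thesis by (simp add: G_def sum_distrib_left[symmetric] mult.commute)
    qed
    have "\<bar>measure lebesgue ?Q * U k x - integral ?Q (U k)\<bar> \<le>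
      \<delta> * measure lebesgue ?Q powr (1 - 1 / p) * (LINT y|lebesgue. G y powr p) powr (1 / p) / (1 - ?N / p)"
      by (rule morrey_smooth[OF p Uk Gc D Gp Q x])
    also have "\<dots> \<le> R"
      unfolding R_def using GB al \<delta> p1
      by (intro divide_right_mono mult_left_mono powr_mono2) (auto intro!: Bochner_Integration.integral_nonneg)
    also have "integral ?Q (U k) = (LINT x|lebesgue. indicator ?Q x * U k x)"
      by (rule integral_cbox_eq_lebesgue[of "U k"]) (use Uk[of 0] in simp)
    finally show ?thesis .
  qed
  have "AE x in lebesgue. x \<in> ?Q \<longrightarrow> \<bar>measure lebesgue ?Q * u x - (LINT x|lebesgue. indicator ?Q x * u x)\<bar> \<le> R"
    using r(2)
  proof eventually_elim
    case (elim x)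
    show ?case
    proof
      assume x: "x \<in> ?Q"
      have "(\<lambda>k. U (r k) x) \<longlonglongrightarrow> u x" using elim by (rule LIM_zero_cancel)
      then have "(\<lambda>k. \<bar>measure lebesgue ?Q * U (r k) x - (LINT x|lebesgue. indicator ?Q x * U (r k) x)\<bar>)
        \<longlonglongrightarrow> \<bar>measure lebesgue ?Q * u x - (LINT x|lebesgue. indicator ?Q x * u x)\<bar>"
        using LIMSEQ_subseq_LIMSEQ[OF IQ r(1)] by (intro tendsto_intros) (auto simp: o_def)
      then show "\<bar>measure lebesgue ?Q * u x - (LINT x|lebesgue. indicator ?Q x * u x)\<bar> \<le> R"
        by (rule LIMSEQ_le_const2) (use bound[OF x] in auto)
    qed
  qed
  then show ?thesis by (simp add: R_def)
qed

lemma cube_facts: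
  fixes c :: "real^'n"
  assumes "\<rho> > 0"
  defines "Q \<equiv> cbox (c - (\<chi> i. \<rho> / 2)) (c + (\<chi> i. \<rho> / 2))"
  shows "measure lebesgue Q = \<rho> ^ CARD('n)" "\<And>x y. x \<in> Q \<Longrightarrow> y \<in> Q \<Longrightarrow> norm (y - x) \<le> real CARD('n) * \<rho>"
    "c \<in> interior Q"
proof -
  have m: "x \<in> Q \<longleftrightarrow> (\<forall>i. \<bar>x $ i - c $ i\<bar> \<le> \<rho> / 2)" for x
  proof -
    have "((c - (\<chi> i. \<rho> / 2)) $ i \<le> x $ i \<and> x $ i \<le> (c + (\<chi> i. \<rho> / 2)) $ i) \<longleftrightarrow> \<bar>x $ i - c $ i\<bar> \<le> \<rho> / 2" for i
      unfolding vector_minus_component vector_add_component vec_lambda_beta by arith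
    then show ?thesis unfolding Q_def mem_box_cart by simp
  qed
  have "c \<in> Q" unfolding m using assms by simp
  then show "measure lebesgue Q = \<rho> ^ CARD('n)"
    using content_cbox_cart[of "c - (\<chi> i. \<rho> / 2)" "c + (\<chi> i. \<rho> / 2)"]
    unfolding Q_def by (auto simp: measure_completion)
  show "norm (y - x) \<le> real CARD('n) * \<rho>" if "x \<in> Q" "y \<in> Q" for x y
  proof -
    have "\<bar>(y - x) $ i\<bar> \<le> \<rho>" for i
    proof -
      have "\<bar>x $ i - c $ i\<bar> \<le> \<rho> / 2" "\<bar>y $ i - c $ i\<bar> \<le> \<rho> / 2" using that unfolding m by auto
      then show ?thesis unfolding vector_minus_component by arith
    qed
    then have "(\<Sum>i\<in>UNIV. \<bar>(y - x) $ i\<bar>) \<le> real CARD('n) * \<rho>"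
      using sum_bounded_above[of UNIV "\<lambda>i. \<bar>(y - x) $ i\<bar>" \<rho>] by simp
    then show ?thesis using norm_le_l1_cart[of "y - x"] by linarith
  qed
  have "c \<in> box (c - (\<chi> i. \<rho> / 2)) (c + (\<chi> i. \<rho> / 2))" using assms by (simp add: mem_box_cart)
  then show "c \<in> interior Q" by (simp add: Q_def)
qed

text \<open>Divided by the volume, Morrey's bound on a cube of side \<open>\<rho>\<close> is C times
  \<open>\<rho>\<close> to the power 1 - N / p, for all members of the sequence alike. A small side
  makes it at most half of \<open>\<epsilon>\<close>; finitely many cubes cover \<open>K\<close>,
  and on these the means tend to 0.\<close>

lemma uniformly_small:
  fixes u :: "nat \<Rightarrow> real^'n \<Rightarrow> real" and g :: "nat \<Rightarrow> 'n \<Rightarrow> real^'n \<Rightarrow> real"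
  assumes p: "real CARD('n) < p" and u: "\<And>n. integrable lebesgue (u n)"
    and w: "\<And>n j. weak_pd UNIV j (u n) (g n j)"
    and g: "\<And>n j. integrable lebesgue (g n j)" "\<And>n j. integrable lebesgue (\<lambda>x. \<bar>g n j x\<bar> powr p)"
      "\<And>n j. (LINT x|lebesgue. \<bar>g n j x\<bar> powr p) \<le> B"
    and avg: "\<And>a b. (\<lambda>n. LINT x|lebesgue. indicator (cbox a b) x * u n x) \<longlonglongrightarrow> 0"
    and K: "compact K" and \<epsilon>: "\<epsilon> > 0"
  shows "eventually (\<lambda>n. AE x in lebesgue. x \<in> K \<longrightarrow> \<bar>u n x\<bar> \<le> \<epsilon>) sequentially"
proof -
  let ?N = "real CARD('n)"
  have "1 \<le> ?N" by simp
  then have p1: "1 \<le> p" using p by linarith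
  define q where "q = 1 - ?N / p"
  have q: "q > 0" using p p1 by (simp add: q_def)
  define C where "C = ?N * (?N powr p * (?N * B)) powr (1 / p) / q"
  have C: "C \<ge> 0" using q by (simp add: C_def)
  \<comment> \<open>The solution of (C + 1) \<open>\<rho>\<close>^q = \<open>\<epsilon>\<close> / 2;
    adding 1 covers C = 0.\<close>
  define \<rho> where "\<rho> = (\<epsilon> / (2 * (C + 1))) powr (1 / q)"
  have \<rho>: "\<rho> > 0" using \<epsilon> C by (simp add: \<rho>_def)
  have "C * \<rho> powr q = C * (\<epsilon> / (2 * (C + 1)))"
    using q \<epsilon> C by (simp add: \<rho>_def powr_powr)
  also have "\<dots> \<le> \<epsilon> / 2" using \<epsilon> C by (simp add: field_simps)
  finally have C\<rho>: "C * \<rho> powr q \<le> \<epsilon> / 2" .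
  define Q where "Q c = cbox (c - (\<chi> i. \<rho> / 2)) (c + (\<chi> i. \<rho> / 2))" for c :: "real^'n"
  have Q: "measure lebesgue (Q c) = \<rho> ^ CARD('n)" "\<And>x y. x \<in> Q c \<Longrightarrow> y \<in> Q c \<Longrightarrow> norm (y - x) \<le> ?N * \<rho>"
    "c \<in> interior (Q c)" for c
    unfolding Q_def by (rule cube_facts(1)[OF \<rho>], rule cube_facts(2)[OF \<rho>], assumption+, rule cube_facts(3)[OF \<rho>])
  let ?\<mu> = "\<rho> ^ CARD('n)"
  have \<mu>: "?\<mu> > 0" by (rule zero_less_power[OF \<rho>])
  have "K \<subseteq> (\<Union>c\<in>K. interior (Q c))"
  proof
    fix c assume "c \<in> K"
    then show "c \<in> (\<Union>c\<in>K. interior (Q c))" using Q(3)[of c] by (rule UN_I)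
  qed
  then obtain D where D: "finite D" "K \<subseteq> (\<Union>c\<in>D. interior (Q c))"
    by (rule compactE_image[OF K open_interior]) (rule that)
  have ev: "eventually (\<lambda>n. \<forall>c\<in>D. \<bar>LINT x|lebesgue. indicator (Q c) x * u n x\<bar> < ?\<mu> * (\<epsilon> / 2)) sequentially"
  proof (intro eventually_ball_finite D(1) ballI)
    fix c
    have "(\<lambda>n. \<bar>LINT x|lebesgue. indicator (Q c) x * u n x\<bar>) \<longlonglongrightarrow> 0"
      unfolding Q_def by (rule tendsto_rabs_zero[OF avg])
    then show "eventually (\<lambda>n. \<bar>LINT x|lebesgue. indicator (Q c) x * u n x\<bar> < ?\<mu> * (\<epsilon> / 2)) sequentially"
      using \<mu> \<epsilon> by (intro order_tendstoD) auto
  qed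
  then show ?thesis
  proof eventually_elim
    case (elim n)
    have "AE x in lebesgue. x \<in> Q c \<longrightarrow> \<bar>u n x\<bar> \<le> \<epsilon>" if c: "c \<in> D" for c
    proof -
      let ?I = "LINT x|lebesgue. indicator (Q c) x * u n x"
      have "AE x in lebesgue. x \<in> Q c \<longrightarrow> \<bar>measure lebesgue (Q c) * u n x - ?I\<bar> \<le>
        (?N * \<rho>) * measure lebesgue (Q c) powr (1 - 1 / p) * (?N powr p * (?N * B)) powr (1 / p) / (1 - ?N / p)"
        using Q(1)[of c] \<mu> Q(2)[of _ c] unfolding Q_def
        by (intro morrey_weak[OF p u w g]) auto
      \<comment> \<open>Since the volume is \<open>\<rho>\<close>^N, its power -1/p is
        \<open>\<rho>\<close> to the power -N/p, which together with the diameter factor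
        \<open>\<rho>\<close> gives \<open>\<rho>\<close>^q.\<close>
      moreover have "?N * \<rho> * ?\<mu> powr (1 - 1 / p) * (?N powr p * (?N * B)) powr (1 / p) / (1 - ?N / p) = ?\<mu> * (C * \<rho> powr q)"
      proof -
        have "?\<mu> powr (1 - 1 / p) = ?\<mu> * ?\<mu> powr (- 1 / p)"
          using powr_mult_base[of ?\<mu> "- 1 / p"] \<mu> by simp
        also have "?\<mu> powr (- 1 / p) = \<rho> powr (- ?N / p)"
          using \<rho> by (simp add: powr_realpow[symmetric] powr_powr)
        finally have 1: "?\<mu> powr (1 - 1 / p) = ?\<mu> * \<rho> powr (- ?N / p)" .
        have "\<rho> powr q = \<rho> * \<rho> powr (- ?N / p)"
          using powr_mult_base[of \<rho> "- ?N / p"] \<rho> by (simp add: q_def)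
        then show ?thesis unfolding 1 by (simp add: C_def q_def)
      qed
      ultimately have "AE x in lebesgue. x \<in> Q c \<longrightarrow> \<bar>?\<mu> * u n x - ?I\<bar> \<le> ?\<mu> * (C * \<rho> powr q)"
        by (simp add: Q(1))
      then show ?thesis
      proof eventually_elim
        case (elim x)
        show ?case
        proof
          assume "x \<in> Q c"
          then have "\<bar>?\<mu> * u n x\<bar> \<le> ?\<mu> * (C * \<rho> powr q) + \<bar>?I\<bar>" using elim by linarith
          also have "\<dots> \<le> ?\<mu> * (\<epsilon> / 2) + ?\<mu> * (\<epsilon> / 2)"
            using C\<rho> \<mu> \<open>\<forall>c\<in>D. _\<close>[rule_format, OF c] by (intro add_mono mult_left_mono) auto
          also have "\<dots> = ?\<mu> * \<epsilon>" by simp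
          finally show "\<bar>u n x\<bar> \<le> \<epsilon>" using \<mu> by (simp add: abs_mult)
        qed
      qed
    qed
    then have "AE x in lebesgue. \<forall>c\<in>D. x \<in> Q c \<longrightarrow> \<bar>u n x\<bar> \<le> \<epsilon>"
      by (rule AE_finite_allI[OF D(1)])
    then show ?case
      by eventually_elim (use D(2) interior_subset in blast)
  qed
qed

section \<open>The unit cube and uniform convergence on its compact subsets\<close>

lemma unit_cube_eq_box: "unit_cube = box (\<chi> i. - 1 / 2) (\<chi> i. 1 / 2)"
  by (auto simp: unit_cube_def mem_box_cart)

lemma open_unit_cube: "open unit_cube"
  unfolding unit_cube_eq_box by (rule open_box)

lemma sets_unit_cube: "(unit_cube :: (real^'n) set) \<in> sets lebesgue"
  using open_unit_cube[where 'a='n] by auto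

lemma emeasure_unit_cube: "emeasure lebesgue (unit_cube :: (real^'n) set) = 1"
proof -
  have "emeasure lebesgue (unit_cube :: (real^'n) set) = ennreal (\<Prod>b\<in>Basis. ((\<chi> i. 1/2) - (\<chi> i. - 1/2) :: real^'n) \<bullet> b)"
  proof -
    have "emeasure lebesgue (unit_cube :: (real^'n) set) = emeasure lborel (unit_cube :: (real^'n) set)"
      unfolding unit_cube_eq_box by simp
    also have "\<dots> = ennreal (\<Prod>b\<in>Basis. ((\<chi> i. 1/2) - (\<chi> i. - 1/2) :: real^'n) \<bullet> b)"
      unfolding unit_cube_eq_box by (rule emeasure_lborel_box) (auto simp: Basis_vec_def inner_axis)
    finally show ?thesis .
  qed
  also have "(\<Prod>b\<in>Basis. ((\<chi> i. 1/2) - (\<chi> i. - 1/2) :: real^'n) \<bullet> b) = 1"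
    by (rule prod.neutral) (auto simp: Basis_vec_def inner_axis)
  finally show ?thesis by simp
qed

lemma finite_measure_unit_cube: "finite_measure (lebesgue_on unit_cube)"
  by (rule finite_measureI) (simp add: emeasure_restrict_space sets_unit_cube emeasure_unit_cube)

lemma measure_unit_cube: "measure (lebesgue_on unit_cube) (unit_cube :: (real^'n) set) = 1"
  by (simp add: measure_def emeasure_restrict_space sets_unit_cube emeasure_unit_cube)

lemma integrable_lebesgue_on_support:
  fixes f :: "'a::euclidean_space \<Rightarrow> 'b::{banach, second_countable_topology}"
  assumes "\<Omega> \<in> sets lebesgue" "\<And>x. x \<notin> \<Omega> \<Longrightarrow> f x = 0" "integrable (lebesgue_on \<Omega>) f"
  shows "integrable lebesgue f"
proof -
  have "(\<lambda>x. indicator \<Omega> x *\<^sub>R f x) = f" using assms(2) by (auto simp: fun_eq_iff indicator_def)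
  then show ?thesis using assms(1,3) by (simp add: integrable_restrict_space)
qed

lemma W1p_diff:
  fixes u v :: "real^'n \<Rightarrow> real^'m"
  assumes "open \<Omega>" "0 \<le> p" "u \<in> W1p \<Omega> p" "v \<in> W1p \<Omega> p"
  shows "(\<lambda>x. u x - v x) \<in> W1p \<Omega> p"
  using W1p_add(1)[OF assms(1-3) W1p_scaleR(1)[OF assms(1,2,4), of "-1"]] by simp

lemma weakly_tendsto_diff:
  fixes u :: "real^'n \<Rightarrow> real^'m"
  assumes \<Omega>: "open \<Omega>" and p: "0 \<le> p" and v: "W1p_weakly_tendsto \<Omega> p v u"
  shows "W1p_weakly_tendsto \<Omega> p (\<lambda>n x. v n x - u x) (\<lambda>x. 0)"
proof -
  have W: "v n \<in> W1p \<Omega> p" "u \<in> W1p \<Omega> p" for n using v by (auto simp: W1p_weakly_tendsto_def)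
  have "(\<lambda>n. F (\<lambda>x. v n x - u x)) \<longlonglongrightarrow> F (\<lambda>x. 0)" if F: "F \<in> W1p_dual \<Omega> p" for F
  proof -
    have s: "F (\<lambda>x. c *\<^sub>R w x) = c * F w" if "w \<in> W1p \<Omega> p" for c w
      using F that by (auto simp: W1p_dual_def)
    have a: "F (\<lambda>x. w x + z x) = F w + F z" if "w \<in> W1p \<Omega> p" "z \<in> W1p \<Omega> p" for w z
      using F that by (auto simp: W1p_dual_def)
    have "F (\<lambda>x. v n x - u x) = F (v n) - F u" for n
      using a[OF W(1) W1p_scaleR(1)[OF \<Omega> p W(2), of "-1"], of n] s[OF W(2), of "-1"] by simp
    moreover have "F (\<lambda>x. 0) = 0" using s[OF W(2), of 0] by simp
    moreover have "(\<lambda>n. F (v n) - F u) \<longlonglongrightarrow> 0"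
      using v F by (intro LIM_zero) (auto simp: W1p_weakly_tendsto_def)
    ultimately show ?thesis by simp
  qed
  moreover have "(\<lambda>x. 0 :: real^'m) \<in> W1p \<Omega> p" using W1p_scaleR(1)[OF \<Omega> p W(2), of 0] by simp
  ultimately show ?thesis
    using W1p_diff[OF \<Omega> p W] by (auto simp: W1p_weakly_tendsto_def)
qed

text \<open>Multiplication by a cut-off that is 1 on \<open>K\<close> extends the components to the
  whole space. The bounds on functions and gradients come from the two instances of
  \<open>W1p_operator\<close>, and the means over boxes tend to 0 because each is a functional in
  the dual.\<close>

lemma weakly_null_uniformly_small:
  fixes z :: "nat \<Rightarrow> real^'n \<Rightarrow> real^'m"
  assumes p: "real CARD('n) < p" and z: "W1p_weakly_tendsto unit_cube p z (\<lambda>x. 0)"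
    and K: "compact K" "K \<subseteq> unit_cube" and \<epsilon>: "\<epsilon> > 0"
  shows "eventually (\<lambda>n. AE x in lebesgue. x \<in> K \<longrightarrow> norm (z n x) \<le> \<epsilon>) sequentially"
proof -
  let ?Y = "unit_cube :: (real^'n) set"
  have "1 \<le> real CARD('n)" by simp
  then have p1: "1 < p" using p by linarith
  interpret I: W1p_operator ?Y p "\<lambda>u. u :: real^'n \<Rightarrow> real^'m"
    by (rule W1p_operator_id[OF open_unit_cube p1])
  interpret D: W1p_operator ?Y p "wgrad ?Y :: (real^'n \<Rightarrow> real^'m) \<Rightarrow> _"
    by (rule W1p_operator_wgrad[OF open_unit_cube p1])
  interpret Y: finite_measure "lebesgue_on ?Y" by (rule finite_measure_unit_cube)
  have zW: "z n \<in> W1p ?Y p" for n using z by (simp add: W1p_weakly_tendsto_def)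
  note W = W1pD[OF open_unit_cube zW]
  obtain B1 where B1: "\<And>n. (LINT x|lebesgue_on ?Y. norm (z n x) powr p) \<le> B1"
    using I.weakly_convergent_bounded[OF z] by blast
  obtain B2 where B2: "\<And>n. (LINT x|lebesgue_on ?Y. norm (wgrad ?Y (z n) x) powr p) \<le> B2"
    using D.weakly_convergent_bounded[OF z] by blast
  obtain \<kappa> U where \<kappa>: "test_function ?Y \<kappa>" "\<And>x. 0 \<le> \<kappa> x" "\<And>x. \<kappa> x \<le> 1" "K \<subseteq> U" "\<And>x. x \<in> U \<Longrightarrow> \<kappa> x = 1"
    using test_function_cutoff[OF K(1) open_unit_cube K(2)] by metis
  obtain M where M: "M > 0" "\<And>x h. \<bar>frechet_derivative \<kappa> (at x) h\<bar> \<le> M * norm h"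
    using test_function_deriv_bound[OF \<kappa>(1)] by blast
  have M': "\<bar>frechet_derivative \<kappa> (at x) (axis j 1)\<bar> \<le> M" for x j
    using M(2)[of x "axis j 1"] by simp
  have ev: "eventually (\<lambda>n. AE x in lebesgue. x \<in> K \<longrightarrow> \<bar>\<kappa> x * z n x $ i\<bar> \<le> \<epsilon> / real CARD('m)) sequentially" for i
  proof (rule uniformly_small[OF p _ _ _ _ _ _ K(1)])
    define G where "G n j x = \<kappa> x * wgrad ?Y (z n) x $ i $ j + frechet_derivative \<kappa> (at x) (axis j 1) * z n x $ i" for n j x
    have pd: "weak_pd ?Y j (\<lambda>x. z n x $ i) (\<lambda>x. wgrad ?Y (z n) x $ i $ j)" for n j
      using W(2) by (simp add: has_weak_gradient_iff[OF open_unit_cube])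
    show "weak_pd UNIV j (\<lambda>x. \<kappa> x * z n x $ i) (G n j)" for n j
      unfolding G_def by (rule weak_pd_test_mult[OF pd \<kappa>(1)])
    show "integrable lebesgue (\<lambda>x. \<kappa> x * z n x $ i)" for n
      using locally_integrable_test_mult[OF \<kappa>(1) weak_pdD(1)[OF pd]] by (simp add: mult.commute)
    show Gi: "integrable lebesgue (G n j)" for n j
      unfolding G_def
      using locally_integrable_test_mult[OF \<kappa>(1) weak_pdD(2)[OF pd]]
        locally_integrable_test_mult[OF test_function_partial[OF \<kappa>(1)] weak_pdD(1)[OF pd]]
      by (simp add: mult.commute)
    have G0: "G n j x = 0" if "x \<notin> ?Y" for n j x
      unfolding G_def using test_function_zero[OF \<kappa>(1) that] test_function_zero[OF test_function_partial[OF \<kappa>(1)] that] by simp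
    let ?b = "\<lambda>n x. 2 powr p * (norm (wgrad ?Y (z n) x) powr p + M powr p * norm (z n x) powr p)"
    have b: "\<bar>G n j x\<bar> powr p \<le> ?b n x" for n j x
    proof -
      have "\<bar>\<kappa> x * wgrad ?Y (z n) x $ i $ j\<bar> \<le> 1 * norm (wgrad ?Y (z n) x)"
        unfolding abs_mult using \<kappa>(2,3)[of x]
        by (intro mult_mono order_trans[OF component_le_norm_cart Finite_Cartesian_Product.norm_nth_le]) auto
      moreover have "\<bar>frechet_derivative \<kappa> (at x) (axis j 1) * z n x $ i\<bar> \<le> M * norm (z n x)"
        unfolding abs_mult by (intro mult_mono M' component_le_norm_cart) (use M(1) in auto)
      ultimately have "\<bar>G n j x\<bar> \<le> norm (wgrad ?Y (z n) x) + M * norm (z n x)"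
        unfolding G_def by linarith
      then have "\<bar>G n j x\<bar> powr p \<le> (norm (wgrad ?Y (z n) x) + M * norm (z n x)) powr p"
        using p1 by (intro powr_mono2) auto
      also have "\<dots> \<le> 2 powr p * (norm (wgrad ?Y (z n) x) powr p + (M * norm (z n x)) powr p)"
        using p1 M(1) by (intro powr_add_le) auto
      finally show ?thesis using M(1) by (simp add: powr_mult)
    qed
    have bi: "integrable (lebesgue_on ?Y) (?b n)" for n
      using LpD(2)[OF W(1)] LpD(2)[OF W(3)] by simp
    have Gp: "integrable (lebesgue_on ?Y) (\<lambda>x. \<bar>G n j x\<bar> powr p)" for n j
    proof (rule Bochner_Integration.integrable_bound[OF bi[of n]])
      have "G n j \<in> borel_measurable (lebesgue_on ?Y)"
        by (rule measurable_restrict_space1[OF borel_measurable_integrable[OF Gi]])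
      then show "(\<lambda>x. \<bar>G n j x\<bar> powr p) \<in> borel_measurable (lebesgue_on ?Y)" by simp
      show "AE x in lebesgue_on ?Y. norm (\<bar>G n j x\<bar> powr p) \<le> norm (?b n x)"
        using b by (intro AE_I2) (auto intro: order_trans[OF _ abs_ge_self])
    qed
    show "integrable lebesgue (\<lambda>x. \<bar>G n j x\<bar> powr p)" for n j
      by (rule integrable_lebesgue_on_support[OF sets_unit_cube _ Gp]) (simp add: G0)
    show "(LINT x|lebesgue. \<bar>G n j x\<bar> powr p) \<le> 2 powr p * (B2 + M powr p * B1)" for n j
    proof -
      have "(LINT x|lebesgue. \<bar>G n j x\<bar> powr p) = (LINT x|lebesgue_on ?Y. \<bar>G n j x\<bar> powr p)"
        by (rule integral_lebesgue_on_support[OF sets_unit_cube, symmetric]) (simp add: G0)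
      also have "\<dots> \<le> (LINT x|lebesgue_on ?Y. ?b n x)"
        by (rule integral_mono[OF Gp bi b])
      also have "\<dots> = 2 powr p * ((LINT x|lebesgue_on ?Y. norm (wgrad ?Y (z n) x) powr p) + M powr p * (LINT x|lebesgue_on ?Y. norm (z n x) powr p))"
        using LpD(2)[OF W(1)] LpD(2)[OF W(3)] by simp
      also have "\<dots> \<le> 2 powr p * (B2 + M powr p * B1)"
        by (intro mult_left_mono add_mono B1 B2) auto
      finally show ?thesis .
    qed
    show "(\<lambda>n. LINT x|lebesgue. indicator (cbox a b) x * (\<kappa> x * z n x $ i)) \<longlonglongrightarrow> 0" for a b
    proof -
      \<comment> \<open>The weight that expresses the mean of the i-th component over the box as an
        integral pairing. It is bounded by 1, so the constant function 1, with integral 1 over the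
        cube, serves as the required dominating function.\<close>
      define k where "k x = (indicator (cbox a b) x * \<kappa> x) *\<^sub>R (axis i 1 :: real^'m)" for x
      have km: "k \<in> borel_measurable (lebesgue_on ?Y)"
        unfolding k_def
        by (intro measurable_restrict_space1 borel_measurable_scaleR borel_measurable_times borel_measurable_indicator
            continuous_imp_measurable_lebesgue[OF test_function_continuous[OF \<kappa>(1)]]) auto
      have kn: "norm (k x) \<le> 1 powr (p - 1)" for x
        using \<kappa>(2,3)[of x] by (auto simp: k_def indicator_def)
      have "(\<lambda>u. 1 * (LINT x|lebesgue_on ?Y. k x \<bullet> u x)) \<in> W1p_dual ?Y p"
        by (rule I.inner_T_dual[OF km _ kn]) (auto simp: measure_unit_cube)
      then have "(\<lambda>n. LINT x|lebesgue_on ?Y. k x \<bullet> z n x) \<longlonglongrightarrow> (LINT x|lebesgue_on ?Y. k x \<bullet> 0)"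
        using z unfolding W1p_weakly_tendsto_def by fastforce
      moreover have "(LINT x|lebesgue_on ?Y. k x \<bullet> z n x) = (LINT x|lebesgue. indicator (cbox a b) x * (\<kappa> x * z n x $ i))" for n
        by (subst integral_lebesgue_on_support[OF sets_unit_cube])
          (auto simp: k_def inner_axis' test_function_zero[OF \<kappa>(1)] mult.assoc)
      ultimately show ?thesis by simp
    qed
  qed (use \<epsilon> in auto)
  have "eventually (\<lambda>n. \<forall>i. AE x in lebesgue. x \<in> K \<longrightarrow> \<bar>\<kappa> x * z n x $ i\<bar> \<le> \<epsilon> / real CARD('m)) sequentially"
    using eventually_all_finite[OF ev] .
  then show ?thesis
  proof eventually_elim
    case (elim n)
    then have "AE x in lebesgue. \<forall>i. x \<in> K \<longrightarrow> \<bar>\<kappa> x * z n x $ i\<bar> \<le> \<epsilon> / real CARD('m)"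
      unfolding AE_all_countable .
    then show ?case
    proof eventually_elim
      case (elim x)
      show ?case
      proof
        assume x: "x \<in> K"
        then have "\<kappa> x = 1" using \<kappa>(4,5) by blast
        then have "\<bar>z n x $ i\<bar> \<le> \<epsilon> / real CARD('m)" for i using elim x by simp
        then have "(\<Sum>i\<in>UNIV. \<bar>z n x $ i\<bar>) \<le> \<epsilon>"
          using sum_bounded_above[of UNIV "\<lambda>i. \<bar>z n x $ i\<bar>" "\<epsilon> / real CARD('m)"] by simp
        then show "norm (z n x) \<le> \<epsilon>" using norm_le_l1_cart[of "z n x"] by linarith
      qed
    qed
  qed
qed

section \<open>Equi-integrability\<close>

text \<open>Adding up all thresholds up to \<open>k\<close> gives a monotone sequence beyond each of
  them, and the summand \<open>k\<close> makes it strict.\<close>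

lemma strict_mono_selection:
  assumes "\<And>k::nat. eventually (P k) sequentially"
  obtains h :: "nat \<Rightarrow> nat" where "strict_mono h" "\<And>k. P k (h k)"
proof -
  obtain N where N: "\<And>k n. N k \<le> n \<Longrightarrow> P k n"
    using assms unfolding eventually_sequentially by metis
  define h where "h k = k + (\<Sum>i\<le>k. N i)" for k
  have "strict_mono h" by (rule strict_monoI_Suc) (simp add: h_def)
  moreover have "P k (h k)" for k
  proof (rule N)
    have "N k \<le> (\<Sum>i\<le>k. N i)" by (rule member_le_sum) auto
    then show "N k \<le> h k" by (simp add: h_def)
  qed
  ultimately show ?thesis by (rule that)
qed

text \<open>Bolzano-Weierstrass for each column, combined by Cantor's diagonal argument.\<close>

lemma diagonal_convergent_subsequence:
  fixes A :: "nat \<Rightarrow> nat \<Rightarrow> real"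
  assumes "\<And>n R. \<bar>A n R\<bar> \<le> C"
  obtains d :: "nat \<Rightarrow> nat" where "strict_mono d" "\<And>R. convergent (\<lambda>k. A (d k) R)"
proof -
  interpret subseqs "\<lambda>R s. convergent (\<lambda>k. A (s k) R)"
  proof
    fix R and s :: "nat \<Rightarrow> nat"
    have "A (s k) R \<in> {-C..C}" for k using assms[of "s k" R] by (auto simp: abs_le_iff)
    then obtain l r where "l \<in> {-C..C}" "strict_mono r" "((\<lambda>k. A (s k) R) \<circ> r) \<longlonglongrightarrow> l"
      using compact_Icc[unfolded compact_def, rule_format, of "\<lambda>k. A (s k) R" "-C" C] by blast
    then show "\<exists>r'. strict_mono r' \<and> convergent (\<lambda>k. A ((s \<circ> r') k) R)"
      by (auto simp: o_def convergent_def)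
  qed
  have conv: "convergent (\<lambda>k. A ((diagseq \<circ> (+) (Suc R)) k) R)" for R
  proof (rule diagseq_holds)
    fix r s :: "nat \<Rightarrow> nat" and n assume "strict_mono r" "convergent (\<lambda>k. A (s k) n)"
    then show "convergent (\<lambda>k. A ((s \<circ> r) k) n)"
      using LIMSEQ_subseq_LIMSEQ[of "\<lambda>k. A (s k) n" _ r] by (auto simp: convergent_def o_def)
  qed
  have "convergent (\<lambda>k. A (diagseq k) R)" for R
  proof -
    \<comment> \<open>Convergence in column \<open>R\<close> is obtained for the diagonal sequence
      after a shift by \<open>Suc R\<close>; a shift does not affect convergence.\<close>
    have "(\<lambda>k. A (diagseq (k + Suc R)) R) = (\<lambda>k. A ((diagseq \<circ> (+) (Suc R)) k) R)"
      by (simp add: fun_eq_iff add.commute)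
    then have "convergent (\<lambda>k. A (diagseq (k + Suc R)) R)" using conv[of R] by (simp only:)
    then show ?thesis by (rule iffD1[OF convergent_ignore_initial_segment])
  qed
  with subseq_diagseq show ?thesis by (rule that)
qed

text \<open>A diagonal sequence makes the integrals of \<open>f\<close> over \<open>{g \<le> R}\<close> converge for every \<open>R\<close>; their
  limits increase to a finite value, so that little mass is left between two large levels.\<close>

lemma slow_truncation:
  fixes f g :: "nat \<Rightarrow> 'a \<Rightarrow> real"
  assumes f: "\<And>n. integrable M (f n)" "\<And>n x. 0 \<le> f n x" "\<And>n. (LINT x|M. f n x) \<le> C"
    and g: "\<And>n. g n \<in> borel_measurable M"
  obtains s :: "nat \<Rightarrow> nat" where "strict_mono s"
    "\<And>\<epsilon>. 0 < \<epsilon> \<Longrightarrow> \<exists>R::nat. \<forall>k\<ge>R. (LINT x|M. f (s k) x * indicator {x. real R < g (s k) x \<and> g (s k) x \<le> real k} x) < \<epsilon>"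
proof -
  define A where "A n R = (LINT x|M. f n x * indicator {x. g n x \<le> real R} x)" for n R :: nat
  have fi: "integrable M (\<lambda>x. f n x * indicator {x. g n x \<le> real R} x)" for n R
  proof (rule Bochner_Integration.integrable_bound[OF f(1)[of n]])
    note [measurable] = g[of n] borel_measurable_integrable[OF f(1)[of n]]
    show "(\<lambda>x. f n x * indicator {x. g n x \<le> real R} x) \<in> borel_measurable M" by measurable
    show "AE x in M. norm (f n x * indicator {x. g n x \<le> real R} x) \<le> norm (f n x)"
      by (intro AE_I2) (auto simp: indicator_def)
  qed
  have A0: "0 \<le> A n R" for n R unfolding A_def using f(2) by (intro Bochner_Integration.integral_nonneg) auto
  have AC: "A n R \<le> C" for n R
    unfolding A_def using f(2) by (intro order_trans[OF integral_mono[OF fi f(1)] f(3)]) (auto simp: indicator_def)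
  have Amono: "A n R \<le> A n R'" if "R \<le> R'" for n R R'
    unfolding A_def using f(2) that by (intro integral_mono fi) (auto simp: indicator_def)
  have diff: "(LINT x|M. f n x * indicator {x. real R < g n x \<and> g n x \<le> real R'} x) = A n R' - A n R" if "R \<le> R'" for n R R'
  proof -
    have "f n x * indicator {x. real R < g n x \<and> g n x \<le> real R'} x =
       f n x * indicator {x. g n x \<le> real R'} x - f n x * indicator {x. g n x \<le> real R} x" for x
      using that by (auto simp: indicator_def)
    then show ?thesis unfolding A_def using fi by simp
  qed
  have absA: "\<bar>A n R\<bar> \<le> C" for n R using A0[of n R] AC[of n R] by simp
  obtain d where d: "strict_mono d" "\<And>R. convergent (\<lambda>k. A (d k) R)"
    by (rule diagonal_convergent_subsequence[of A C, OF absA]) (rule that)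
  define L where "L R = lim (\<lambda>k. A (d k) R)" for R
  have L: "(\<lambda>k. A (d k) R) \<longlonglongrightarrow> L R" for R
    using d(2) by (simp add: L_def convergent_LIMSEQ_iff)
  have Lmono: "L R \<le> L R'" if "R \<le> R'" for R R'
    by (rule LIMSEQ_le[OF L L]) (use Amono[OF that] in auto)
  have LC: "L R \<le> C" for R by (rule LIMSEQ_le_const2[OF L]) (use AC in auto)
  obtain a where a: "L \<longlonglongrightarrow> a" "\<And>R. L R \<le> a"
    using incseq_convergent[of L C] Lmono LC by (auto simp: incseq_def)
  \<comment> \<open>At stage \<open>k\<close> all levels up to \<open>k\<close> are matched
    simultaneously, in particular the moving level \<open>k\<close> itself.\<close>
  have ev: "eventually (\<lambda>m. \<forall>R\<le>k. \<bar>A (d m) R - L R\<bar> < inverse (real (Suc k))) sequentially" for k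
  proof -
    have "eventually (\<lambda>m. \<forall>R\<in>{..k}. \<bar>A (d m) R - L R\<bar> < inverse (real (Suc k))) sequentially"
    proof (intro eventually_ball_finite ballI)
      fix R
      have "(\<lambda>m. \<bar>A (d m) R - L R\<bar>) \<longlonglongrightarrow> 0" by (intro tendsto_rabs_zero LIM_zero L)
      then show "eventually (\<lambda>m. \<bar>A (d m) R - L R\<bar> < inverse (real (Suc k))) sequentially"
        by (intro order_tendstoD) auto
    qed simp
    then show ?thesis by (simp only: Ball_def atMost_iff)
  qed
  obtain h where h: "strict_mono h" "\<And>k. \<forall>R\<le>k. \<bar>A (d (h k)) R - L R\<bar> < inverse (real (Suc k))"
    by (rule strict_mono_selection[of "\<lambda>k m. \<forall>R\<le>k. \<bar>A (d m) R - L R\<bar> < inverse (real (Suc k))", OF ev]) (rule that)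
  show ?thesis
  proof (rule that)
    show "strict_mono (d \<circ> h)" by (rule strict_mono_o[OF d(1) h(1)])
    fix \<epsilon> :: real assume \<epsilon>: "0 < \<epsilon>"
    have "eventually (\<lambda>R. L R > a - \<epsilon> / 3) sequentially" using a(1) \<epsilon> by (intro order_tendstoD) auto
    moreover have "eventually (\<lambda>R. inverse (real (Suc R)) < \<epsilon> / 3) sequentially"
      using LIMSEQ_inverse_real_of_nat \<epsilon> by (intro order_tendstoD) auto
    ultimately have "eventually (\<lambda>R. L R > a - \<epsilon> / 3 \<and> inverse (real (Suc R)) < \<epsilon> / 3) sequentially"
      by (rule eventually_conj)
    then obtain R where R: "L R > a - \<epsilon> / 3" "inverse (real (Suc R)) < \<epsilon> / 3"
      by (auto simp: eventually_sequentially)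
    \<comment> \<open>Replacing both terms by their limits costs twice the inverse of
      \<open>Suc k\<close>, and the limits differ by at most a - \<open>L R\<close>: three
      contributions below a third of \<open>\<epsilon>\<close>.\<close>
    have "A (d (h k)) k - A (d (h k)) R < \<epsilon>" if "R \<le> k" for k
    proof -
      have "inverse (real (Suc k)) \<le> inverse (real (Suc R))" using that by (intro le_imp_inverse_le) auto
      then show ?thesis
        using h(2)[of k, rule_format, of k] h(2)[of k, rule_format, of R] that R a(2)[of k] by linarith
    qed
    then show "\<exists>R::nat. \<forall>k\<ge>R. (LINT x|M. f ((d \<circ> h) k) x *
       indicator {x. real R < g ((d \<circ> h) k) x \<and> g ((d \<circ> h) k) x \<le> real k} x) < \<epsilon>"
      using diff by (intro exI[of _ R]) auto
  qed
qed

text \<open>Absolute continuity of the integral: above a high level little mass remains, and below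
  it the integral is at most the level times the measure of the set.\<close>

lemma integral_small_set:
  fixes f :: "'a \<Rightarrow> real"
  assumes f: "integrable M f" "\<And>x. 0 \<le> f x" and \<epsilon>: "0 < \<epsilon>"
  shows "\<exists>\<delta>>0. \<forall>E\<in>sets M. emeasure M E < ennreal \<delta> \<longrightarrow> (LINT x:E|M. f x) < \<epsilon>"
proof -
  note [measurable] = borel_measurable_integrable[OF f(1)]
  let ?t = "\<lambda>(n::nat) x. f x * indicator {x. real n < f x} x"
  have ti: "integrable M (?t n)" for n
    by (rule Bochner_Integration.integrable_bound[OF f(1)]) (measurable, auto simp: indicator_def)
  have "(\<lambda>n. LINT x|M. ?t n x) \<longlonglongrightarrow> (LINT x|M. 0 :: real)"
  proof (rule integral_dominated_convergence[OF _ _ f(1)])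
    show "AE x in M. (\<lambda>n. ?t n x) \<longlonglongrightarrow> 0"
    proof (intro AE_I2)
      fix x
      obtain n where n: "f x \<le> real n" using real_arch_simple by blast
      have "eventually (\<lambda>m. ?t m x = 0) sequentially"
        using eventually_ge_at_top[of n] by eventually_elim (use n in \<open>auto simp: indicator_def\<close>)
      then show "(\<lambda>n. ?t n x) \<longlonglongrightarrow> 0" by (rule tendsto_eventually)
    qed
    show "AE x in M. norm (?t n x) \<le> f x" for n using f(2) by (intro AE_I2) (auto simp: indicator_def)
  qed auto
  then have "eventually (\<lambda>n. (LINT x|M. ?t n x) < \<epsilon> / 2) sequentially"
    using \<epsilon> by (intro order_tendstoD) auto
  then obtain n where n: "(LINT x|M. ?t n x) < \<epsilon> / 2" by (auto simp: eventually_sequentially)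
  \<comment> \<open>This makes n \<open>\<delta>\<close> at most half of \<open>\<epsilon>\<close>,
    also for n = 0.\<close>
  define \<delta> where "\<delta> = \<epsilon> / (2 * (real n + 1))"
  show ?thesis
  proof (intro exI[of _ \<delta>] conjI ballI impI)
    show "\<delta> > 0" using \<epsilon> by (simp add: \<delta>_def)
    fix E assume E[measurable]: "E \<in> sets M" and em: "emeasure M E < ennreal \<delta>"
    have fin: "emeasure M E < \<infinity>" using em by (rule less_trans) simp
    have "emeasure M E = ennreal (measure M E)"
      using fin by (intro emeasure_eq_ennreal_measure) simp
    then have mE: "measure M E < \<delta>"
      using em by (simp only: ennreal_less_iff[OF measure_nonneg])
    have iE: "integrable M (indicator E :: 'a \<Rightarrow> real)" using E fin by (rule integrable_real_indicator)
    have "(LINT x:E|M. f x) \<le> (LINT x|M. real n * indicator E x + ?t n x)"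
      unfolding set_lebesgue_integral_def
    proof (rule integral_mono)
      show "integrable M (\<lambda>x. indicator E x *\<^sub>R f x)" by (rule integrable_mult_indicator[OF E f(1)])
      show "integrable M (\<lambda>x. real n * indicator E x + ?t n x)" using ti iE by simp
      show "indicator E x *\<^sub>R f x \<le> real n * indicator E x + ?t n x" for x
        using f(2) by (auto simp: indicator_def)
    qed
    also have "\<dots> = real n * measure M E + (LINT x|M. ?t n x)"
      using ti iE E by simp
    also have "real n * measure M E \<le> real n * \<delta>" using mE by (intro mult_left_mono) auto
    also have "real n * \<delta> \<le> \<epsilon> / 2" using \<epsilon> by (simp add: \<delta>_def field_simps)
    finally show "(LINT x:E|M. f x) < \<epsilon>" using n by simp
  qed
qed

text \<open>Uniform smallness for late indices suffices, since the finitely many earlier functions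
  are handled one by one by absolute continuity of the integral.\<close>

lemma equi_integrableI:
  fixes f :: "nat \<Rightarrow> 'a \<Rightarrow> real"
  assumes f: "\<And>n. integrable M (f n)" "\<And>n x. 0 \<le> f n x" "\<And>n. (LINT x|M. f n x) \<le> C"
    and tail: "\<And>\<epsilon>. 0 < \<epsilon> \<Longrightarrow> \<exists>\<delta>>0. \<exists>N. \<forall>n\<ge>N. \<forall>E\<in>sets M. emeasure M E < ennreal \<delta> \<longrightarrow> (LINT x:E|M. f n x) < \<epsilon>"
  shows "equi_integrable M f"
proof -
  have "\<exists>\<delta>>0. \<forall>n. \<forall>E\<in>sets M. emeasure M E < ennreal \<delta> \<longrightarrow> (LINT x:E|M. \<bar>f n x\<bar>) < \<epsilon>" if \<epsilon>: "0 < \<epsilon>" for \<epsilon>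
  proof -
    obtain \<delta>1 N where 1: "\<delta>1 > 0" "\<And>n E. N \<le> n \<Longrightarrow> E \<in> sets M \<Longrightarrow> emeasure M E < ennreal \<delta>1 \<Longrightarrow> (LINT x:E|M. f n x) < \<epsilon>"
      using tail[OF \<epsilon>] by blast
    have small: "\<exists>\<delta>>0. \<forall>n<N. \<forall>E\<in>sets M. emeasure M E < ennreal \<delta> \<longrightarrow> (LINT x:E|M. f n x) < \<epsilon>" for N :: nat
    proof (induction N)
      case 0
      show ?case by (auto intro: exI[of _ 1])
    next
      case (Suc N)
      obtain \<delta> where \<delta>: "\<delta> > 0" "\<And>n E. n < N \<Longrightarrow> E \<in> sets M \<Longrightarrow> emeasure M E < ennreal \<delta> \<Longrightarrow> (LINT x:E|M. f n x) < \<epsilon>"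
        using Suc by blast
      obtain \<delta>' where \<delta>': "\<delta>' > 0" "\<And>E. E \<in> sets M \<Longrightarrow> emeasure M E < ennreal \<delta>' \<Longrightarrow> (LINT x:E|M. f N x) < \<epsilon>"
        using integral_small_set[OF f(1,2) \<epsilon>, of N] by blast
      have "emeasure M E < ennreal \<delta>" "emeasure M E < ennreal \<delta>'" if "emeasure M E < ennreal (min \<delta> \<delta>')" for E
        using less_le_trans[OF that ennreal_leI[OF min.cobounded1]] less_le_trans[OF that ennreal_leI[OF min.cobounded2]]
        by blast+
      then show ?case
        using \<delta> \<delta>' by (intro exI[of _ "min \<delta> \<delta>'"]) (auto simp: less_Suc_eq)
    qed
    from small[of N] obtain \<delta>2 where 2: "\<delta>2 > 0" "\<And>n E. n < N \<Longrightarrow> E \<in> sets M \<Longrightarrow> emeasure M E < ennreal \<delta>2 \<Longrightarrow> (LINT x:E|M. f n x) < \<epsilon>"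
      by blast
    have "(LINT x:E|M. f n x) < \<epsilon>" if "E \<in> sets M" "emeasure M E < ennreal (min \<delta>1 \<delta>2)" for n E
    proof -
      have "emeasure M E < ennreal \<delta>1" "emeasure M E < ennreal \<delta>2"
        using less_le_trans[OF that(2) ennreal_leI[OF min.cobounded1]] less_le_trans[OF that(2) ennreal_leI[OF min.cobounded2]]
        by blast+
      then show ?thesis using 1(2)[of n E] 2(2)[of n E] that(1) by (cases "n < N") auto
    qed
    then show ?thesis using 1(1) 2(1) f(2) by (intro exI[of _ "min \<delta>1 \<delta>2"]) auto
  qed
  then show ?thesis using f unfolding equi_integrable_def by auto
qed

section \<open>Extension by zero, and the gradient of a linear map\<close>

lemma Lp_UNIV_support:
  fixes f :: "real^'n \<Rightarrow> 'b::euclidean_space"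
  assumes "\<Omega> \<in> sets lebesgue" "\<And>x. x \<notin> \<Omega> \<Longrightarrow> f x = 0" "Lp \<Omega> p f"
  shows "Lp UNIV p f"
proof -
  have "(\<lambda>x. indicator \<Omega> x *\<^sub>R f x) = f" using assms(2) by (auto simp: fun_eq_iff indicator_def)
  then have "f \<in> borel_measurable lebesgue"
    using LpD(1)[OF assms(3)] borel_measurable_restrict_space_iff[of \<Omega> lebesgue f] assms(1) by simp
  moreover have "integrable lebesgue (\<lambda>x. norm (f x) powr p)"
    by (rule integrable_lebesgue_on_support[OF assms(1) _ LpD(2)[OF assms(3)]]) (simp add: assms(2))
  ultimately show ?thesis by (simp add: Lp_def lebesgue_on_UNIV_eq)
qed

lemma weak_pd_matrix_vector:
  fixes A :: "real^'n^'m"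
  shows "weak_pd \<Omega> j (\<lambda>x. (A *v x) $ i) (\<lambda>x. A $ i $ j)"
proof -
  have bl: "bounded_linear (\<lambda>x. (A *v x) $ i)"
    by (rule bounded_linear_compose[OF bounded_linear_vec_nth matrix_vector_mul_bounded_linear])
  have "frechet_derivative (\<lambda>x. (A *v x) $ i) (at x) (axis j 1) = A $ i $ j" for x
  proof -
    have "frechet_derivative (\<lambda>x. (A *v x) $ i) (at x) = (\<lambda>x. (A *v x) $ i)"
      by (rule frechet_derivative_at[OF bounded_linear_imp_has_derivative[OF bl], symmetric])
    then show ?thesis by (simp add: matrix_vector_mult_basis column_def)
  qed
  then show ?thesis
    using weak_pd_smooth[OF C_k_bounded_linear[OF bl], of \<Omega> j] by simp
qed

section \<open>The modified sequence\<close>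

lemma norm_matrix_le:
  fixes A :: "real^'n^'m"
  assumes "\<And>i j. \<bar>A $ i $ j\<bar> \<le> c"
  shows "norm A \<le> real CARD('m) * real CARD('n) * c"
proof -
  have "norm (A $ i) \<le> real CARD('n) * c" for i
    using norm_le_l1_cart[of "A $ i"] sum_bounded_above[of UNIV "\<lambda>j. \<bar>A $ i $ j\<bar>" c] assms by fastforce
  then have "(\<Sum>i\<in>UNIV. norm (A $ i)) \<le> real CARD('m) * (real CARD('n) * c)"
    using sum_bounded_above[of UNIV "\<lambda>i. norm (A $ i)" "real CARD('n) * c"] by simp
  moreover have "norm A \<le> (\<Sum>i\<in>UNIV. norm (A $ i))"
    unfolding norm_vec_def[of A] by (intro L2_set_le_sum) auto
  ultimately show ?thesis by simp
qed

text \<open>The tensor product of \<open>z\<close> with the gradient of \<open>\<phi>\<close>, that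
  is, the second term in the product rule for the gradient of \<open>\<phi>\<close> times
  \<open>z\<close>.\<close>

definition outer_gradient :: "(real^'n \<Rightarrow> real) \<Rightarrow> (real^'n \<Rightarrow> real^'m) \<Rightarrow> real^'n \<Rightarrow> real^'n^'m" where
  "outer_gradient \<phi> z x = (\<chi> i j. frechet_derivative \<phi> (at x) (axis j 1) * z x $ i)"

lemma norm_outer_gradient_le:
  fixes z :: "real^'n \<Rightarrow> real^'m"
  assumes "0 \<le> M" "\<And>h. \<bar>frechet_derivative \<phi> (at x) h\<bar> \<le> M * norm h"
  shows "norm (outer_gradient \<phi> z x) \<le> real CARD('m) * real CARD('n) * (M * norm (z x))"
proof (rule norm_matrix_le)
  fix i j
  have "\<bar>frechet_derivative \<phi> (at x) (axis j 1)\<bar> \<le> M" using assms(2)[of "axis j 1"] by simp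
  then show "\<bar>outer_gradient \<phi> z x $ i $ j\<bar> \<le> M * norm (z x)"
    unfolding outer_gradient_def by (simp add: abs_mult) (intro mult_mono component_le_norm_cart, use assms in auto)
qed

lemma W1p_gradient_Lp:
  assumes "open \<Omega>" "u \<in> W1p \<Omega> p" "has_weak_gradient \<Omega> u G"
  shows "Lp \<Omega> p G"
proof (rule Lp_cong_AE[OF W1pD(3)[OF assms(1,2)] wgrad_measurable(2)[OF assms(1,3)]])
  show "AE x in lebesgue_on \<Omega>. G x = wgrad \<Omega> u x"
    using wgrad_eq_AE[OF assms(1,3)] by eventually_elim simp
qed

text \<open>Product rule. The compact support of \<open>\<phi>\<close> inside
  \<open>\<Omega>\<close> extends the product by zero to the whole space, where \<open>W1p0I\<close>
  applies.\<close>

lemma test_function_mult_W1p0: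
  fixes z :: "real^'n \<Rightarrow> real^'m"
  assumes \<Omega>: "open \<Omega>" and p: "1 \<le> p" and z: "z \<in> W1p \<Omega> p" "has_weak_gradient \<Omega> z H" and t: "test_function \<Omega> \<phi>"
  shows "(\<lambda>x. \<phi> x *\<^sub>R z x) \<in> W1p0 \<Omega> p"
    "has_weak_gradient UNIV (\<lambda>x. \<phi> x *\<^sub>R z x) (\<lambda>x. \<phi> x *\<^sub>R H x + outer_gradient \<phi> z x)"
proof -
  let ?G = "\<lambda>x. \<phi> x *\<^sub>R H x + outer_gradient \<phi> z x"
  have \<Omega>s: "\<Omega> \<in> sets lebesgue" using \<Omega> by auto
  have p0: "0 \<le> p" using p by simp
  show w: "has_weak_gradient UNIV (\<lambda>x. \<phi> x *\<^sub>R z x) ?G"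
    using weak_pd_test_mult[OF _ t] z(2)
    by (simp add: has_weak_gradient_iff[OF \<Omega>] has_weak_gradient_iff[OF open_UNIV] outer_gradient_def)
  obtain S where S: "compact S" "S \<subseteq> \<Omega>" "\<And>x. x \<notin> S \<Longrightarrow> \<phi> x = 0"
    "\<And>x. x \<notin> S \<Longrightarrow> frechet_derivative \<phi> (at x) = (\<lambda>h. 0)"
    using test_function_supportE[OF t] by metis
  have G0: "?G x = 0" if "x \<notin> S" for x
    using S(3,4)[OF that] by (simp add: outer_gradient_def vec_eq_iff)
  obtain M where M: "M > 0" "\<And>x. \<bar>\<phi> x\<bar> \<le> M" using test_function_bounded[OF t] by blast
  obtain M' where M': "M' > 0" "\<And>x h. \<bar>frechet_derivative \<phi> (at x) h\<bar> \<le> M' * norm h"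
    using test_function_deriv_bound[OF t] by blast
  note Lz = W1pD(1)[OF \<Omega> z(1)] and LH = W1p_gradient_Lp[OF \<Omega> z]
  have \<phi>m: "\<phi> \<in> borel_measurable (lebesgue_on \<Omega>)"
    by (rule measurable_restrict_space1[OF continuous_imp_measurable_lebesgue[OF test_function_continuous[OF t]]])
  have L1: "Lp \<Omega> p (\<lambda>x. \<phi> x *\<^sub>R z x)"
    by (rule Lp_bound[OF Lz p0 borel_measurable_scaleR[OF \<phi>m LpD(1)[OF Lz]], of M])
      (use M in \<open>auto intro!: mult_right_mono\<close>)
  have L2: "Lp \<Omega> p (\<lambda>x. \<phi> x *\<^sub>R H x)"
    by (rule Lp_bound[OF LH p0 borel_measurable_scaleR[OF \<phi>m LpD(1)[OF LH]], of M])
      (use M in \<open>auto intro!: mult_right_mono\<close>)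
  have "?G \<in> borel_measurable (lebesgue_on \<Omega>)"
    using wgrad_measurable(2)[OF open_UNIV w] by (simp add: lebesgue_on_UNIV_eq measurable_restrict_space1)
  \<comment> \<open>Measurability of the tensor term is read off from the full gradient, which is
    measurable because it is locally integrable.\<close>
  then have "(\<lambda>x. ?G x - \<phi> x *\<^sub>R H x) \<in> borel_measurable (lebesgue_on \<Omega>)"
    using LpD(1)[OF L2] by (rule borel_measurable_diff)
  then have om: "outer_gradient \<phi> z \<in> borel_measurable (lebesgue_on \<Omega>)" by simp
  have L3: "Lp \<Omega> p (outer_gradient \<phi> z)"
    by (rule Lp_bound[OF Lz p0 om, of "real CARD('m) * real CARD('n) * M'"])
      (use norm_outer_gradient_le[of M' \<phi> _ z, OF _ M'(2)] M'(1) in \<open>auto simp: mult.assoc\<close>)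
  have U1: "Lp UNIV p (\<lambda>x. \<phi> x *\<^sub>R z x)"
    by (rule Lp_UNIV_support[OF \<Omega>s _ L1]) (use S(2,3) in auto)
  have U2: "Lp UNIV p ?G"
    by (rule Lp_UNIV_support[OF \<Omega>s _ Lp_add[OF p0 L2 L3]]) (use S(2) G0 in blast)
  show "(\<lambda>x. \<phi> x *\<^sub>R z x) \<in> W1p0 \<Omega> p"
    by (rule W1p0I[OF \<Omega> p w S(1,2) _ G0 U1 U2]) (simp add: S(3))
qed

section \<open>The growth conditions in usable form\<close>

lemma ennreal_divide_lessD:
  assumes "ennreal a / ennreal b < ennreal e" "0 \<le> a" "0 \<le> b" "0 < e"
  shows "a \<le> e * b"
proof (cases "b = 0")
  \<comment> \<open>A positive \<open>a\<close> would make the quotient infinite.\<close>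
  case True
  then have "\<not> 0 < a"
    using assms(1) by (auto simp: ennreal_divide_top divide_ennreal_def)
  then show ?thesis using True assms(2) by simp
next
  case False
  then have "ennreal (a / b) < ennreal e" using assms by (simp add: divide_ennreal)
  then have "a / b < e" using assms False by (simp add: ennreal_less_iff)
  then show ?thesis using assms False by (simp add: field_simps)
qed

text \<open>The supremum of quotients becomes an inequality between products, which holds for every
  large matrix, including those where \<open>L\<close> vanishes.\<close>

lemma cond_D1E:
  fixes L :: "real^'n^'m \<Rightarrow> real"
  assumes "cond_D1 L" "\<And>\<xi>. 0 \<le> L \<xi>"
  obtains \<Lambda> :: "real \<Rightarrow> real" where "\<And>R. 1 < R \<Longrightarrow> 0 < \<Lambda> R" "\<And>R. 1 < R \<Longrightarrow> \<Lambda> R < 1" "(\<Lambda> \<longlongrightarrow> 1) at_top"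
    "\<And>e. 0 < e \<Longrightarrow> eventually (\<lambda>R. \<forall>\<zeta>. R \<le> norm \<zeta> \<longrightarrow> L (\<Lambda> R *\<^sub>R \<zeta>) \<le> e * L \<zeta>) at_top"
proof -
  obtain \<Lambda> :: "real \<Rightarrow> real" where \<Lambda>: "\<forall>R>1. 0 < \<Lambda> R \<and> \<Lambda> R < 1" "(\<Lambda> \<longlongrightarrow> 1) at_top"
    "((\<lambda>R. SUP \<xi>\<in>{\<xi>. R \<le> norm \<xi>}. ennreal (L (\<Lambda> R *\<^sub>R \<xi>)) / ennreal (L \<xi>)) \<longlongrightarrow> 0) at_top"
    using assms(1) unfolding cond_D1_def by blast
  have "eventually (\<lambda>R. \<forall>\<zeta>. R \<le> norm \<zeta> \<longrightarrow> L (\<Lambda> R *\<^sub>R \<zeta>) \<le> e * L \<zeta>) at_top" if e: "0 < e" for e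
  proof -
    have "eventually (\<lambda>R. (SUP \<xi>\<in>{\<xi>. R \<le> norm \<xi>}. ennreal (L (\<Lambda> R *\<^sub>R \<xi>)) / ennreal (L \<xi>)) < ennreal e) at_top"
      using \<Lambda>(3) e by (intro order_tendstoD) auto
    then show ?thesis
    proof eventually_elim
      case (elim R)
      show ?case
      proof (intro allI impI)
        fix \<zeta> :: "real^'n^'m" assume "R \<le> norm \<zeta>"
        then have "ennreal (L (\<Lambda> R *\<^sub>R \<zeta>)) / ennreal (L \<zeta>) \<le> (SUP \<xi>\<in>{\<xi>. R \<le> norm \<xi>}. ennreal (L (\<Lambda> R *\<^sub>R \<xi>)) / ennreal (L \<xi>))"
          by (intro SUP_upper) simp
        then have "ennreal (L (\<Lambda> R *\<^sub>R \<zeta>)) / ennreal (L \<zeta>) < ennreal e"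
          using elim by (rule le_less_trans)
        then show "L (\<Lambda> R *\<^sub>R \<zeta>) \<le> e * L \<zeta>" by (rule ennreal_divide_lessD) (use assms(2) e in auto)
      qed
    qed
  qed
  with \<Lambda> show ?thesis by (intro that[of \<Lambda>]) auto
qed

lemma continuous_bounded_on_ball:
  fixes L :: "'a::euclidean_space \<Rightarrow> real"
  assumes "continuous_on UNIV L" "\<And>\<xi>. 0 \<le> L \<xi>"
  obtains B where "0 \<le> B" "\<And>\<zeta>. norm \<zeta> \<le> \<rho> \<Longrightarrow> L \<zeta> \<le> B"
proof -
  have "bounded (L ` cball 0 \<rho>)"
    by (intro compact_imp_bounded compact_continuous_image continuous_on_subset[OF assms(1)] compact_cball) auto
  then obtain B where B: "B > 0" "\<And>y. y \<in> L ` cball 0 \<rho> \<Longrightarrow> norm y \<le> B" by (auto simp: bounded_pos)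
  show ?thesis
  proof (rule that)
    show "0 \<le> B" using B(1) by simp
    show "L \<zeta> \<le> B" if "norm \<zeta> \<le> \<rho>" for \<zeta> using B(2)[of "L \<zeta>"] that by auto
  qed
qed

theorem theorem1p7:
  fixes L :: "real^'n^'m \<Rightarrow> real" and p :: real
  assumes "continuous_on UNIV L"
    and "\<And>\<xi>. 0 \<le> L \<xi>"
    and "cond_D1 L" and "cond_D2 L" and "cond_D3 L"
    and "real CARD('n) < p"
  shows "\<forall>(\<xi> :: real^'n^'m) (v :: nat \<Rightarrow> real^'n \<Rightarrow> real^'m).
    W1p_weakly_tendsto unit_cube p v (\<lambda>y. \<xi> *v y) \<and>
    (SUP n. \<integral>\<^sup>+ y. ennreal (L (wgrad unit_cube (v n) y)) \<partial>lebesgue_on unit_cube) < \<infinity> \<longrightarrow>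
    (\<exists>(r :: nat \<Rightarrow> nat) (w :: nat \<Rightarrow> real^'n \<Rightarrow> real^'m).
       strict_mono r \<and>
       (\<forall>n. (\<lambda>y. w n y - \<xi> *v y) \<in> W1p0 unit_cube p) \<and>
       tendsto_zero_in_measure (lebesgue_on unit_cube)
         (\<lambda>n y. norm (wgrad unit_cube (v (r n)) y - wgrad unit_cube (w n) y)) \<and>
       equi_integrable (lebesgue_on unit_cube) (\<lambda>n y. L (wgrad unit_cube (w n) y)))"
proof (intro allI impI, elim conjE)
  fix \<xi> :: "real^'n^'m" and v :: "nat \<Rightarrow> real^'n \<Rightarrow> real^'m"
  assume weak: "W1p_weakly_tendsto unit_cube p v (\<lambda>y. \<xi> *v y)"
    and fin: "(SUP n. \<integral>\<^sup>+ y. ennreal (L (wgrad unit_cube (v n) y)) \<partial>lebesgue_on unit_cube) < \<infinity>"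
  define Y where "Y = (unit_cube :: (real^'n) set)"
  define M where "M = lebesgue_on Y"
  define l where "l y = \<xi> *v y" for y
  note Lc = assms(1) and L0 = assms(2)
  have "1 \<le> real CARD('n)" by simp
  then have p1: "1 < p" "1 \<le> p" "0 \<le> p" using assms(6) by linarith+
  have Yo: "open Y" unfolding Y_def by (rule open_unit_cube)
  have Ys: "Y \<in> sets lebesgue" unfolding Y_def by (rule sets_unit_cube)
  have spM: "space M = Y" by (simp add: M_def)
  interpret M: finite_measure M unfolding M_def Y_def by (rule finite_measure_unit_cube)
  have mM: "measure M Y = 1" unfolding M_def Y_def by (rule measure_unit_cube)
  interpret D: W1p_operator Y p "wgrad Y :: (real^'n \<Rightarrow> real^'m) \<Rightarrow> _"
    by (rule W1p_operator_wgrad[OF Yo p1(1)])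
  have vW: "v n \<in> W1p Y p" and lW: "l \<in> W1p Y p" for n
    using weak unfolding W1p_weakly_tendsto_def Y_def l_def by auto
  have lG: "has_weak_gradient Y l (\<lambda>x. \<xi>)"
    unfolding has_weak_gradient_iff[OF Yo] l_def by (intro allI weak_pd_matrix_vector)
  define V where "V n = wgrad Y (v n)" for n
  have VG: "has_weak_gradient Y (v n) (V n)" for n unfolding V_def by (rule W1pD(2)[OF Yo vW])
  have Vm[measurable]: "V n \<in> borel_measurable M" for n unfolding V_def M_def by (rule wgrad_measurable(1)[OF Yo VG])
  have Lm[measurable]: "L \<in> borel_measurable borel" by (rule borel_measurable_continuous_onI[OF Lc])
  define f where "f n x = L (V n x)" for n x
  define g where "g n x = norm (V n x)" for n x
  have gm[measurable]: "g n \<in> borel_measurable M" for n unfolding g_def by measurable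
  have fm[measurable]: "f n \<in> borel_measurable M" for n unfolding f_def by measurable
  have f0: "0 \<le> f n x" for n x by (simp add: f_def L0)
  obtain C0 where C0: "0 \<le> C0" "(SUP n. \<integral>\<^sup>+ y. ennreal (f n y) \<partial>M) = ennreal C0"
    using fin unfolding f_def V_def M_def Y_def by (cases "SUP n. \<integral>\<^sup>+ y. ennreal (L (wgrad unit_cube (v n) y)) \<partial>lebesgue_on unit_cube") auto
  have fn: "(\<integral>\<^sup>+ y. ennreal (f n y) \<partial>M) \<le> ennreal C0" for n
    unfolding C0(2)[symmetric] by (rule SUP_upper) simp
  have fi: "integrable M (f n)" for n
  proof (rule integrableI_nonneg[OF fm])
    show "(\<integral>\<^sup>+ y. ennreal (f n y) \<partial>M) < \<infinity>" using fn[of n] by (rule le_less_trans) simp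
  qed (simp add: f0)
  have fC: "(LINT x|M. f n x) \<le> C0" for n
    using fn[of n] nn_integral_eq_integral[OF fi[of n]] f0 C0(1) by simp
  \<comment> \<open>The k-th member of this subsequence is truncated at level \<open>k\<close>:
    index and level are the same number from here on.\<close>
  obtain s where s: "strict_mono s" and trunc: "\<And>\<epsilon>. 0 < \<epsilon> \<Longrightarrow> \<exists>R::nat. \<forall>k\<ge>R.
      (LINT x|M. f (s k) x * indicator {x. real R < g (s k) x \<and> g (s k) x \<le> real k} x) < \<epsilon>"
    by (rule slow_truncation[of M f C0 g, OF fi f0 fC gm]) (rule that)
  define z where "z n x = v n x - l x" for n x
  have zweak: "W1p_weakly_tendsto unit_cube p z (\<lambda>x. 0)"
    using weakly_tendsto_diff[OF open_unit_cube p1(3) weak] by (simp add: z_def[abs_def] l_def)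
  \<comment> \<open>This bound feeds Chebyshev's inequality in the proof of convergence in
    measure.\<close>
  obtain BV where BV: "\<And>n. (LINT x|M. norm (V n x) powr p) \<le> BV"
    using D.weakly_convergent_bounded weak unfolding M_def V_def Y_def by blast
  obtain \<epsilon>\<^sub>3 \<alpha>\<^sub>3 c\<^sub>3 where D3: "0 < \<epsilon>\<^sub>3" "0 < \<alpha>\<^sub>3" "0 < c\<^sub>3"
    "\<And>t \<zeta> a. t \<in> {0..1} \<Longrightarrow> c\<^sub>3 \<le> norm (\<zeta> - \<xi>) \<Longrightarrow> norm a \<le> \<epsilon>\<^sub>3 \<Longrightarrow> L (\<xi> + t *\<^sub>R (\<zeta> - \<xi>) + a) \<le> \<alpha>\<^sub>3 * (1 + L \<zeta>)"
    using assms(5) unfolding cond_D3_def by meson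
  obtain \<alpha>\<^sub>2 where D2: "0 < \<alpha>\<^sub>2" "\<And>t \<zeta>. t \<in> {0..1} \<Longrightarrow> L (t *\<^sub>R \<zeta>) \<le> \<alpha>\<^sub>2 * (1 + L \<zeta>)"
    using assms(4) unfolding cond_D2_def by blast
  obtain \<Lambda> :: "real \<Rightarrow> real" where \<Lambda>: "\<And>R. 1 < R \<Longrightarrow> 0 < \<Lambda> R" "\<And>R. 1 < R \<Longrightarrow> \<Lambda> R < 1" "(\<Lambda> \<longlongrightarrow> 1) at_top"
    "\<And>e. 0 < e \<Longrightarrow> eventually (\<lambda>R. \<forall>\<zeta>. R \<le> norm \<zeta> \<longrightarrow> L (\<Lambda> R *\<^sub>R \<zeta>) \<le> e * L \<zeta>) at_top"
    by (rule cond_D1E[OF assms(3) L0]) (rule that)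
  have \<Lambda>n: "(\<lambda>j. \<Lambda> (real j)) \<longlonglongrightarrow> 1"
    by (rule filterlim_compose[OF \<Lambda>(3) filterlim_real_sequentially])
  obtain C where C: "\<And>n::nat. compact (C n)" "\<And>n. C n \<subseteq> Y" "\<And>n. C n \<subseteq> interior (C (Suc n))" "\<Union>(range C) = Y"
    by (rule open_Union_compact_subsets[OF Yo]) (rule that)
  define cst where "cst = real CARD('m) * real CARD('n)"
  have cst: "0 < cst" by (simp add: cst_def)
  \<comment> \<open>All data of the k-th cut-off are bundled so that they can be chosen together,
    before any member of the sequence is selected: support \<open>S\<close>, region \<open>U\<close>
    where it is 1, derivative bound \<open>m\<close>, and bound \<open>c\<close> for
    \<open>l\<close> on the support.\<close>
  define cutoff where "cutoff k \<phi> U S m c \<longleftrightarrow> test_function Y \<phi> \<and> (\<forall>x. 0 \<le> \<phi> x) \<and> (\<forall>x. \<phi> x \<le> 1) \<and>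
    open U \<and> C k \<subseteq> U \<and> (\<forall>x\<in>U. \<phi> x = 1) \<and> compact S \<and> S \<subseteq> Y \<and> (\<forall>x. x \<notin> S \<longrightarrow> \<phi> x = 0) \<and>
    (\<forall>x. x \<notin> S \<longrightarrow> frechet_derivative \<phi> (at x) = (\<lambda>h. 0)) \<and>
    (0::real) < m \<and> (\<forall>x h. \<bar>frechet_derivative \<phi> (at x) h\<bar> \<le> m * norm h) \<and> (\<forall>x\<in>S. norm (l x) \<le> c)"
    for k \<phi> U S m and c :: real
  have "\<exists>\<phi> U S m c. cutoff k \<phi> U S m c" for k
  proof -
    obtain \<phi> U where 1: "test_function Y \<phi>" "\<And>x. 0 \<le> \<phi> x" "\<And>x. \<phi> x \<le> 1" "open U" "C k \<subseteq> U" "U \<subseteq> Y" "\<And>x. x \<in> U \<Longrightarrow> \<phi> x = 1"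
      by (rule test_function_cutoff[OF C(1) Yo C(2)]) (rule that)
    obtain S where 2: "compact S" "S \<subseteq> Y" "\<And>x. x \<notin> S \<Longrightarrow> \<phi> x = 0" "\<And>x. x \<notin> S \<Longrightarrow> frechet_derivative \<phi> (at x) = (\<lambda>h. 0)"
      by (rule test_function_supportE[OF 1(1)]) (rule that)
    obtain m where 3: "m > 0" "\<And>x h. \<bar>frechet_derivative \<phi> (at x) h\<bar> \<le> m * norm h"
      by (rule test_function_deriv_bound[OF 1(1)]) (rule that)
    have "bounded (l ` S)" unfolding l_def
      by (intro compact_imp_bounded compact_continuous_image 2(1) linear_continuous_on matrix_vector_mul_bounded_linear)
    then obtain c where c: "\<And>x. x \<in> S \<Longrightarrow> norm (l x) \<le> c" by (auto simp: bounded_iff)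
    have "cutoff k \<phi> U S m c"
      unfolding cutoff_def by (intro conjI allI ballI impI 1 2 3 c)
    then show ?thesis by blast
  qed
  then obtain \<phi> U S m c where cutoff: "\<And>k. cutoff k (\<phi> k) (U k) (S k) (m k) (c k)"
    by metis
  have \<phi>: "\<And>k. test_function Y (\<phi> k)" "\<And>k x. 0 \<le> \<phi> k x" "\<And>k x. \<phi> k x \<le> 1"
    and U: "\<And>k. open (U k)" "\<And>k. C k \<subseteq> U k" "\<And>k x. x \<in> U k \<Longrightarrow> \<phi> k x = 1"
    and S: "\<And>k. compact (S k)" "\<And>k. S k \<subseteq> Y" "\<And>k x. x \<notin> S k \<Longrightarrow> \<phi> k x = 0"
      "\<And>k x. x \<notin> S k \<Longrightarrow> frechet_derivative (\<phi> k) (at x) = (\<lambda>h. 0)"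
    and m: "\<And>k. (0::real) < m k" "\<And>k x h. \<bar>frechet_derivative (\<phi> k) (at x) h\<bar> \<le> m k * norm h"
    and c: "\<And>k x. x \<in> S k \<Longrightarrow> norm (l x) \<le> c k"
    using cutoff unfolding cutoff_def by blast+
  \<comment> \<open>The function multiplied by the derivative of the cut-off will be at most 2
    \<open>tol k\<close>; times \<open>cst\<close> and \<open>m k\<close> this is exactly the
    perturbation \<open>\<epsilon>\<^sub>3\<close> allowed by the third condition.\<close>
  define tol where "tol k = \<epsilon>\<^sub>3 / (2 * cst * m k)" for k
  have tol: "0 < tol k" for k using D3(1) cst m(1) by (simp add: tol_def)
  \<comment> \<open>The requirements on the index \<open>j\<close> to be paired with the k-th
    cut-off. The bound 2 on \<open>j\<close> puts the level into the domain of
    \<open>\<Lambda>\<close>; the last two clauses control the two sources of the cut-off error, the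
    distance of \<open>v\<close> from \<open>l\<close> and that of the factor from 1.\<close>
  define P where "P k j \<longleftrightarrow> 2 \<le> j \<and> (\<forall>\<zeta>. real j \<le> norm \<zeta> \<longrightarrow> L (\<Lambda> (real j) *\<^sub>R \<zeta>) \<le> inverse (real (Suc k)) * L \<zeta>) \<and>
    (AE x in lebesgue. x \<in> S k \<longrightarrow> norm (z (s j) x) \<le> tol k) \<and> \<bar>\<Lambda> (real j) - 1\<bar> * c k \<le> tol k" for k j :: nat
  have evP: "eventually (P k) sequentially" for k
    unfolding P_def
  proof (intro eventually_conj)
    show "eventually (\<lambda>j. 2 \<le> j) sequentially" by (rule eventually_ge_at_top)
    show "eventually (\<lambda>j. \<forall>\<zeta>. real j \<le> norm \<zeta> \<longrightarrow> L (\<Lambda> (real j) *\<^sub>R \<zeta>) \<le> inverse (real (Suc k)) * L \<zeta>) sequentially"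
      by (rule eventually_compose_filterlim[OF \<Lambda>(4) filterlim_real_sequentially]) simp
    show "eventually (\<lambda>j. AE x in lebesgue. x \<in> S k \<longrightarrow> norm (z (s j) x) \<le> tol k) sequentially"
      by (rule eventually_subseq[OF s weakly_null_uniformly_small[OF assms(6) zweak S(1) _ tol]])
        (use S(2) in \<open>simp add: Y_def\<close>)
    have "(\<lambda>j. \<bar>\<Lambda> (real j) - 1\<bar> * c k) \<longlonglongrightarrow> \<bar>1 - 1\<bar> * c k" by (intro tendsto_intros \<Lambda>n)
    then have "eventually (\<lambda>j. \<bar>\<Lambda> (real j) - 1\<bar> * c k < tol k) sequentially"
      using tol[of k] by (intro order_tendstoD) auto
    then show "eventually (\<lambda>j. \<bar>\<Lambda> (real j) - 1\<bar> * c k \<le> tol k) sequentially"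
      by (rule eventually_mono) simp
  qed
  obtain h where h: "strict_mono h" "\<And>k. P k (h k)"
    by (rule strict_mono_selection[of P, OF evP]) (rule that)
  define r where "r = s \<circ> h"
  have r: "strict_mono r" unfolding r_def by (rule strict_mono_o[OF s h(1)])
  define lam where "lam k = \<Lambda> (real (h k))" for k
  have lam: "0 < lam k" "lam k < 1" for k
    using h(2)[of k] \<Lambda>(1,2)[of "real (h k)"] by (auto simp: P_def lam_def)
  have lam_lim: "lam \<longlonglongrightarrow> 1"
    using LIMSEQ_subseq_LIMSEQ[OF \<Lambda>n h(1)] by (simp add: lam_def[abs_def] o_def)
  \<comment> \<open>The cut-off acts on the difference between the scaled member and
    \<open>l\<close>, so the modified function equals \<open>l\<close> outside \<open>S k\<close>
    and the scaled member where the cut-off is 1.\<close>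
  define y where "y k x = lam k *\<^sub>R v (r k) x - l x" for k x
  have yW: "y k \<in> W1p Y p" for k
    unfolding y_def by (intro W1p_diff[OF Yo p1(3)] W1p_scaleR(1)[OF Yo p1(3)] vW lW)
  have yG: "has_weak_gradient Y (y k) (\<lambda>x. lam k *\<^sub>R V (r k) x - \<xi>)" for k
    unfolding y_def by (intro has_weak_gradient_diff[OF Yo] has_weak_gradient_scaleR[OF Yo] VG lG)
  note cut = test_function_mult_W1p0[OF Yo p1(2) yW yG \<phi>(1)]
  define w where "w k x = l x + \<phi> k x *\<^sub>R y k x" for k x
  define G where "G k x = \<xi> + (\<phi> k x *\<^sub>R (lam k *\<^sub>R V (r k) x - \<xi>) + outer_gradient (\<phi> k) (y k) x)" for k x
  have wG: "has_weak_gradient Y (w k) (G k)" for k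
  proof -
    have "has_weak_gradient Y (\<lambda>x. \<phi> k x *\<^sub>R y k x) (\<lambda>x. \<phi> k x *\<^sub>R (lam k *\<^sub>R V (r k) x - \<xi>) + outer_gradient (\<phi> k) (y k) x)"
      using cut(2)[of k k] weak_pd_subset[of UNIV _ _ _ Y] by (simp add: has_weak_gradient_iff[OF Yo] has_weak_gradient_iff[OF open_UNIV])
    then show ?thesis unfolding w_def G_def by (rule has_weak_gradient_add[OF Yo lG])
  qed
  define W where "W k = wgrad Y (w k)" for k
  have Wm[measurable]: "W k \<in> borel_measurable M" for k unfolding W_def M_def by (rule wgrad_measurable(1)[OF Yo wG])
  have WG: "AE x in M. W k x = G k x" for k unfolding W_def M_def by (rule wgrad_eq_AE[OF Yo wG])
  have small: "AE x in M. norm (outer_gradient (\<phi> k) (y k) x) \<le> \<epsilon>\<^sub>3" for k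
  proof -
    have "AE x in lebesgue. x \<in> S k \<longrightarrow> norm (z (r k) x) \<le> tol k"
      using h(2)[of k] by (simp add: P_def r_def)
    then have "AE x in lebesgue. x \<in> Y \<longrightarrow> x \<in> S k \<longrightarrow> norm (z (r k) x) \<le> tol k"
      by eventually_elim simp
    then have "AE x in M. x \<in> S k \<longrightarrow> norm (z (r k) x) \<le> tol k"
      unfolding M_def using Ys by (simp add: AE_restrict_space_iff)
    then show ?thesis
    proof eventually_elim
      case (elim x)
      show ?case
      proof (cases "x \<in> S k")
        case True
        have "y k x = lam k *\<^sub>R z (r k) x + (lam k - 1) *\<^sub>R l x"
          by (simp add: y_def z_def algebra_simps)
        then have "norm (y k x) \<le> lam k * norm (z (r k) x) + \<bar>lam k - 1\<bar> * norm (l x)"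
          using norm_triangle_ineq[of "lam k *\<^sub>R z (r k) x" "(lam k - 1) *\<^sub>R l x"] lam(1)[of k] by simp
        also have "\<dots> \<le> 1 * tol k + \<bar>lam k - 1\<bar> * c k"
          using elim True lam[of k] c[OF True] by (intro add_mono mult_mono) auto
        also have "\<dots> \<le> 2 * tol k" using h(2)[of k] by (simp add: P_def lam_def)
        finally have y: "norm (y k x) \<le> 2 * tol k" .
        have "norm (outer_gradient (\<phi> k) (y k) x) \<le> cst * (m k * norm (y k x))"
          unfolding cst_def using m[of k] by (intro norm_outer_gradient_le) auto
        also have "\<dots> \<le> cst * (m k * (2 * tol k))" using y cst m(1)[of k] by (intro mult_left_mono) auto
        also have "\<dots> = \<epsilon>\<^sub>3" using cst m(1)[of k] by (simp add: tol_def)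
        finally show ?thesis .
      next
        case False
        then have "outer_gradient (\<phi> k) (y k) x = 0" using S(4) by (simp add: outer_gradient_def vec_eq_iff)
        then show ?thesis using D3(1) by simp
      qed
    qed
  qed
  \<comment> \<open>The third condition concerns only matrices at distance at least
    \<open>c\<^sub>3\<close> from \<open>\<xi>\<close>; for the remaining ones the new gradient lies
    in this ball.\<close>
  obtain B0 where B0: "0 \<le> B0" "\<And>\<zeta>. norm \<zeta> \<le> norm \<xi> + c\<^sub>3 + \<epsilon>\<^sub>3 \<Longrightarrow> L \<zeta> \<le> B0"
    by (rule continuous_bounded_on_ball[OF Lc L0]) (rule that)
  \<comment> \<open>\<open>F\<close> is the part of the energy below the truncation level. The
    majorant \<open>H\<close> consists of a constant, a multiple of \<open>F\<close>, and the whole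
    energy with a factor tending to 0.\<close>
  define F where "F k x = f (r k) x * indicator {x. g (r k) x \<le> real (h k)} x" for k x
  define K where "K = B0 + \<alpha>\<^sub>3 + \<alpha>\<^sub>3 * \<alpha>\<^sub>2"
  have K: "0 \<le> K" using B0(1) D3(2) D2(1) by (simp add: K_def)
  define i where "i k = inverse (real (Suc k))" for k
  have i: "0 < i k" "i k \<le> 1" for k by (auto simp: i_def inverse_le_1_iff)
  define H where "H k x = K + \<alpha>\<^sub>3 * \<alpha>\<^sub>2 * F k x + \<alpha>\<^sub>3 * i k * f (r k) x" for k x
  have bound: "AE x in M. L (W k x) \<le> H k x" for k
    using small[of k] WG[of k]
  proof eventually_elim
    case (elim x)
    let ?\<zeta> = "lam k *\<^sub>R V (r k) x" and ?a = "outer_gradient (\<phi> k) (y k) x"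
    have W: "W k x = \<xi> + \<phi> k x *\<^sub>R (?\<zeta> - \<xi>) + ?a" using elim by (simp add: G_def add.assoc)
    have F0: "0 \<le> F k x" "0 \<le> i k * f (r k) x" using f0 i(1)[of k] by (auto simp: F_def)
    \<comment> \<open>Below the level the second condition applies with t = \<open>lam k\<close>,
      above it the first one, which gains the factor \<open>i k\<close>.\<close>
    have L\<zeta>: "L ?\<zeta> \<le> \<alpha>\<^sub>2 + \<alpha>\<^sub>2 * F k x + i k * f (r k) x"
    proof (cases "g (r k) x \<le> real (h k)")
      case True
      then have "L ?\<zeta> \<le> \<alpha>\<^sub>2 * (1 + F k x)" using D2(2)[of "lam k" "V (r k) x"] lam[of k] by (simp add: F_def f_def)
      then show ?thesis using F0 by (simp add: algebra_simps)
    next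
      case False
      then have "L ?\<zeta> \<le> i k * f (r k) x"
        using h(2)[of k] unfolding P_def lam_def f_def i_def g_def by simp
      then show ?thesis using F0(1) D2(1) by (simp add: add_increasing)
    qed
    have \<alpha>: "0 \<le> \<alpha>\<^sub>3 * L ?\<zeta>" using D3(2) L0 by simp
    \<comment> \<open>The sum of the bounds for the two cases that follow; both bounds are
      nonnegative, so either case can use it.\<close>
    have *: "B0 + \<alpha>\<^sub>3 * (1 + L ?\<zeta>) \<le> H k x"
    proof -
      have "\<alpha>\<^sub>3 * L ?\<zeta> \<le> \<alpha>\<^sub>3 * (\<alpha>\<^sub>2 + \<alpha>\<^sub>2 * F k x + i k * f (r k) x)" using L\<zeta> D3(2) by (intro mult_left_mono) auto
      then show ?thesis by (simp add: H_def K_def algebra_simps)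
    qed
    show ?case
    proof (cases "c\<^sub>3 \<le> norm (?\<zeta> - \<xi>)")
      case True
      have "L (W k x) \<le> \<alpha>\<^sub>3 * (1 + L ?\<zeta>)"
        unfolding W using \<phi>(2,3)[of k x] True elim(1) by (intro D3(4)) auto
      then show ?thesis using * B0(1) by linarith
    next
      case False
      have "norm (W k x) \<le> norm \<xi> + norm (\<phi> k x *\<^sub>R (?\<zeta> - \<xi>)) + norm ?a"
        unfolding W by (intro norm_triangle_le add_mono norm_triangle_ineq order_refl)
      also have "norm (\<phi> k x *\<^sub>R (?\<zeta> - \<xi>)) \<le> 1 * norm (?\<zeta> - \<xi>)"
        unfolding norm_scaleR using \<phi>(2,3)[of k x] by (intro mult_right_mono) auto
      finally have "norm (W k x) \<le> norm \<xi> + c\<^sub>3 + \<epsilon>\<^sub>3" using False elim(1) by simp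
      then have "L (W k x) \<le> B0" by (rule B0(2))
      then show ?thesis using * \<alpha> D3(2) by (simp add: distrib_left)
    qed
  qed
  have Fi: "integrable M (F k)" for k
    unfolding F_def
  proof (rule Bochner_Integration.integrable_bound[OF fi[of "r k"]])
    show "(\<lambda>x. f (r k) x * indicator {x. g (r k) x \<le> real (h k)} x) \<in> borel_measurable M" by measurable
  qed (auto simp: indicator_def)
  have Hi: "integrable M (H k)" for k unfolding H_def using Fi fi by simp
  have LWm: "(\<lambda>x. L (W k x)) \<in> borel_measurable M" for k by measurable
  have LWi: "integrable M (\<lambda>x. L (W k x))" for k
  proof (rule Bochner_Integration.integrable_bound[OF Hi LWm])
    show "AE x in M. norm (L (W k x)) \<le> norm (H k x)"
      using bound[of k] by eventually_elim (simp add: L0)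
  qed
  have equi: "equi_integrable M (\<lambda>k x. L (W k x))"
  proof (rule equi_integrableI[OF LWi L0])
    show "(LINT x|M. L (W k x)) \<le> K + \<alpha>\<^sub>3 * \<alpha>\<^sub>2 * C0 + \<alpha>\<^sub>3 * 1 * C0" for k
    proof -
      have FC: "(LINT x|M. F k x) \<le> C0"
        using f0 by (intro order_trans[OF integral_mono[OF Fi fi] fC]) (auto simp: F_def indicator_def)
      have "(LINT x|M. L (W k x)) \<le> (LINT x|M. H k x)"
        by (rule integral_mono_AE[OF LWi Hi bound])
      also have "\<dots> = K + \<alpha>\<^sub>3 * \<alpha>\<^sub>2 * (LINT x|M. F k x) + \<alpha>\<^sub>3 * i k * (LINT x|M. f (r k) x)"
        unfolding H_def using Fi fi mM by (simp add: spM)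
      also have "\<dots> \<le> K + \<alpha>\<^sub>3 * \<alpha>\<^sub>2 * C0 + \<alpha>\<^sub>3 * 1 * C0"
        using D3(2) D2(1) i[of k] FC fC C0(1) f0
        by (intro add_mono mult_mono mult_left_mono) (auto intro!: Bochner_Integration.integral_nonneg)
      finally show ?thesis .
    qed
    fix \<epsilon> :: real assume \<epsilon>: "0 < \<epsilon>"
    have "0 < \<epsilon> / (3 * (\<alpha>\<^sub>3 * \<alpha>\<^sub>2))" using \<epsilon> D3(2) D2(1) by simp
    from trunc[OF this] obtain R :: nat where R: "\<And>k. R \<le> k \<Longrightarrow>
      (LINT x|M. f (s k) x * indicator {x. real R < g (s k) x \<and> g (s k) x \<le> real k} x) < \<epsilon> / (3 * (\<alpha>\<^sub>3 * \<alpha>\<^sub>2))" by blast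
    obtain BR where BR: "0 \<le> BR" "\<And>\<zeta>. norm \<zeta> \<le> real R \<Longrightarrow> L \<zeta> \<le> BR"
      by (rule continuous_bounded_on_ball[OF Lc L0]) (rule that)
    \<comment> \<open>\<open>F\<close> is at most \<open>BR\<close> where the gradient is at most
      \<open>R\<close>, so that region contributes \<open>K1\<close> times the measure of
      \<open>E\<close>. The levels between \<open>R\<close> and \<open>h k\<close> are controlled by
      \<open>trunc\<close>, and the factor \<open>i k\<close> handles the rest; each part gets a
      third of \<open>\<epsilon>\<close>.\<close>
    define K1 where "K1 = K + \<alpha>\<^sub>3 * \<alpha>\<^sub>2 * BR"
    have K1: "0 \<le> K1" using K BR(1) D3(2) D2(1) by (simp add: K1_def)
    define \<delta> where "\<delta> = \<epsilon> / (3 * (K1 + 1))"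
    have \<delta>: "0 < \<delta>" using \<epsilon> K1 by (simp add: \<delta>_def)
    have K1\<delta>: "K1 * \<delta> \<le> \<epsilon> / 3" using \<epsilon> K1 by (simp add: \<delta>_def field_simps)
    have "(\<lambda>k. \<alpha>\<^sub>3 * i k * C0) \<longlonglongrightarrow> \<alpha>\<^sub>3 * 0 * C0"
      unfolding i_def by (intro tendsto_intros LIMSEQ_inverse_real_of_nat)
    then have "eventually (\<lambda>k. \<alpha>\<^sub>3 * i k * C0 < \<epsilon> / 3) sequentially"
      using \<epsilon> by (intro order_tendstoD) auto
    then obtain N0 where N0: "\<And>k. N0 \<le> k \<Longrightarrow> \<alpha>\<^sub>3 * i k * C0 < \<epsilon> / 3"
      by (auto simp: eventually_sequentially)
    have "(LINT x:E|M. L (W k x)) < \<epsilon>" if k: "max N0 R \<le> k" and E: "E \<in> sets M" and em: "emeasure M E < ennreal \<delta>" for k E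
    proof -
      have mE: "measure M E < \<delta>"
        using em by (simp only: M.emeasure_eq_measure ennreal_less_iff[OF measure_nonneg])
      let ?T = "\<lambda>x. f (r k) x * indicator {x. real R < g (r k) x \<and> g (r k) x \<le> real (h k)} x"
      have Ti: "integrable M ?T"
      proof (rule Bochner_Integration.integrable_bound[OF fi[of "r k"]])
        show "?T \<in> borel_measurable M" by measurable
      qed (auto simp: indicator_def)
      have Ei: "integrable M (indicator E :: _ \<Rightarrow> real)"
        using E by (intro integrable_real_indicator) (auto simp: M.emeasure_eq_measure)
      have FT: "F k x \<le> BR + ?T x" for x
        using f0[of "r k" x] BR(1) BR(2)[of "V (r k) x"] by (auto simp: F_def f_def g_def indicator_def)
      let ?B = "\<lambda>x. K1 * indicator E x + \<alpha>\<^sub>3 * \<alpha>\<^sub>2 * ?T x + \<alpha>\<^sub>3 * i k * f (r k) x"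
      have "(LINT x:E|M. L (W k x)) \<le> (LINT x|M. ?B x)"
        unfolding set_lebesgue_integral_def
      proof (rule integral_mono_AE[OF integrable_mult_indicator[OF E LWi]])
        show "integrable M ?B" using Ei Ti fi by simp
        show "AE x in M. indicator E x *\<^sub>R L (W k x) \<le> ?B x"
          using bound[of k]
        proof eventually_elim
          case (elim x)
          have "\<alpha>\<^sub>3 * \<alpha>\<^sub>2 * F k x \<le> \<alpha>\<^sub>3 * \<alpha>\<^sub>2 * (BR + ?T x)"
            using D3(2) D2(1) FT[of x] by (intro mult_left_mono) auto
          then have "L (W k x) \<le> K1 + \<alpha>\<^sub>3 * \<alpha>\<^sub>2 * ?T x + \<alpha>\<^sub>3 * i k * f (r k) x"
            using elim by (simp add: H_def K1_def distrib_left)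
          moreover have "0 \<le> \<alpha>\<^sub>3 * \<alpha>\<^sub>2 * ?T x + \<alpha>\<^sub>3 * i k * f (r k) x"
            using D3(2) D2(1) i(1)[of k] f0 by simp
          ultimately show ?case by (cases "x \<in> E") simp_all
        qed
      qed
      also have "\<dots> = K1 * measure M E + \<alpha>\<^sub>3 * \<alpha>\<^sub>2 * (LINT x|M. ?T x) + \<alpha>\<^sub>3 * i k * (LINT x|M. f (r k) x)"
        using Ei Ti fi E by simp
      also have "\<dots> < \<epsilon> / 3 + \<epsilon> / 3 + \<epsilon> / 3"
      proof (intro add_le_less_mono add_mono)
        show "K1 * measure M E \<le> \<epsilon> / 3"
          using mult_left_mono[OF less_imp_le[OF mE] K1] K1\<delta> by linarith
        \<comment> \<open>A strictly increasing sequence of naturals satisfies k \<le>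
          \<open>h k\<close>, so \<open>trunc\<close> is available at the level
          \<open>h k\<close>.\<close>
        have "R \<le> h k" using k strict_mono_imp_increasing[OF h(1), of k] by simp
        then have "(LINT x|M. ?T x) < \<epsilon> / (3 * (\<alpha>\<^sub>3 * \<alpha>\<^sub>2))" using R[of "h k"] by (simp add: r_def)
        then show "\<alpha>\<^sub>3 * \<alpha>\<^sub>2 * (LINT x|M. ?T x) \<le> \<epsilon> / 3"
          using D3(2) D2(1) by (simp add: field_simps)
        have "\<alpha>\<^sub>3 * i k * (LINT x|M. f (r k) x) \<le> \<alpha>\<^sub>3 * i k * C0"
          using fC D3(2) i(1)[of k] by (intro mult_left_mono) auto
        also have "\<dots> < \<epsilon> / 3" using N0 k by simp
        finally show "\<alpha>\<^sub>3 * i k * (LINT x|M. f (r k) x) < \<epsilon> / 3" .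
      qed
      finally show ?thesis by simp
    qed
    then show "\<exists>\<delta>>0. \<exists>N. \<forall>k\<ge>N. \<forall>E\<in>sets M. emeasure M E < ennreal \<delta> \<longrightarrow> (LINT x:E|M. L (W k x)) < \<epsilon>"
      using \<delta> by blast
  qed
  have CM: "C k \<in> sets M" for k
  proof -
    have "C k \<in> sets lebesgue" using C(1)[of k] by (simp add: compact_imp_closed)
    then show ?thesis unfolding M_def using C(2)[of k] Ys by (simp add: sets_restrict_space_iff)
  qed
  have YM: "Y \<in> sets M" using sets.top[of M] by (simp add: spM)
  \<comment> \<open>The cut-off is 1 on an open set around \<open>C k\<close>, so the tensor term
    vanishes there and the new gradient is just the scaled old one.\<close>
  have core: "AE x in M. x \<in> C k \<longrightarrow> norm (V (r k) x - W k x) = (1 - lam k) * g (r k) x" for k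
    using WG[of k]
  proof eventually_elim
    case (elim x)
    show ?case
    proof
      assume "x \<in> C k"
      then have x: "x \<in> U k" using U(2) by blast
      have "(\<phi> k has_derivative (\<lambda>h. 0)) (at x)"
        by (rule has_derivative_transform_within_open[OF has_derivative_const U(1) x]) (simp add: U(3))
      then have "frechet_derivative (\<phi> k) (at x) = (\<lambda>h. 0)" by (rule frechet_derivative_at[symmetric])
      then have "outer_gradient (\<phi> k) (y k) x = 0" by (simp add: outer_gradient_def vec_eq_iff)
      then have "V (r k) x - W k x = (1 - lam k) *\<^sub>R V (r k) x"
        using elim U(3)[OF x] by (simp add: G_def scaleR_left_diff_distrib)
      then show "norm (V (r k) x - W k x) = (1 - lam k) * g (r k) x"
        using lam(2)[of k] by (simp add: g_def)
    qed
  qed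
  have meas: "tendsto_zero_in_measure M (\<lambda>k x. norm (V (r k) x - W k x))"
    unfolding tendsto_zero_in_measure_def
  proof (intro conjI allI impI)
    show "(\<lambda>x. norm (V (r k) x - W k x)) \<in> borel_measurable M" for k by measurable
    fix e :: real assume e: "0 < e"
    let ?q = "\<lambda>k. ((1 - lam k) / e) powr p"
    have gp: "integrable M (\<lambda>x. g n x powr p)" for n
      unfolding g_def V_def M_def using LpD(2)[OF W1pD(3)[OF Yo vW]] .
    \<comment> \<open>Outside \<open>C k\<close> only the measure of the remaining set is used; on
      \<open>C k\<close> Chebyshev's inequality with the p-th power applies to the difference from
      \<open>core\<close>.\<close>
    have em: "emeasure M {x \<in> space M. e \<le> \<bar>norm (V (r k) x - W k x)\<bar>} \<le> ennreal ((1 - measure M (C k)) + ?q k * BV)" for k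
    proof -
      let ?A = "{x \<in> space M. e \<le> (1 - lam k) * g (r k) x}"
      have A: "?A \<in> sets M" by measurable
      have "emeasure M {x \<in> space M. e \<le> \<bar>norm (V (r k) x - W k x)\<bar>} \<le> emeasure M ((Y - C k) \<union> ?A)"
      proof (rule emeasure_mono_AE)
        show "AE x in M. x \<in> {x \<in> space M. e \<le> \<bar>norm (V (r k) x - W k x)\<bar>} \<longrightarrow> x \<in> (Y - C k) \<union> ?A"
          using core[of k] by eventually_elim (auto simp: spM)
      qed (use A CM YM in auto)
      also have "\<dots> = ennreal (measure M ((Y - C k) \<union> ?A))" by (rule M.emeasure_eq_measure)
      also have "\<dots> \<le> ennreal ((1 - measure M (C k)) + ?q k * BV)"
      proof (rule ennreal_leI)
        have "measure M ((Y - C k) \<union> ?A) \<le> measure M (Y - C k) + measure M ?A"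
          using A CM YM by (intro measure_Un_le) auto
        also have "measure M (Y - C k) = 1 - measure M (C k)"
          using M.finite_measure_Diff[OF YM CM C(2)] mM by simp
        also have "measure M ?A = (LINT x|M. indicator ?A x)" using A by simp
        also have "\<dots> \<le> (LINT x|M. ?q k * g (r k) x powr p)"
        proof (rule integral_mono)
          show "integrable M (indicator ?A :: _ \<Rightarrow> real)"
            using A by (intro integrable_real_indicator) (auto simp: M.emeasure_eq_measure)
          show "integrable M (\<lambda>x. ?q k * g (r k) x powr p)" using gp by simp
          show "indicator ?A x \<le> ?q k * g (r k) x powr p" for x
          proof (cases "x \<in> ?A")
            case True
            then have "1 \<le> (1 - lam k) / e * g (r k) x" using e by (simp add: field_simps)
            then have "1 powr p \<le> ((1 - lam k) / e * g (r k) x) powr p" using p1 by (intro powr_mono2) auto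
            also have "\<dots> = ?q k * g (r k) x powr p"
              by (rule powr_mult)
            finally show ?thesis using True by simp
          qed simp
        qed
        also have "\<dots> = ?q k * (LINT x|M. g (r k) x powr p)" by simp
        also have "\<dots> \<le> ?q k * BV" using BV by (intro mult_left_mono) (auto simp: g_def)
        finally show "measure M ((Y - C k) \<union> ?A) \<le> (1 - measure M (C k)) + ?q k * BV" by simp
      qed
      finally show ?thesis .
    qed
    \<comment> \<open>The compact sets increase to the cube, whose measure is 1, so the exceptional
      set outside \<open>C k\<close> disappears in the limit.\<close>
    have "(\<lambda>k. measure M (C k)) \<longlonglongrightarrow> measure M (\<Union>k. C k)"
      using C(3) interior_subset CM by (intro M.finite_Lim_measure_incseq incseq_SucI) blast+
    then have C1: "(\<lambda>k. measure M (C k)) \<longlonglongrightarrow> 1" using C(4) mM by simp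
    have "(\<lambda>k. (1 - lam k) / e) \<longlonglongrightarrow> (1 - 1) / e" using e by (intro tendsto_intros lam_lim) auto
    then have "(\<lambda>k. (1 - lam k) / e) \<longlonglongrightarrow> 0" by simp
    then have q0: "?q \<longlonglongrightarrow> 0"
      using p1 lam(2) e by (intro tendsto_zero_powrI[where b=p]) (auto intro!: always_eventually less_imp_le)
    have "(\<lambda>k. (1 - measure M (C k)) + ?q k * BV) \<longlonglongrightarrow> (1 - 1) + 0 * BV"
      by (intro tendsto_intros C1 q0)
    then have "(\<lambda>k. (1 - measure M (C k)) + ?q k * BV) \<longlonglongrightarrow> 0" by simp
    then have lim: "(\<lambda>k. ennreal ((1 - measure M (C k)) + ?q k * BV)) \<longlonglongrightarrow> 0"
      using tendsto_ennrealI by fastforce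
    show "(\<lambda>k. emeasure M {x \<in> space M. e \<le> \<bar>norm (V (r k) x - W k x)\<bar>}) \<longlonglongrightarrow> 0"
      by (rule tendsto_sandwich[OF always_eventually always_eventually tendsto_const lim]) (intro allI zero_le em)+
  qed
  have W0: "(\<lambda>x. w k x - \<xi> *v x) \<in> W1p0 Y p" for k
    using cut(1)[of k k] by (simp add: w_def l_def)
  show "\<exists>(r :: nat \<Rightarrow> nat) (w :: nat \<Rightarrow> real^'n \<Rightarrow> real^'m).
       strict_mono r \<and>
       (\<forall>n. (\<lambda>y. w n y - \<xi> *v y) \<in> W1p0 unit_cube p) \<and>
       tendsto_zero_in_measure (lebesgue_on unit_cube)
         (\<lambda>n y. norm (wgrad unit_cube (v (r n)) y - wgrad unit_cube (w n) y)) \<and>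
       equi_integrable (lebesgue_on unit_cube) (\<lambda>n y. L (wgrad unit_cube (w n) y))"
    using r W0 meas equi unfolding V_def W_def M_def Y_def by blast
qed

end
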